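(* Let $\alpha\in(0,1)$. Assume that the heat kernel satisfies, for some constant $C>0$, $$0<p_s(x,y)\lesssim \frac{1}{\mu(B(x,\sqrt s))}e^{-C d(x,y)^2/s}\qquad\text{for all } s>0,\ x,y\in\mathbb M,$$ and that the measure $\mu$ satisfies $$\inf_{(x,r)\in\mathbb M\times(0,\infty)}\frac{\mu(B(x,r))}{r^{\beta^\star}}>0 .$$ For $b>0$ and $T>0$, let $r_0=b\beta^\star/2\alpha$ and $I=[0,T)$. Assume that $r\ge r_0>1$ and that $(q,p,r)$ is a generalized admissible triplet satisfying $p>b+1$. (i) If $f\in C_{q/(b+1)}(I;L^{p/(b+1)})$, then for $p<r(b+1)$, $$\|G(f)\|_{L^\infty(I;L^r)}\lesssim T^{1-b\beta^\star/2r\alpha}\|f\|_{C_{q/(b+1)}(I;L^{p/(b+1)})} .$$ For $p\ge r(b+1)$ and $\theta=\frac{p-r(b+1)}{(b+1)(p-r)}$, $$\|G(f)\|_{L^\infty(I;L^r)}\lesssim T^{1-b\beta^\star/2r\alpha}\,\big\||f|^{1/(b+1)}\big\|^{\theta(b+1)}_{L^\infty(I;L^r)}\,\big\||f|^{1/(b+1)}\big\|^{(1-\theta)(b+1)}_{C_q(I;L^p)} .$$ (ii) If $f\in C_{q/(b+1)}(I;L^{p/(b+1)})$, then for $p<r(b+1)$, $$\|G(f)\|_{C_q(I;L^p)}\lesssim T^{1-b\beta^\star/2r\alpha}\|f\|_{C_{q/(b+1)}(I;L^{p/(b+1)})} .$$ For $p\ge r(b+1)$ and $\theta=\frac{p-r(b+1)}{(b+1)(p-r)}$,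 $$\|G(f)\|_{C_q(I;L^p)}\lesssim T^{1-b\beta^\star/2r\alpha}\,\big\||f|^{1/(b+1)}\big\|^{\theta(b+1)}_{L^\infty(I;L^r)}\,\big\||f|^{1/(b+1)}\big\|^{(1-\theta)(b+1)}_{C_q(I;L^p)} .$$
   Context: Setting: $(\mathbb M,d,\mu)$ is a metric measure space, i.e. $(\mathbb M,d)$ is a non-empty, locally compact, separable metric space and $\mu$ is a Borel measure on $\mathbb M$; $B(x,r)=\{y\in\mathbb M: d(x,y)<r\}$. $\beta^\star$ is a positive constant less than or equal to the Hausdorff dimension of $\mathbb M$. $L^p=L^p(\mathbb M)=L^p(\mathbb M,\mu)$. Heat kernel: a family $\{p_t\}_{t>0}$ of measurable functions on $\mathbb M\times\mathbb M$ such that for almost all $x,y\in\mathbb M$ and all $s,t>0$: (i) $p_t(x,y)\ge0$; (ii) $\int_{\mathbb M}p_t(x,y)\,d\mu(y)\le1$; (iii) $p_t(x,y)=p_t(y,x)$; (iv) $p_{s+t}(x,y)=\int_{\mathbb M}p_s(x,z)p_t(z,y)\,d\mu(z)$; (v) $\lim_{t\to0^+}\int_{\mathbb M}p_t(x,y)f(y)\,d\mu(y)=f(x)$ for all $f\in L^2(\mathbb M,\mu)$. It generates the semigroup $P_tf(x)=\int_{\mathbb M}p_t(x,y)f(y)\,d\mu(y)$ on $L^2(\mathbb M,\mu)$, with generator $\mathcal Lf=\lim_{t\to0}(f-P_tf)/t$ (limit in $L^2$), a self-adjoint, positive definite operator, so $P_t=e^{-t\mathcal L}$. Fractional heat semigroup: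 for $0<\alpha<1$, $e^{-t\mathcal L^\alpha}f(x)=\int_{\mathbb M}K^{\mathcal L}_{\alpha,t}(x,y)f(y)\,d\mu(y)$ with $K^{\mathcal L}_{\alpha,t}(x,y)=\int_0^\infty\eta^\alpha_t(s)p_s(x,y)\,ds$, where $\eta^\alpha_t$ is the non-negative continuous subordination density, satisfying $\eta^\alpha_t(s)=t^{-1/\alpha}\eta^\alpha_1(s/t^{1/\alpha})$; $\eta^\alpha_t(s)\lesssim t/s^{1+\alpha}$ for all $s,t>0$; $\int_0^\infty s^{-\gamma}\eta^\alpha_1(s)\,ds<\infty$ for $\gamma>0$; $\eta^\alpha_t(s)\simeq t/s^{1+\alpha}$ for $s\ge t^{1/\alpha}>0$. Duhamel term: $G(f)(t,x)=\int_0^te^{-(t-\tau)\mathcal L^\alpha}f(\tau,\cdot)(x)\,d\tau$. Generalized admissible triplet: $(q,p,r)$ with $\frac1q=\frac{\beta^\star}{2\alpha}\big(\frac1r-\frac1p\big)$, where $1<r\le p<\frac{\beta^\star r}{\beta^\star-2\alpha r}$ if $\beta^\star>2r\alpha$, and $1<r\le p<\infty$ if $\beta^\star\le2r\alpha$. (If $p=r$ then $q=\infty$.) Function spaces: for a Banach space $\mathbb X$ and $I=[0,T)$, $C(I;\mathbb X)$ is the space of continuous functions $I\to\mathbb X$; $C_\sigma(I;\mathbb X)=\{f\in C(I;\mathbb X):\ \|f\|_{C_\sigma(I;\mathbb X)}=\sup_{t\in I}t^{1/\sigma}\|f(t)\|_{\mathbb X}<\infty\}$ (with $t^{1/\infty}=1$);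 $L^\infty(I;\mathbb X)$ is the usual space of essentially bounded functions of time with values in $\mathbb X$. $X\lesssim Y$ means $X\le cY$ with a constant $c>0$ independent of the main parameters (here of $f$ and $T$); $X\simeq Y$ means $X\lesssim Y\lesssim X$.
   Formalization: The English allows r = r_0, where some estimates fail on R^n. Excluded: p = r = r_0 in the estimates for p < r(b+1); r = r_0 in (i) for p ≥ r(b+1); and r = r_0 with p = r(b+1) in (ii). All other cases are kept. *)

theory Defs
  imports "HOL-Analysis.Analysis" "HOL-Probability.Essential_Supremum"
begin

(* Hausdorff dimension. Covers are restricted to bounded sets because the library's
   diameter is unspecified on unbounded ones. Only exponents s > 0 are used, so no
   convention for 0 to the power 0 is needed; the infimum over s > 0 is still 0 for a
   zero-dimensional set, and it is infinite if no s qualifies. *)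

definition hausdorff_premeasure :: "real \<Rightarrow> real \<Rightarrow> 'a::metric_space set \<Rightarrow> ennreal" where
  "hausdorff_premeasure s \<delta> A =
     (INF U \<in> {U :: nat \<Rightarrow> 'a set. A \<subseteq> (\<Union>i. U i) \<and> (\<forall>i. bounded (U i) \<and> diameter (U i) \<le> \<delta>)}.
        \<Sum>i. ennreal (diameter (U i) powr s))"

definition hausdorff_measure :: "real \<Rightarrow> 'a::metric_space set \<Rightarrow> ennreal" where
  "hausdorff_measure s A = (SUP \<delta>\<in>{0<..}. hausdorff_premeasure s \<delta> A)"

definition hausdorff_dim :: "'a::metric_space set \<Rightarrow> ennreal" where
  "hausdorff_dim A = Inf {ennreal s | s. 0 < s \<and> hausdorff_measure s A = 0}"


(* The space is the whole type, which is nonempty. *)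

definition metric_measure_space :: "'a::metric_space measure \<Rightarrow> bool" where
  "metric_measure_space M \<longleftrightarrow>
     locally compact (UNIV :: 'a set) \<and> separable_space (euclidean :: 'a topology) \<and>
     sets M = sets borel"


(* Power of an extended nonnegative number with exponent a \<ge> 0, where x to the power 0
   is 1 for every x (real powr has 0 powr 0 = 0). *)

definition epow :: "ennreal \<Rightarrow> real \<Rightarrow> ennreal" where
  "epow x a = (if a = 0 then 1 else if x = \<infinity> then \<infinity> else ennreal (enn2real x powr a))"

(* Elements of L^p are represented by functions, equality being equality almost everywhere.
   Measurability and integrals over the space refer to the completion of M: a heat kernel is
   controlled only up to a null set of pairs (x,y), so that kernel integrals are Borel
   functions only after modification on null sets. *)

definition Lp_enorm :: "'a measure \<Rightarrow> real \<Rightarrow> ('a \<Rightarrow> real) \<Rightarrow> ennreal" where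
  "Lp_enorm M p f = epow (\<integral>\<^sup>+ x. ennreal (\<bar>f x\<bar> powr p) \<partial>(completion M)) (1 / p)"

definition Lp_space :: "'a measure \<Rightarrow> real \<Rightarrow> ('a \<Rightarrow> real) set" where
  "Lp_space M p = {f \<in> borel_measurable (completion M). Lp_enorm M p f < \<infinity>}"


(* Functions of time with values in L^p, on the interval [0,T). *)

definition C_Lp :: "real \<Rightarrow> 'a measure \<Rightarrow> real \<Rightarrow> (real \<Rightarrow> 'a \<Rightarrow> real) set" where
  "C_Lp T M p = {F. \<forall>t\<in>{0..<T}. F t \<in> Lp_space M p \<and>
     ((\<lambda>s. Lp_enorm M p (\<lambda>x. F s x - F t x)) \<longlongrightarrow> 0) (at t within {0..<T})}"

definition time_weight :: "ennreal \<Rightarrow> real \<Rightarrow> real" where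
  "time_weight \<sigma> t = (if \<sigma> = \<infinity> then 1 else t powr (1 / enn2real \<sigma>))"

(* Both norms below are infinite outside the respective space, so that a finite bound
   on such a norm includes membership in the space. *)

definition C_norm :: "real \<Rightarrow> ennreal \<Rightarrow> 'a measure \<Rightarrow> real \<Rightarrow> (real \<Rightarrow> 'a \<Rightarrow> real) \<Rightarrow> ennreal" where
  "C_norm T \<sigma> M p F =
     (if F \<in> C_Lp T M p
      then SUP t\<in>{0..<T}. ennreal (time_weight \<sigma> t) * Lp_enorm M p (F t) else \<infinity>)"

definition C_space :: "real \<Rightarrow> ennreal \<Rightarrow> 'a measure \<Rightarrow> real \<Rightarrow> (real \<Rightarrow> 'a \<Rightarrow> real) set" where
  "C_space T \<sigma> M p = {F \<in> C_Lp T M p. C_norm T \<sigma> M p F < \<infinity>}"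

(* Bochner (strong) measurability: almost everywhere limit in L^p of simple functions of time. *)

definition bochner_measurable :: "real \<Rightarrow> 'a measure \<Rightarrow> real \<Rightarrow> (real \<Rightarrow> 'a \<Rightarrow> real) \<Rightarrow> bool" where
  "bochner_measurable T M p F \<longleftrightarrow>
     (\<exists>S :: nat \<Rightarrow> real \<Rightarrow> 'a \<Rightarrow> real.
        (\<forall>n. finite (S n ` {0..<T}) \<and> S n ` {0..<T} \<subseteq> Lp_space M p \<and>
             (\<forall>g. {t \<in> {0..<T}. S n t = g} \<in> sets lebesgue)) \<and>
        (AE t in lebesgue_on {0..<T}.
           F t \<in> Lp_space M p \<and> (\<lambda>n. Lp_enorm M p (\<lambda>x. S n t x - F t x)) \<longlonglongrightarrow> 0))"

definition Linf_norm :: "real \<Rightarrow> 'a measure \<Rightarrow> real \<Rightarrow> (real \<Rightarrow> 'a \<Rightarrow> real) \<Rightarrow> ennreal" where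
  "Linf_norm T M p F =
     (if bochner_measurable T M p F
      then esssup (lebesgue_on {0..<T}) (\<lambda>t. Lp_enorm M p (F t)) else \<infinity>)"


definition heat_op :: "'a measure \<Rightarrow> (real \<Rightarrow> 'a \<Rightarrow> 'a \<Rightarrow> real) \<Rightarrow> real \<Rightarrow> ('a \<Rightarrow> real) \<Rightarrow> 'a \<Rightarrow> real" where
  "heat_op M h t f x = (LINT y|completion M. h t x y * f y)"

definition heat_kernel :: "'a measure \<Rightarrow> (real \<Rightarrow> 'a \<Rightarrow> 'a \<Rightarrow> real) \<Rightarrow> bool" where
  "heat_kernel M h \<longleftrightarrow>
     (\<forall>t>0. (\<lambda>(x, y). h t x y) \<in> borel_measurable (M \<Otimes>\<^sub>M M)) \<and>
     (AE (x, y) in M \<Otimes>\<^sub>M M. \<forall>s>0. \<forall>t>0.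
        0 \<le> h t x y \<and>
        (\<integral>\<^sup>+ z. ennreal (h t x z) \<partial>M) \<le> 1 \<and>
        h t x y = h t y x \<and>
        ennreal (h (s + t) x y) = (\<integral>\<^sup>+ z. ennreal (h s x z * h t z y) \<partial>M)) \<and>
     (\<forall>f \<in> Lp_space M 2.
        ((\<lambda>t. Lp_enorm M 2 (\<lambda>x. heat_op M h t f x - f x)) \<longlongrightarrow> 0) (at_right 0))"

(* The density \<eta> t of the \<alpha>-stable subordinator at time t: the continuous nonnegative function
   on (0,\<infinity>) with Laplace transform l \<mapsto> exp (- t l^\<alpha>), which determines it uniquely on (0,\<infinity>);
   this is the identity that makes subordination turn exp (- s L) into exp (- t L^\<alpha>). *)

definition subordination_density :: "real \<Rightarrow> (real \<Rightarrow> real \<Rightarrow> real) \<Rightarrow> bool" where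
  "subordination_density \<alpha> \<eta> \<longleftrightarrow>
     (\<forall>t>0. continuous_on {0<..} (\<eta> t) \<and> (\<forall>s>0. 0 \<le> \<eta> t s) \<and>
        (\<forall>l\<ge>0. (\<integral>\<^sup>+ s\<in>{0<..}. ennreal (exp (- l * s) * \<eta> t s) \<partial>lborel)
                 = ennreal (exp (- t * l powr \<alpha>))))"

definition frac_heat_kernel ::
    "(real \<Rightarrow> real \<Rightarrow> real) \<Rightarrow> (real \<Rightarrow> 'a \<Rightarrow> 'a \<Rightarrow> real) \<Rightarrow> real \<Rightarrow> 'a \<Rightarrow> 'a \<Rightarrow> real" where
  "frac_heat_kernel \<eta> h t x y = (LINT s:{0<..}|lborel. \<eta> t s * h s x y)"

definition frac_heat_op ::
    "'a measure \<Rightarrow> (real \<Rightarrow> real \<Rightarrow> real) \<Rightarrow> (real \<Rightarrow> 'a \<Rightarrow> 'a \<Rightarrow> real) \<Rightarrow>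
     real \<Rightarrow> ('a \<Rightarrow> real) \<Rightarrow> 'a \<Rightarrow> real" where
  "frac_heat_op M \<eta> h t f x = (LINT y|completion M. frac_heat_kernel \<eta> h t x y * f y)"

(* The end point \<tau> = t, where the kernel of the semigroup does not exist, is left out. *)

definition duhamel ::
    "'a measure \<Rightarrow> (real \<Rightarrow> real \<Rightarrow> real) \<Rightarrow> (real \<Rightarrow> 'a \<Rightarrow> 'a \<Rightarrow> real) \<Rightarrow>
     (real \<Rightarrow> 'a \<Rightarrow> real) \<Rightarrow> real \<Rightarrow> 'a \<Rightarrow> real" where
  "duhamel M \<eta> h f t x = (LINT \<tau>:{0<..<t}|lborel. frac_heat_op M \<eta> h (t - \<tau>) (f \<tau>) x)"

(* Bochner integrals of non-integrable functions are 0 by convention; this predicate says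
   that, at almost every x, duhamel M \<eta> h f t x does not involve that convention. *)

definition duhamel_converges ::
    "'a measure \<Rightarrow> (real \<Rightarrow> real \<Rightarrow> real) \<Rightarrow> (real \<Rightarrow> 'a \<Rightarrow> 'a \<Rightarrow> real) \<Rightarrow>
     (real \<Rightarrow> 'a \<Rightarrow> real) \<Rightarrow> real \<Rightarrow> bool" where
  "duhamel_converges M \<eta> h f t \<longleftrightarrow>
     (AE x in M.
        (AE y in M. \<forall>s>0. set_integrable lborel {0<..} (\<lambda>\<sigma>. \<eta> s \<sigma> * h \<sigma> x y)) \<and>
        (AE \<tau> in lborel. \<tau> \<in> {0<..<t} \<longrightarrow>
           integrable (completion M) (\<lambda>y. frac_heat_kernel \<eta> h (t - \<tau>) x y * f \<tau> y)) \<and>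
        set_integrable lborel {0<..<t} (\<lambda>\<tau>. frac_heat_op M \<eta> h (t - \<tau>) (f \<tau>) x))"

(* p is real, hence p < \<infinity>; with 1/\<infinity> = 0 in ennreal, q = \<infinity> exactly when p = r. *)

definition generalized_admissible :: "real \<Rightarrow> real \<Rightarrow> ennreal \<Rightarrow> real \<Rightarrow> real \<Rightarrow> bool" where
  "generalized_admissible \<alpha> \<beta> q p r \<longleftrightarrow>
     1 / q = ennreal (\<beta> / (2 * \<alpha>) * (1 / r - 1 / p)) \<and> 1 < r \<and> r \<le> p \<and>
     (\<beta> > 2 * r * \<alpha> \<longrightarrow> p < \<beta> * r / (\<beta> - 2 * \<alpha> * r))"

(* End points in the theorem. All estimates are claimed for r \<ge> r0 = b \<beta> / (2 \<alpha>), as far as they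
   are true. The exceptions, in which the time integral of the bounds diverges and already the
   Gauss kernel on R^n gives counterexamples, are
     p < r (b + 1):        p = r = r0                    (both estimates; excluded by r0 < p),
     p \<ge> r (b + 1), (i):   r = r0                        (excluded by r0 < r),
     p \<ge> r (b + 1), (ii):  r = r0 and p = r (b + 1)     (excluded by r0 < r or r (b + 1) < p). *)

end

theory Submission
  imports Defs "HOL-Real_Asymp.Real_Asymp"
begin

text \<open>
  Write \<gamma> = \<beta> / (2 \<alpha>) and let K_t be the kernel of exp (- t L^\<alpha>). The estimates rest on
  two properties of K_t: it is nonnegative with total mass at most 1 in either variable, and it is
  bounded by C t^(-\<gamma>). The second one comes from the heat kernel bound and the volume growth, which give
  h_s(x,y) \<le> c s^(-\<beta>/2), and from the negative moment of the subordinator,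
  integral of s^(-\<beta>/2) \<eta>_t(s) ds \<le> Q t^(-\<gamma>).
  By Jensen's inequality the two properties give the smoothing estimate
  ||K_t f||_n \<le> C' t^(-\<gamma> (1/m - 1/n)) ||f||_m for 1 \<le> m \<le> n (lemma smoothing).

  Inserting this in the Duhamel integral with Minkowski's inequality (time_Minkowski) leaves one
  integral over time, of (t - \<tau>)^(-a) \<tau>^(-w), with a = \<gamma> (1/m - 1/n) and \<tau>^(-w) the growth that the
  weighted norm of f allows. It is a multiple of t^(1 - a - w) if a, w < 1, and in all cases
  1 - a - w is 1 - b \<beta> / (2 r \<alpha>), up to the weight of the left-hand side (exponents). For p < r (b + 1)
  the source exponent m is p / (b + 1). For p \<ge> r (b + 1) that exponent is at least r, and the weight that
  comes with it may be too singular at \<tau> = 0; so m = r is used instead, and the L^r norm of f(\<tau>) is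
  interpolated between the two norms of |f|^(1/(b+1)), which is what \<theta> stands for (C_Lp_interpolation).

  In the second estimate for p > r (b + 1) the critical case r = r0 has w = 1, and this integral
  diverges. There the exponent m is perturbed to both sides, which makes \<tau>^(-1) into \<tau>^(-1+d) for
  small times and into \<tau>^(-1-d) for large times. Splitting the time interval at a point that depends
  on the ratio of the two norms makes both halves contribute the same product of powers of the two
  norms (duhamel_int_past_critical), as in the real method of interpolation.

  Two questions of measurability take some work. The heat kernel is given for every time separately,
  and up to null sets of pairs (x,y), so joint measurability in time and space has to be derived:
  the semigroup law and the strong continuity in L^2 make the time dependence right-continuous for
  almost every (x,y) (exceptional_set). The subordination density is measurable in its time
  parameter because it scales, which is a consequence of the uniqueness of Laplace transforms
  (subordination_scaling). The function f is a family of representatives chosen independently at each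
  time; its continuity in L^m allows approximation by functions that are piecewise constant in time.

  The norms on the left-hand side include membership in the space, hence continuity in time of the
  Duhamel integral as a map into L^n (duhamel_int_past_C_Lp). It follows from uniform continuity of f
  on compact time intervals, since a < 1 makes the singularity of the kernel integrable.
\<close>

section \<open>Integrals of powers and the weighted Jensen inequality\<close>

text \<open>The p-th power of the L^p norm. Bounds in terms of it avoid roots of extended numbers,
  and it makes sense for all p > 0; the exponent r / (b + 1) can be below 1.\<close>
definition energy :: "'a measure \<Rightarrow> real \<Rightarrow> ('a \<Rightarrow> real) \<Rightarrow> ennreal" where
  "energy M p f = (\<integral>\<^sup>+ x. ennreal (\<bar>f x\<bar> powr p) \<partial>completion M)"

lemma epow_ennreal: "0 \<le> c \<Longrightarrow> a \<noteq> 0 \<Longrightarrow> epow (ennreal c) a = ennreal (c powr a)"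
  by (simp add: epow_def)

lemma epow_le_iff:
  assumes "0 < a" "0 \<le> c"
  shows "epow x a \<le> ennreal c \<longleftrightarrow> x \<le> ennreal (c powr (1 / a))"
proof (cases x)
  case (real y)
  have "y powr a \<le> c \<longleftrightarrow> y \<le> c powr (1 / a)"
  proof
    assume "y powr a \<le> c"
    then have "(y powr a) powr (1 / a) \<le> c powr (1 / a)" using assms by (intro powr_mono2) auto
    then show "y \<le> c powr (1 / a)" using assms real by (simp add: powr_powr)
  next
    assume "y \<le> c powr (1 / a)"
    then have "y powr a \<le> (c powr (1 / a)) powr a" using assms real by (intro powr_mono2) auto
    then show "y powr a \<le> c" using assms by (simp add: powr_powr)
  qed
  then show ?thesis using real assms by (simp add: epow_ennreal)
next
  case top
  then show ?thesis using assms by (simp add: epow_def top_unique)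
qed

lemma Lp_enorm_le_iff:
  assumes "0 < p" "0 \<le> c"
  shows "Lp_enorm M p f \<le> ennreal c \<longleftrightarrow> energy M p f \<le> ennreal (c powr p)"
  using epow_le_iff[of "1 / p" c "energy M p f"] assms by (simp add: Lp_enorm_def energy_def)

lemma Lp_enorm_less_top_iff:
  assumes "0 < p"
  shows "Lp_enorm M p f < top \<longleftrightarrow> energy M p f < top"
  using assms by (auto simp: Lp_enorm_def energy_def epow_def less_top infinity_ennreal_def)

lemma Lp_spaceD:
  assumes "f \<in> Lp_space M p" "0 < p"
  shows "f \<in> borel_measurable (completion M)" "energy M p f < top"
  using assms by (auto simp: Lp_space_def Lp_enorm_less_top_iff infinity_ennreal_def)

lemma Lp_spaceI:
  assumes "f \<in> borel_measurable (completion M)" "energy M p f < top" "0 < p"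
  shows "f \<in> Lp_space M p"
  using assms by (auto simp: Lp_space_def Lp_enorm_less_top_iff infinity_ennreal_def)

lemma energy_cong_AE:
  assumes "AE x in M. f x = g x"
  shows "energy M p f = energy M p g"
  unfolding energy_def nn_integral_completion
  by (rule nn_integral_cong_AE) (use assms in auto)

lemma Lp_enorm_minus_commute: "Lp_enorm M p (\<lambda>x. f x - g x) = Lp_enorm M p (\<lambda>x. g x - f x)"
  by (simp add: Lp_enorm_def abs_minus_commute)

lemma energy_zero: "0 < p \<Longrightarrow> energy M p (\<lambda>x. 0) = 0"
  by (simp add: energy_def)

lemma energy_eq_0_AE:
  assumes "f \<in> borel_measurable (completion M)" "energy M p f = 0" "0 < p"
  shows "AE x in M. f x = 0"
proof -
  have "AE x in completion M. ennreal (\<bar>f x\<bar> powr p) = 0"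
    using assms by (subst nn_integral_0_iff_AE[symmetric]) (auto simp: energy_def)
  then show ?thesis by (simp add: AE_completion_iff)
qed

lemma abs_add_powr_le:
  fixes u v :: real
  assumes "0 < p"
  shows "\<bar>u + v\<bar> powr p \<le> 2 powr p * (\<bar>u\<bar> powr p + \<bar>v\<bar> powr p)"
proof -
  have "\<bar>u + v\<bar> powr p \<le> (2 * max \<bar>u\<bar> \<bar>v\<bar>) powr p"
    using assms by (intro powr_mono2) auto
  also have "\<dots> = 2 powr p * max \<bar>u\<bar> \<bar>v\<bar> powr p" by (simp add: powr_mult)
  also have "\<dots> \<le> 2 powr p * (\<bar>u\<bar> powr p + \<bar>v\<bar> powr p)"
    by (intro mult_left_mono) (auto simp: max_def)
  finally show ?thesis .
qed

text \<open>A quasi-triangle inequality valid for every p > 0. It suffices wherever only convergence or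
  boundedness matters.\<close>
lemma energy_add_le:
  assumes [measurable]: "f \<in> borel_measurable (completion M)" "g \<in> borel_measurable (completion M)"
    and "0 < p"
  shows "energy M p (\<lambda>x. f x + g x) \<le> ennreal (2 powr p) * (energy M p f + energy M p g)"
proof -
  have "energy M p (\<lambda>x. f x + g x)
      \<le> (\<integral>\<^sup>+ x. ennreal (2 powr p) * (ennreal (\<bar>f x\<bar> powr p) + ennreal (\<bar>g x\<bar> powr p)) \<partial>completion M)"
    unfolding energy_def
    by (intro nn_integral_mono)
      (simp add: ennreal_plus[symmetric] ennreal_mult[symmetric] abs_add_powr_le assms del: ennreal_plus)
  also have "\<dots> = ennreal (2 powr p) * (energy M p f + energy M p g)"
    unfolding energy_def by (simp add: nn_integral_cmult nn_integral_add)
  finally show ?thesis .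
qed

lemma energy_diff_le:
  assumes [measurable]: "f \<in> borel_measurable (completion M)" "g \<in> borel_measurable (completion M)"
    and "0 < p"
  shows "energy M p (\<lambda>x. f x - g x) \<le> ennreal (2 powr p) * (energy M p f + energy M p g)"
  using energy_add_le[of f M "\<lambda>x. - g x" p] assms by (simp add: energy_def)

lemma ennreal_lincomb:
  "0 \<le> A \<Longrightarrow> 0 \<le> B \<Longrightarrow> 0 \<le> C \<Longrightarrow> 0 \<le> D \<Longrightarrow>
    ennreal A * ennreal B + ennreal C * ennreal D = ennreal (A * B + C * D)"
  by (simp add: ennreal_mult[symmetric] ennreal_plus[symmetric] del: ennreal_plus)

lemma ennreal_le_lincomb:
  "X \<le> A * B + C * D \<Longrightarrow> 0 \<le> A \<Longrightarrow> 0 \<le> B \<Longrightarrow> 0 \<le> C \<Longrightarrow> 0 \<le> D \<Longrightarrow>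
    ennreal X \<le> ennreal A * ennreal B + ennreal C * ennreal D"
  by (simp only: ennreal_lincomb ennreal_leI)

text \<open>Jensen's inequality for a measure w of total mass at most W, which is also Hoelder's inequality
  for the pair of exponents m and m / (m - 1). It is obtained by integrating Young's inequality
  v \<le> v^m a^(1-m) / m + (1 - 1/m) a, the tangent line bound at a, and choosing a = (Z / W)^(1/m).
  All norm inequalities below are instances of it.\<close>
lemma nn_integral_weighted_Jensen:
  fixes w u :: "'a \<Rightarrow> real"
  assumes [measurable]: "w \<in> borel_measurable M" "u \<in> borel_measurable M"
    and w0: "\<And>x. 0 \<le> w x" and u0: "\<And>x. 0 \<le> u x" and m: "1 \<le> m" and W0: "0 < W" and Z0: "0 \<le> Z"
    and W: "(\<integral>\<^sup>+ x. ennreal (w x) \<partial>M) \<le> ennreal W"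
    and Z: "(\<integral>\<^sup>+ x. ennreal (w x * u x powr m) \<partial>M) \<le> ennreal Z"
  shows "(\<integral>\<^sup>+ x. ennreal (w x * u x) \<partial>M) \<le> ennreal (W powr (1 - 1 / m) * Z powr (1 / m))"
proof -
  have young: "v \<le> v powr m * (a powr (1 - m) / m) + (m - 1) / m * a" if "0 \<le> v" "0 < a" for v a :: real
  proof -
    have "(v powr m * a powr (1 - m)) powr (1 / m) * a powr (1 - 1 / m)
        \<le> (1 / m) * (v powr m * a powr (1 - m)) + (1 - 1 / m) * a"
      using Youngs_inequality_0[of "1 / m" "1 - 1 / m" "v powr m * a powr (1 - m)" a] that m
      by (cases "v = 0") (auto simp: field_simps)
    moreover have "(v powr m * a powr (1 - m)) powr (1 / m) * a powr (1 - 1 / m) = v"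
      using that m by (simp add: powr_mult powr_powr powr_add[symmetric] diff_divide_distrib)
    ultimately show ?thesis using m by (simp add: field_simps)
  qed
  have key: "(\<integral>\<^sup>+ x. ennreal (w x * u x) \<partial>M) \<le> ennreal (Z * (a powr (1 - m) / m) + (m - 1) / m * a * W)"
    if a: "0 < a" for a
  proof -
    have "(\<integral>\<^sup>+ x. ennreal (w x * u x) \<partial>M)
      \<le> (\<integral>\<^sup>+ x. ennreal (a powr (1 - m) / m) * ennreal (w x * u x powr m) + ennreal ((m - 1) / m * a) * ennreal (w x) \<partial>M)"
    proof (intro nn_integral_mono)
      fix x
      have "w x * u x \<le> w x * (u x powr m * (a powr (1 - m) / m) + (m - 1) / m * a)"
        using young[OF u0 a] w0 by (intro mult_left_mono) auto
      then show "ennreal (w x * u x) \<le> ennreal (a powr (1 - m) / m) * ennreal (w x * u x powr m) + ennreal ((m - 1) / m * a) * ennreal (w x)"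
        using w0 u0 a m by (subst ennreal_lincomb) (auto intro!: ennreal_leI simp: algebra_simps)
    qed
    also have "\<dots> = ennreal (a powr (1 - m) / m) * (\<integral>\<^sup>+ x. ennreal (w x * u x powr m) \<partial>M)
        + ennreal ((m - 1) / m * a) * (\<integral>\<^sup>+ x. ennreal (w x) \<partial>M)"
      by (simp add: nn_integral_add nn_integral_cmult)
    also have "\<dots> \<le> ennreal (a powr (1 - m) / m) * ennreal Z + ennreal ((m - 1) / m * a) * ennreal W"
      by (intro add_mono mult_left_mono W Z) auto
    also have "\<dots> = ennreal (Z * (a powr (1 - m) / m) + (m - 1) / m * a * W)"
      using Z0 W0 a m by (simp add: ennreal_mult[symmetric] ennreal_plus[symmetric] mult_ac del: ennreal_plus)
    finally show ?thesis .
  qed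
  show ?thesis
  proof (cases "Z = 0")
    case True
    have small: "(\<integral>\<^sup>+ x. ennreal (w x * u x) \<partial>M) \<le> ennreal e" if "0 < e" for e
    proof -
      have "(\<integral>\<^sup>+ x. ennreal (w x * u x) \<partial>M) \<le> ennreal ((m - 1) / m * (e / W) * W)"
        using key[of "e / W"] True that W0 by simp
      also have "\<dots> \<le> ennreal e" using that W0 m by (intro ennreal_leI) (simp add: field_simps)
      finally show ?thesis .
    qed
    have "(\<integral>\<^sup>+ x. ennreal (w x * u x) \<partial>M) \<le> 0"
      by (rule ennreal_le_epsilon) (use small in simp)
    then show ?thesis using True m by simp
  next
    case False
    define a where "a = (Z / W) powr (1 / m)"
    have a: "0 < a" using False Z0 W0 by (simp add: a_def)
    have am: "a powr m = Z / W" using m W0 Z0 by (simp add: a_def powr_powr)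
    have "Z * a powr (1 - m) = a * W"
      using am a W0 by (simp add: powr_diff field_simps)
    moreover have "a * W = W powr (1 - 1 / m) * Z powr (1 / m)"
      using W0 Z0 by (simp add: a_def powr_divide powr_diff field_simps)
    ultimately have "Z * (a powr (1 - m) / m) + (m - 1) / m * a * W = W powr (1 - 1 / m) * Z powr (1 / m)"
      using m by (simp add: field_simps)
    with key[OF a] show ?thesis by simp
  qed
qed

text \<open>Convexity of the p-th power at u / l and v / (1 - l). Taking l as the share of the norm of f in
  the sum of both norms turns this into the triangle inequality after integration.\<close>
lemma convex_powr_le:
  fixes u v :: real
  assumes p: "1 \<le> p" and "0 \<le> u" "0 \<le> v" and l: "0 < l" "l < 1"
  shows "(u + v) powr p \<le> l powr (1 - p) * u powr p + (1 - l) powr (1 - p) * v powr p"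
proof -
  have ge1: "1 \<le> t powr (1 - p)" if "0 < t" "t < 1" for t :: real
    using powr_mono'[of "1 - p" 0 t] that p by simp
  consider "u = 0" | "v = 0" | "0 < u" "0 < v" using assms by force
  then show ?thesis
  proof cases
    case 1
    then show ?thesis using mult_right_mono[OF ge1[of "1 - l"], of "v powr p"] l by simp
  next
    case 2
    then show ?thesis using mult_right_mono[OF ge1[of l], of "u powr p"] l by simp
  next
    case 3
    have "((1 - l) *\<^sub>R (v / (1 - l)) + l *\<^sub>R (u / l)) powr p
        \<le> (1 - l) * (v / (1 - l)) powr p + l * (u / l) powr p"
      using convex_onD[OF powr_convex[OF p], of l "v / (1 - l)" "u / l"] 3 l by simp
    then have "(v + u) powr p \<le> (1 - l) * (v powr p / (1 - l) powr p) + l * (u powr p / l powr p)"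
      using 3 l by (simp add: powr_divide)
    also have "(1 - l) * (v powr p / (1 - l) powr p) = (1 - l) powr (1 - p) * v powr p"
      using l by (simp add: powr_diff)
    also have "l * (u powr p / l powr p) = l powr (1 - p) * u powr p"
      using l by (simp add: powr_diff)
    finally show ?thesis by (simp add: add.commute)
  qed
qed

lemma energy_triangle:
  assumes [measurable]: "f \<in> borel_measurable (completion M)" "g \<in> borel_measurable (completion M)"
    and p: "1 \<le> p" and F: "0 < F" "energy M p f \<le> ennreal (F powr p)"
    and G: "0 < G" "energy M p g \<le> ennreal (G powr p)"
  shows "energy M p (\<lambda>x. f x + g x) \<le> ennreal ((F + G) powr p)"
proof -
  define l where "l = F / (F + G)"
  have l: "0 < l" "l < 1" "1 - l = G / (F + G)" using F G by (auto simp: l_def field_simps)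
  have "energy M p (\<lambda>x. f x + g x)
      \<le> (\<integral>\<^sup>+ x. ennreal (l powr (1 - p)) * ennreal (\<bar>f x\<bar> powr p)
          + ennreal ((1 - l) powr (1 - p)) * ennreal (\<bar>g x\<bar> powr p) \<partial>completion M)"
    unfolding energy_def
  proof (intro nn_integral_mono)
    fix x
    have "\<bar>f x + g x\<bar> powr p \<le> (\<bar>f x\<bar> + \<bar>g x\<bar>) powr p"
      using p by (intro powr_mono2) auto
    also have "\<dots> \<le> l powr (1 - p) * \<bar>f x\<bar> powr p + (1 - l) powr (1 - p) * \<bar>g x\<bar> powr p"
      by (intro convex_powr_le p l) auto
    finally show "ennreal (\<bar>f x + g x\<bar> powr p) \<le> ennreal (l powr (1 - p)) * ennreal (\<bar>f x\<bar> powr p)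
          + ennreal ((1 - l) powr (1 - p)) * ennreal (\<bar>g x\<bar> powr p)"
      by (rule ennreal_le_lincomb) auto
  qed
  also have "\<dots> = ennreal (l powr (1 - p)) * energy M p f + ennreal ((1 - l) powr (1 - p)) * energy M p g"
    unfolding energy_def by (simp add: nn_integral_add nn_integral_cmult)
  also have "\<dots> \<le> ennreal (l powr (1 - p)) * ennreal (F powr p) + ennreal ((1 - l) powr (1 - p)) * ennreal (G powr p)"
    by (intro add_mono mult_left_mono F G) auto
  also have "\<dots> = ennreal (l powr (1 - p) * F powr p + (1 - l) powr (1 - p) * G powr p)"
    by (subst ennreal_lincomb) auto
  also have "l powr (1 - p) * F powr p + (1 - l) powr (1 - p) * G powr p = (F + G) powr p"
  proof -
    have "F powr p = l powr p * (F + G) powr p" "G powr p = (1 - l) powr p * (F + G) powr p"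
      using F G l by (simp_all only: l_def l(3) powr_divide) simp_all
    then have "l powr (1 - p) * F powr p + (1 - l) powr (1 - p) * G powr p
        = (l powr (1 - p) * l powr p + (1 - l) powr (1 - p) * (1 - l) powr p) * (F + G) powr p"
      by (simp add: algebra_simps)
    also have "\<dots> = (F + G) powr p"
      using l(1,2) by (simp add: powr_add[symmetric])
    finally show ?thesis .
  qed
  finally show ?thesis .
qed

text \<open>Lyapunov's inequality: this is Jensen's inequality with weight |f|^m0 for the function
  |f|^(m - m0), whose power of order (m1 - m0) / (m - m0) is |f|^(m1 - m0).\<close>
lemma energy_interpolation:
  assumes [measurable]: "f \<in> borel_measurable (completion M)"
    and ord: "0 < m0" "m0 < m" "m \<le> m1" and F0: "0 < F0" "energy M m0 f \<le> ennreal F0"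
    and F1: "0 \<le> F1" "energy M m1 f \<le> ennreal F1"
  shows "energy M m f \<le> ennreal (F0 powr ((m1 - m) / (m1 - m0)) * F1 powr ((m - m0) / (m1 - m0)))"
proof -
  define \<kappa> where "\<kappa> = (m1 - m0) / (m - m0)"
  have k: "1 \<le> \<kappa>" "1 / \<kappa> = (m - m0) / (m1 - m0)" "1 - 1 / \<kappa> = (m1 - m) / (m1 - m0)"
    using ord by (auto simp: \<kappa>_def field_simps)
  have split: "\<bar>z\<bar> powr m = \<bar>z\<bar> powr m0 * \<bar>z\<bar> powr (m - m0)"
    "\<bar>z\<bar> powr m1 = \<bar>z\<bar> powr m0 * (\<bar>z\<bar> powr (m - m0)) powr \<kappa>" for z :: real
    using ord by (auto simp: powr_add[symmetric] powr_powr \<kappa>_def)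
  have "(\<integral>\<^sup>+ x. ennreal (\<bar>f x\<bar> powr m0 * \<bar>f x\<bar> powr (m - m0)) \<partial>completion M)
      \<le> ennreal (F0 powr (1 - 1 / \<kappa>) * F1 powr (1 / \<kappa>))"
    using F0 F1 k by (intro nn_integral_weighted_Jensen) (auto simp: energy_def split(2))
  then show ?thesis unfolding energy_def split(1) k(2)[symmetric] k(3)[symmetric] .
qed

section \<open>Continuous functions of time with values in L^p\<close>

lemma tendsto_0_ennreal_iff:
  fixes f :: "'b \<Rightarrow> ennreal"
  shows "(f \<longlongrightarrow> 0) F \<longleftrightarrow> (\<forall>\<epsilon>>0. \<forall>\<^sub>F x in F. f x \<le> ennreal \<epsilon>)"
proof
  assume "(f \<longlongrightarrow> 0) F"
  then show "\<forall>\<epsilon>>0. \<forall>\<^sub>F x in F. f x \<le> ennreal \<epsilon>"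
    by (auto dest!: order_tendstoD(2)[where a = "ennreal _"] elim!: eventually_mono)
next
  assume *: "\<forall>\<epsilon>>0. \<forall>\<^sub>F x in F. f x \<le> ennreal \<epsilon>"
  show "(f \<longlongrightarrow> 0) F"
  proof (rule order_tendstoI)
    fix a :: ennreal assume "0 < a"
    then obtain e :: real where "0 < e" "ennreal e < a"
      by (metis dense ennreal_less_zero_iff ennreal_cases less_trans top.not_eq_extremum not_less_zero)
    with *[rule_format, of e] show "\<forall>\<^sub>F x in F. f x < a"
      by (auto elim!: eventually_mono)
  qed simp
qed

lemma C_LpD:
  assumes "F \<in> C_Lp T M p" "t \<in> {0..<T}"
  shows "F t \<in> Lp_space M p"
    "((\<lambda>s. Lp_enorm M p (\<lambda>x. F s x - F t x)) \<longlongrightarrow> 0) (at t within {0..<T})"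
  using assms by (auto simp: C_Lp_def)

lemma C_Lp_LIMSEQ_enorm:
  assumes F: "F \<in> C_Lp T M p" and p: "0 < p" and s: "\<And>n. s n \<in> {0..<T}" "s \<longlonglongrightarrow> t" and t: "t \<in> {0..<T}"
  shows "(\<lambda>n. Lp_enorm M p (\<lambda>x. F (s n) x - F t x)) \<longlonglongrightarrow> 0"
proof -
  let ?\<phi> = "\<lambda>s. Lp_enorm M p (\<lambda>x. F s x - F t x)"
  have 0: "?\<phi> t = 0" using p by (simp add: Lp_enorm_def epow_def)
  have "continuous (at t within {0..<T}) ?\<phi>"
    unfolding continuous_within 0 using C_LpD[OF F t] by simp
  from continuous_within_tendsto_compose'[OF this s] show ?thesis unfolding 0 .
qed

lemma C_Lp_LIMSEQ:
  assumes F: "F \<in> C_Lp T M p" and p: "0 < p" and s: "\<And>n. s n \<in> {0..<T}" "s \<longlonglongrightarrow> t" and t: "t \<in> {0..<T}"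
  shows "(\<lambda>n. energy M p (\<lambda>x. F (s n) x - F t x)) \<longlonglongrightarrow> 0"
  unfolding tendsto_0_ennreal_iff
proof (intro allI impI)
  fix \<epsilon> :: real assume e: "0 < \<epsilon>"
  have "\<forall>\<^sub>F n in sequentially. Lp_enorm M p (\<lambda>x. F (s n) x - F t x) \<le> ennreal (\<epsilon> powr (1 / p))"
    using C_Lp_LIMSEQ_enorm[OF assms] e unfolding tendsto_0_ennreal_iff by auto
  then show "\<forall>\<^sub>F n in sequentially. energy M p (\<lambda>x. F (s n) x - F t x) \<le> ennreal \<epsilon>"
    using p e by (auto elim!: eventually_mono simp: Lp_enorm_le_iff powr_powr)
qed

lemma C_LpI:
  assumes "\<And>t. t \<in> {0..<T} \<Longrightarrow> F t \<in> Lp_space M p"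
    and "\<And>t \<epsilon>. t \<in> {0..<T} \<Longrightarrow> 0 < \<epsilon> \<Longrightarrow>
      \<exists>\<delta>>0. \<forall>s\<in>{0..<T}. \<bar>s - t\<bar> < \<delta> \<longrightarrow> Lp_enorm M p (\<lambda>x. F s x - F t x) \<le> ennreal \<epsilon>"
  shows "F \<in> C_Lp T M p"
  unfolding C_Lp_def tendsto_0_ennreal_iff eventually_at dist_real_def
  using assms by fast

text \<open>The Heine-Cantor argument, with the quasi-triangle inequality in place of a metric.\<close>
lemma C_Lp_uniformly_continuous:
  assumes F: "F \<in> C_Lp T M p" and p: "0 < p" and R: "R < T" and e: "0 < \<epsilon>"
  shows "\<exists>\<delta>>0. \<forall>s\<in>{0..R}. \<forall>t\<in>{0..R}. \<bar>s - t\<bar> < \<delta> \<longrightarrow> energy M p (\<lambda>x. F s x - F t x) \<le> ennreal \<epsilon>"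
proof (rule ccontr)
  assume "\<not> ?thesis"
  then have "\<forall>n::nat. \<exists>s t. s \<in> {0..R} \<and> t \<in> {0..R} \<and> \<bar>s - t\<bar> < 1 / Suc n \<and>
      \<not> energy M p (\<lambda>x. F s x - F t x) \<le> ennreal \<epsilon>"
    by (metis of_nat_0_less_iff zero_less_Suc zero_less_divide_1_iff)
  then obtain s t where st: "\<And>n. s n \<in> {0..R}" "\<And>n. t n \<in> {0..R}" "\<And>n::nat. \<bar>s n - t n\<bar> < 1 / Suc n"
    "\<And>n. \<not> energy M p (\<lambda>x. F (s n) x - F (t n) x) \<le> ennreal \<epsilon>"
    by metis
  obtain l r where lr: "l \<in> {0..R}" "strict_mono (r :: nat \<Rightarrow> nat)" "(s \<circ> r) \<longlonglongrightarrow> l"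
    using compact_imp_seq_compact[of "{0..R}"] st(1) unfolding seq_compact_def by (metis compact_Icc)
  have l: "l \<in> {0..<T}" using lr R by auto
  have sub: "s n \<in> {0..<T}" "t n \<in> {0..<T}" for n using st(1,2)[of n] R by auto
  have "(\<lambda>n. \<bar>s n - t n\<bar>) \<longlonglongrightarrow> 0"
    by (rule tendsto_sandwich[OF _ _ tendsto_const LIMSEQ_inverse_real_of_nat])
      (use st(3) in \<open>auto simp: inverse_eq_divide less_imp_le\<close>)
  then have "(\<lambda>n. s n - t n) \<longlonglongrightarrow> 0" by (simp add: tendsto_rabs_zero_iff)
  then have "((\<lambda>n. s n - t n) \<circ> r) \<longlonglongrightarrow> 0" by (rule LIMSEQ_subseq_LIMSEQ[OF _ lr(2)])
  from tendsto_diff[OF lr(3) this] have tr: "(t \<circ> r) \<longlonglongrightarrow> l" by (simp add: o_def)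
  have "(\<lambda>n. ennreal (2 powr p) * (energy M p (\<lambda>x. F ((s \<circ> r) n) x - F l x) + energy M p (\<lambda>x. F ((t \<circ> r) n) x - F l x)))
      \<longlonglongrightarrow> ennreal (2 powr p) * (0 + 0)"
    by (intro ennreal_tendsto_cmult tendsto_add C_Lp_LIMSEQ[OF F p] lr tr l) (use sub in auto)
  then have "\<forall>\<^sub>F n in sequentially. ennreal (2 powr p) * (energy M p (\<lambda>x. F ((s \<circ> r) n) x - F l x) + energy M p (\<lambda>x. F ((t \<circ> r) n) x - F l x)) \<le> ennreal \<epsilon>"
    using e by (simp add: tendsto_0_ennreal_iff)
  then obtain n where n: "ennreal (2 powr p) * (energy M p (\<lambda>x. F ((s \<circ> r) n) x - F l x) + energy M p (\<lambda>x. F ((t \<circ> r) n) x - F l x)) \<le> ennreal \<epsilon>"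
    by (rule eventually_happens'[OF sequentially_bot, THEN exE])
  have [measurable]: "F u \<in> borel_measurable (completion M)" if "u \<in> {0..<T}" for u
    using C_LpD(1)[OF F that] p by (rule Lp_spaceD)
  have "energy M p (\<lambda>x. F (s (r n)) x - F (t (r n)) x)
      = energy M p (\<lambda>x. (F (s (r n)) x - F l x) - (F (t (r n)) x - F l x))" by simp
  also have "\<dots> \<le> ennreal (2 powr p) * (energy M p (\<lambda>x. F (s (r n)) x - F l x) + energy M p (\<lambda>x. F (t (r n)) x - F l x))"
    using sub l p by (intro energy_diff_le) auto
  also have "\<dots> \<le> ennreal \<epsilon>" using n by simp
  finally show False using st(4) by blast
qed

lemma C_Lp_bounded:
  assumes F: "F \<in> C_Lp T M p" and p: "0 < p" and R: "R < T"
  shows "\<exists>K>0. \<forall>t\<in>{0..R}. energy M p (F t) \<le> ennreal (K powr p)"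
proof (rule ccontr)
  assume no: "\<not> ?thesis"
  have "\<forall>n::nat. \<exists>t. t \<in> {0..R} \<and> \<not> energy M p (F t) \<le> ennreal ((real (Suc n) powr (1/p)) powr p)"
  proof
    fix n :: nat
    have "0 < real (Suc n) powr (1/p)" by simp
    with no show "\<exists>t. t \<in> {0..R} \<and> \<not> energy M p (F t) \<le> ennreal ((real (Suc n) powr (1/p)) powr p)"
      by blast
  qed
  then obtain t where t: "\<And>n. t n \<in> {0..R}" "\<And>n::nat. \<not> energy M p (F (t n)) \<le> ennreal (real (Suc n))"
    using p by (simp add: powr_powr) metis
  obtain l r where lr: "l \<in> {0..R}" "strict_mono (r :: nat \<Rightarrow> nat)" "(t \<circ> r) \<longlonglongrightarrow> l"
    using compact_imp_seq_compact[of "{0..R}"] t(1) unfolding seq_compact_def by (metis compact_Icc)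
  have l: "l \<in> {0..<T}" using lr R by auto
  have sub: "t n \<in> {0..<T}" for n using t(1)[of n] R by auto
  have "(\<lambda>n. energy M p (\<lambda>x. F ((t \<circ> r) n) x - F l x)) \<longlonglongrightarrow> 0"
    by (intro C_Lp_LIMSEQ[OF F p] lr l) (use sub in auto)
  then have ev: "\<forall>\<^sub>F n in sequentially. energy M p (\<lambda>x. F ((t \<circ> r) n) x - F l x) \<le> ennreal 1"
    unfolding tendsto_0_ennreal_iff by (rule allE[where x = 1]) simp
  obtain e where e: "0 \<le> e" "energy M p (F l) = ennreal e"
    using Lp_spaceD(2)[OF C_LpD(1)[OF F l] p] by (cases "energy M p (F l)") auto
  obtain N where N: "\<And>n. N \<le> n \<Longrightarrow> energy M p (\<lambda>x. F ((t \<circ> r) n) x - F l x) \<le> ennreal 1"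
    using ev by (auto simp: eventually_sequentially)
  have [measurable]: "F u \<in> borel_measurable (completion M)" if "u \<in> {0..<T}" for u
    using C_LpD(1)[OF F that] p by (rule Lp_spaceD)
  define n where "n = max N (nat \<lceil>2 powr p * (1 + e)\<rceil>)"
  have "energy M p (F (t (r n))) = energy M p (\<lambda>x. (F (t (r n)) x - F l x) + F l x)" by simp
  also have "\<dots> \<le> ennreal (2 powr p) * (energy M p (\<lambda>x. F (t (r n)) x - F l x) + energy M p (F l))"
    using sub l p by (intro energy_add_le) auto
  also have "\<dots> \<le> ennreal (2 powr p) * (ennreal 1 + ennreal e)"
    using N[of n] e by (intro mult_left_mono add_mono) (auto simp: n_def)
  also have "\<dots> = ennreal (2 powr p * (1 + e))"
    using e by (simp add: ennreal_mult)
  also have "\<dots> \<le> ennreal (real (Suc (r n)))"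
  proof (rule ennreal_leI)
    have "2 powr p * (1 + e) \<le> real (nat \<lceil>2 powr p * (1 + e)\<rceil>)" by linarith
    also have "\<dots> \<le> real n" by (simp add: n_def)
    also have "\<dots> \<le> real (Suc (r n))" using seq_suble[OF lr(2), of n] by simp
    finally show "2 powr p * (1 + e) \<le> real (Suc (r n))" .
  qed
  finally show False using t(2) by blast
qed

text \<open>The essential supremum is infinite on functions that are not measurable, so the norm has to be
  shown to depend measurably on time. This needs the exact triangle inequality.\<close>
lemma C_Lp_continuous_enorm:
  assumes F: "F \<in> C_Lp T M p" and p: "1 \<le> p"
  shows "continuous_on {0..<T} (\<lambda>t. enn2real (Lp_enorm M p (F t)))"
    and "\<And>t. t \<in> {0..<T} \<Longrightarrow> Lp_enorm M p (F t) = ennreal (enn2real (Lp_enorm M p (F t)))"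
proof -
  have p0: "0 < p" using p by simp
  have fin: "Lp_enorm M p (F t) = ennreal (enn2real (Lp_enorm M p (F t)))" if "t \<in> {0..<T}" for t
    using C_LpD(1)[OF F that] by (simp add: Lp_space_def)
  then show "\<And>t. t \<in> {0..<T} \<Longrightarrow> Lp_enorm M p (F t) = ennreal (enn2real (Lp_enorm M p (F t)))" .
  have m[measurable]: "F u \<in> borel_measurable (completion M)" if "u \<in> {0..<T}" for u
    using C_LpD(1)[OF F that] p0 by (rule Lp_spaceD)
  let ?n = "\<lambda>t. enn2real (Lp_enorm M p (F t))"
  have step: "?n s \<le> ?n t + \<epsilon>"
    if s: "s \<in> {0..<T}" and t: "t \<in> {0..<T}" and e: "0 < \<epsilon>"
      and le: "Lp_enorm M p (\<lambda>x. F s x - F t x) \<le> ennreal (\<epsilon> / 2)" for s t \<epsilon>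
  proof -
    have "energy M p (\<lambda>x. (F s x - F t x) + F t x) \<le> ennreal ((\<epsilon> / 2 + (?n t + \<epsilon> / 2)) powr p)"
    proof (rule energy_triangle)
      show "energy M p (\<lambda>x. F s x - F t x) \<le> ennreal ((\<epsilon> / 2) powr p)"
        using le p0 e by (simp add: Lp_enorm_le_iff)
      have "Lp_enorm M p (F t) \<le> ennreal (?n t + \<epsilon> / 2)"
        using e by (subst fin[OF t]) (auto intro!: ennreal_leI)
      then show "energy M p (F t) \<le> ennreal ((?n t + \<epsilon> / 2) powr p)"
        using e p0 by (subst (asm) Lp_enorm_le_iff) auto
      show "0 < ?n t + \<epsilon> / 2" using e by (simp add: add_nonneg_pos)
    qed (use m[OF s] m[OF t] p e in auto)
    then have "Lp_enorm M p (F s) \<le> ennreal (?n t + \<epsilon>)"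
      using p0 e by (subst Lp_enorm_le_iff) (auto simp: add_ac)
    then show ?thesis using e by (intro enn2real_leI) auto
  qed
  show "continuous_on {0..<T} ?n"
    unfolding continuous_on_iff
  proof (intro ballI allI impI)
    fix t \<epsilon> :: real assume t: "t \<in> {0..<T}" and e: "0 < \<epsilon>"
    have "\<forall>\<^sub>F s in at t within {0..<T}. Lp_enorm M p (\<lambda>x. F s x - F t x) \<le> ennreal (\<epsilon> / 2 / 2)"
      using tendsto_0_ennreal_iff[THEN iffD1, OF C_LpD(2)[OF F t], rule_format, of "\<epsilon> / 2 / 2"] e by simp
    then obtain d where d: "0 < d" "\<And>s. s \<in> {0..<T} \<Longrightarrow> s \<noteq> t \<Longrightarrow> dist s t < d \<Longrightarrow>
        Lp_enorm M p (\<lambda>x. F s x - F t x) \<le> ennreal (\<epsilon> / 2 / 2)"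
      unfolding eventually_at by blast
    have "dist (?n s) (?n t) < \<epsilon>" if s: "s \<in> {0..<T}" "dist s t < d" for s
    proof (cases "s = t")
      case False
      have "?n s \<le> ?n t + \<epsilon> / 2" "?n t \<le> ?n s + \<epsilon> / 2"
        using d(2)[OF s(1) False s(2)] s t e Lp_enorm_minus_commute[of M p "F s" "F t"]
        by (auto intro!: step)
      then show ?thesis using e by (simp add: dist_real_def)
    qed (use e in simp)
    then show "\<exists>d>0. \<forall>s\<in>{0..<T}. dist s t < d \<longrightarrow> dist (?n s) (?n t) < \<epsilon>"
      using d(1) by blast
  qed
qed

text \<open>Rounding the time down to a multiple of 1 / (n + 1) stays inside [0,T) and gives simple functions.\<close>
lemma C_Lp_bochner_measurable:
  assumes F: "F \<in> C_Lp T M p" and p: "0 < p"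
  shows "bochner_measurable T M p F"
proof -
  define \<phi> where "\<phi> = (\<lambda>(n::nat) t::real. \<lfloor>real (Suc n) * t\<rfloor>)"
  define \<sigma> where "\<sigma> = (\<lambda>n t. real_of_int (\<phi> n t) / real (Suc n))"
  have \<sigma>: "\<sigma> n t \<in> {0..<T}" "t - 1 / real (Suc n) \<le> \<sigma> n t" "\<sigma> n t \<le> t" if "t \<in> {0..<T}" for n t
  proof -
    have "real (Suc n) * t - 1 \<le> real_of_int (\<phi> n t)" "real_of_int (\<phi> n t) \<le> real (Suc n) * t"
      unfolding \<phi>_def by linarith+
    then show 1: "t - 1 / real (Suc n) \<le> \<sigma> n t" "\<sigma> n t \<le> t"
      unfolding \<sigma>_def
      by (simp_all add: pos_le_divide_eq pos_divide_le_eq right_diff_distrib mult.commute del: of_nat_Suc)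
    have "0 \<le> \<phi> n t" using that by (simp add: \<phi>_def)
    then show "\<sigma> n t \<in> {0..<T}" using 1 that by (simp add: \<sigma>_def)
  qed
  have lim: "(\<lambda>n. \<sigma> n t) \<longlonglongrightarrow> t" if "t \<in> {0..<T}" for t
  proof (rule tendsto_sandwich)
    show "(\<lambda>n. t - 1 / real (Suc n)) \<longlonglongrightarrow> t"
      using tendsto_diff[OF tendsto_const LIMSEQ_inverse_real_of_nat, of t] by (simp add: inverse_eq_divide)
  qed (use \<sigma>[OF that] in auto)
  have fin: "finite (\<phi> n ` {0..<T})" for n
  proof (rule finite_subset)
    show "\<phi> n ` {0..<T} \<subseteq> {0..\<lfloor>real (Suc n) * T\<rfloor>}"
      by (auto simp: \<phi>_def intro!: floor_mono mult_left_mono)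
  qed simp
  show ?thesis
    unfolding bochner_measurable_def
  proof (intro exI[of _ "\<lambda>n t. F (\<sigma> n t)"] conjI allI)
    fix n
    have "(\<lambda>t. F (\<sigma> n t)) ` {0..<T} = (\<lambda>i. F (real_of_int i / real (Suc n))) ` \<phi> n ` {0..<T}"
      by (simp add: image_image \<sigma>_def)
    then show "finite ((\<lambda>t. F (\<sigma> n t)) ` {0..<T})" using fin by simp
    show "(\<lambda>t. F (\<sigma> n t)) ` {0..<T} \<subseteq> Lp_space M p"
      using \<sigma>(1) C_LpD(1)[OF F] by auto
    fix g
    have "{t \<in> {0..<T}. F (\<sigma> n t) = g} = {0..<T} \<inter> \<phi> n -` {i. F (real_of_int i / real (Suc n)) = g}"
      by (auto simp: \<sigma>_def)
    moreover have "\<phi> n -` {i. F (real_of_int i / real (Suc n)) = g} \<inter> space borel \<in> sets borel"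
      by (rule measurable_sets[where A = "count_space UNIV"]) (auto simp: \<phi>_def)
    ultimately show "{t \<in> {0..<T}. F (\<sigma> n t) = g} \<in> sets lebesgue"
      by (auto intro!: sets.Int sets_completionI_sets)
  next
    show "AE t in lebesgue_on {0..<T}. F t \<in> Lp_space M p \<and>
        (\<lambda>n. Lp_enorm M p (\<lambda>x. F (\<sigma> n t) x - F t x)) \<longlonglongrightarrow> 0"
      by (intro AE_I2) (auto intro!: C_LpD(1)[OF F] C_Lp_LIMSEQ_enorm[OF F p] \<sigma>(1) lim)
  qed
qed

lemma C_Lp_Linf_norm_le:
  assumes F: "F \<in> C_Lp T M p" and p: "1 \<le> p"
    and le: "\<And>t. t \<in> {0..<T} \<Longrightarrow> Lp_enorm M p (F t) \<le> X"
  shows "Linf_norm T M p F \<le> X"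
proof -
  let ?n = "\<lambda>t. enn2real (Lp_enorm M p (F t))"
  have [measurable]: "?n \<in> borel_measurable (lebesgue_on {0..<T})"
    using C_Lp_continuous_enorm(1)[OF F p] by (intro continuous_imp_measurable_on_sets_lebesgue) auto
  have "(\<lambda>t. ennreal (?n t)) \<in> borel_measurable (lebesgue_on {0..<T})" by measurable
  then have "(\<lambda>t. Lp_enorm M p (F t)) \<in> borel_measurable (lebesgue_on {0..<T})"
    by (rule measurable_cong[THEN iffD1, rotated]) (use C_Lp_continuous_enorm(2)[OF F p] in auto)
  then have "esssup (lebesgue_on {0..<T}) (\<lambda>t. Lp_enorm M p (F t)) \<le> X"
    by (intro esssup_I AE_I2) (auto intro: le)
  then show ?thesis using C_Lp_bochner_measurable[OF F] p by (simp add: Linf_norm_def)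
qed

text \<open>An L^m0 bound at almost every time extends to every time: a sequence of good times converging to t
  fast enough in L^m1 converges almost everywhere in space, and Fatou's lemma applies.\<close>
lemma C_Lp_energy_bound_everywhere:
  assumes F: "F \<in> C_Lp T M m1" and m: "0 < m0" "0 < m1"
    and AE: "AE t in lebesgue_on {0..<T}. energy M m0 (F t) \<le> K" and t: "t \<in> {0..<T}"
  shows "energy M m0 (F t) \<le> K"
proof -
  define G where "G = {s \<in> {0..<T}. energy M m0 (F s) \<le> K}"
  have dense: "\<exists>s\<in>G. t < s \<and> s < t + d" if "0 < d" for d
  proof (rule ccontr)
    assume no: "\<not> ?thesis"
    define e where "e = min (t + d) T"
    have e: "t < e" using that t by (simp add: e_def)
    have "AE s in lebesgue. s \<in> {0..<T} \<longrightarrow> energy M m0 (F s) \<le> K"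
      using AE by (subst (asm) AE_restrict_space_iff) auto
    then have "AE s in lebesgue. s \<notin> {t<..<e}"
      by (rule AE_mp) (intro AE_I2, use no t in \<open>auto simp: G_def e_def\<close>)
    then have "{t<..<e} \<in> null_sets lebesgue"
      by (subst (asm) AE_iff_null_sets[symmetric]) auto
    then show False using e by (auto simp: null_sets_def)
  qed
  have "\<exists>s\<in>G. energy M m1 (\<lambda>x. F s x - F t x) \<le> ennreal ((1/2) ^ n)" for n
  proof -
    have "\<exists>s. \<forall>k::nat. s k \<in> G \<and> t < s k \<and> s k < t + 1 / Suc k"
    proof (intro choice allI)
      fix k :: nat
      show "\<exists>s. s \<in> G \<and> t < s \<and> s < t + 1 / Suc k"
        using dense[of "1 / Suc k"] by auto
    qed
    then obtain s where s: "\<And>k::nat. s k \<in> G \<and> t < s k \<and> s k < t + 1 / Suc k" by blast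
    have "s \<longlonglongrightarrow> t"
    proof (rule tendsto_sandwich[OF _ _ tendsto_const])
      show "(\<lambda>k. t + 1 / real (Suc k)) \<longlonglongrightarrow> t"
        using tendsto_add[OF tendsto_const LIMSEQ_inverse_real_of_nat, of t] by (simp add: inverse_eq_divide)
      show "\<forall>\<^sub>F k in sequentially. t \<le> s k" "\<forall>\<^sub>F k in sequentially. s k \<le> t + 1 / real (Suc k)"
        by (intro always_eventually allI less_imp_le; use s in blast)+
    qed
    then have "(\<lambda>k. energy M m1 (\<lambda>x. F (s k) x - F t x)) \<longlonglongrightarrow> 0"
      by (intro C_Lp_LIMSEQ[OF F m(2) _ _ t]) (use s in \<open>auto simp: G_def\<close>)
    then have "\<forall>\<^sub>F k in sequentially. energy M m1 (\<lambda>x. F (s k) x - F t x) \<le> ennreal ((1/2) ^ n)"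
      unfolding tendsto_0_ennreal_iff by simp
    then obtain k where "energy M m1 (\<lambda>x. F (s k) x - F t x) \<le> ennreal ((1/2) ^ n)"
      by (rule eventually_happens'[OF sequentially_bot, THEN exE])
    then show ?thesis using s by blast
  qed
  \<comment> \<open>Summable energies force convergence almost everywhere along the whole sequence.\<close>
  then obtain s where s: "\<And>n. s n \<in> G" "\<And>n. energy M m1 (\<lambda>x. F (s n) x - F t x) \<le> ennreal ((1/2) ^ n)"
    by metis
  have sT: "s n \<in> {0..<T}" for n using s(1) by (auto simp: G_def)
  have meas: "F u \<in> borel_measurable (completion M)" if "u \<in> {0..<T}" for u
    using C_LpD(1)[OF F that] m(2) by (rule Lp_spaceD)
  have [measurable]: "F (s n) \<in> borel_measurable (completion M)" "F t \<in> borel_measurable (completion M)" for n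
    using meas sT t by auto
  have "(\<integral>\<^sup>+ x. (\<Sum>n. ennreal (\<bar>F (s n) x - F t x\<bar> powr m1)) \<partial>completion M)
      = (\<Sum>n. energy M m1 (\<lambda>x. F (s n) x - F t x))"
    unfolding energy_def by (rule nn_integral_suminf) measurable
  also have "\<dots> \<le> (\<Sum>n. ennreal ((1/2) ^ n))"
    by (intro suminf_le s(2)) auto
  also have "\<dots> < top"
    by (subst suminf_ennreal2) (auto intro!: summable_geometric)
  finally have "AE x in completion M. (\<Sum>n. ennreal (\<bar>F (s n) x - F t x\<bar> powr m1)) \<noteq> top"
    by (intro nn_integral_PInf_AE[unfolded infinity_ennreal_def]) (auto simp: less_top)
  then have conv: "AE x in completion M. (\<lambda>n. F (s n) x) \<longlonglongrightarrow> F t x"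
  proof (rule AE_mp, intro AE_I2 impI)
    fix x assume fin: "(\<Sum>n. ennreal (\<bar>F (s n) x - F t x\<bar> powr m1)) \<noteq> top"
    then have "summable (\<lambda>n. \<bar>F (s n) x - F t x\<bar> powr m1)"
      by (intro summable_suminf_not_top) auto
    then have "(\<lambda>n. \<bar>F (s n) x - F t x\<bar> powr m1) \<longlonglongrightarrow> 0" by (rule summable_LIMSEQ_zero)
    then have "(\<lambda>n. (\<bar>F (s n) x - F t x\<bar> powr m1) powr (1 / m1)) \<longlonglongrightarrow> 0 powr (1 / m1)"
      using m by (intro tendsto_powr') auto
    then have "(\<lambda>n. F (s n) x - F t x) \<longlonglongrightarrow> 0"
      using m by (simp add: powr_powr tendsto_rabs_zero_iff)
    then show "(\<lambda>n. F (s n) x) \<longlonglongrightarrow> F t x" by (simp add: LIM_zero_iff)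
  qed
  have "energy M m0 (F t) \<le> (\<integral>\<^sup>+ x. liminf (\<lambda>n. ennreal (\<bar>F (s n) x\<bar> powr m0)) \<partial>completion M)"
    unfolding energy_def
  proof (rule nn_integral_mono_AE, rule AE_mp[OF conv], intro AE_I2 impI)
    fix x assume "(\<lambda>n. F (s n) x) \<longlonglongrightarrow> F t x"
    then have "(\<lambda>n. ennreal (\<bar>F (s n) x\<bar> powr m0)) \<longlonglongrightarrow> ennreal (\<bar>F t x\<bar> powr m0)"
      using m by (intro tendsto_ennrealI tendsto_powr' tendsto_rabs tendsto_const) auto
    then show "ennreal (\<bar>F t x\<bar> powr m0) \<le> liminf (\<lambda>n. ennreal (\<bar>F (s n) x\<bar> powr m0))"
      by (intro eq_refl lim_imp_Liminf[OF sequentially_bot, symmetric])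
  qed
  also have "\<dots> \<le> liminf (\<lambda>n. energy M m0 (F (s n)))"
    unfolding energy_def by (rule nn_integral_liminf) measurable
  also have "\<dots> \<le> limsup (\<lambda>n. energy M m0 (F (s n)))"
    by (rule Liminf_le_Limsup) simp
  also have "\<dots> \<le> K"
    by (rule Limsup_bounded) (use s(1) in \<open>auto simp: G_def\<close>)
  finally show ?thesis .
qed

text \<open>Continuity in L^m1 and boundedness in L^m0 give continuity in between, by interpolating the
  increments.\<close>
lemma C_Lp_intermediate:
  assumes F: "F \<in> C_Lp T M m1" and m: "0 < m0" "m0 < m" "m \<le> m1" and K: "0 \<le> K"
    and bd: "\<And>t. t \<in> {0..<T} \<Longrightarrow> energy M m0 (F t) \<le> ennreal K"
  shows "F \<in> C_Lp T M m"
proof -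
  have m1: "0 < m1" "0 < m" using m by auto
  have meas: "F u \<in> borel_measurable (completion M)" if "u \<in> {0..<T}" for u
    using C_LpD(1)[OF F that] m1(1) by (rule Lp_spaceD)
  show ?thesis
  proof (rule C_LpI)
    fix t assume t: "t \<in> {0..<T}"
    obtain e where e: "0 \<le> e" "energy M m1 (F t) = ennreal e"
      using Lp_spaceD(2)[OF C_LpD(1)[OF F t] m1(1)] by (cases "energy M m1 (F t)") auto
    have "energy M m (F t) \<le> ennreal ((K + 1) powr ((m1 - m) / (m1 - m0)) * e powr ((m - m0) / (m1 - m0)))"
      by (rule energy_interpolation[OF meas[OF t] m])
        (use e K bd[OF t] in \<open>auto intro: order_trans ennreal_leI\<close>)
    then show "F t \<in> Lp_space M m"
      using meas[OF t] m1 by (intro Lp_spaceI) (auto intro: le_less_trans)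
    fix \<epsilon> :: real assume eps: "0 < \<epsilon>"
    define L where "L = 2 powr m0 * (2 * K) + 1"
    have L: "0 < L" using K by (simp add: L_def add_nonneg_pos)
    define a where "a = (m1 - m) / (m1 - m0)"
    define b where "b = (m - m0) / (m1 - m0)"
    have ab: "0 < b" using m by (simp add: b_def)
    define \<eta> where "\<eta> = (\<epsilon> powr m / L powr a) powr (1 / b)"
    have \<eta>: "0 < \<eta>" using eps L by (simp add: \<eta>_def)
    have "\<forall>\<^sub>F s in at t within {0..<T}. Lp_enorm M m1 (\<lambda>x. F s x - F t x) \<le> ennreal (\<eta> powr (1 / m1))"
      using tendsto_0_ennreal_iff[THEN iffD1, OF C_LpD(2)[OF F t], rule_format, of "\<eta> powr (1 / m1)"] \<eta> by simp
    then obtain d where d: "0 < d" "\<And>s. s \<in> {0..<T} \<Longrightarrow> s \<noteq> t \<Longrightarrow> dist s t < d \<Longrightarrow>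
        Lp_enorm M m1 (\<lambda>x. F s x - F t x) \<le> ennreal (\<eta> powr (1 / m1))"
      unfolding eventually_at by blast
    have "Lp_enorm M m (\<lambda>x. F s x - F t x) \<le> ennreal \<epsilon>" if s: "s \<in> {0..<T}" "\<bar>s - t\<bar> < d" for s
    proof (cases "s = t")
      case True
      then show ?thesis using m1 by (simp add: Lp_enorm_def epow_def infinity_ennreal_def)
    next
      case False
      have 1: "energy M m1 (\<lambda>x. F s x - F t x) \<le> ennreal \<eta>"
        using d(2)[OF s(1) False] s(2) m1 \<eta> by (simp add: dist_real_def Lp_enorm_le_iff powr_powr)
      have "energy M m0 (\<lambda>x. F s x - F t x) \<le> ennreal (2 powr m0) * (energy M m0 (F s) + energy M m0 (F t))"
        by (intro energy_diff_le meas s t m)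
      also have "\<dots> \<le> ennreal (2 powr m0) * (ennreal K + ennreal K)"
        by (intro mult_left_mono add_mono bd s t) auto
      also have "\<dots> \<le> ennreal L"
        using K by (simp add: L_def ennreal_mult[symmetric] ennreal_plus[symmetric] del: ennreal_plus)
      finally have 0: "energy M m0 (\<lambda>x. F s x - F t x) \<le> ennreal L" .
      have "energy M m (\<lambda>x. F s x - F t x) \<le> ennreal (L powr a * \<eta> powr b)"
        unfolding a_def b_def
        by (rule energy_interpolation[OF _ m L 0 _ 1]) (use meas s t \<eta> in auto)
      also have "L powr a * \<eta> powr b = \<epsilon> powr m"
        using L ab eps by (simp add: \<eta>_def powr_powr)
      finally show ?thesis using m1 eps by (simp add: Lp_enorm_le_iff)
    qed
    then show "\<exists>\<delta>>0. \<forall>s\<in>{0..<T}. \<bar>s - t\<bar> < \<delta> \<longrightarrow> Lp_enorm M m (\<lambda>x. F s x - F t x) \<le> ennreal \<epsilon>"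
      using d(1) by blast
  qed
qed

section \<open>Smoothing kernels\<close>

lemma borel_representative:
  fixes f :: "'a \<Rightarrow> real"
  assumes "f \<in> borel_measurable (completion M)"
  obtains g where "g \<in> borel_measurable M" "AE x in M. f x = g x"
  using completion_ex_borel_measurable_real[OF assms] by auto

lemma borel_measurable_completion_AE:
  fixes f g :: "'a \<Rightarrow> real"
  assumes g: "g \<in> borel_measurable M" and eq: "AE x in M. f x = g x"
  shows "f \<in> borel_measurable (completion M)"
proof -
  obtain N where N: "N \<in> null_sets M" "{x \<in> space M. f x \<noteq> g x} \<subseteq> N"
    using eq by (auto simp: eventually_ae_filter)
  show ?thesis
  proof (rule measurableI)
    fix A :: "real set" assume A: "A \<in> sets borel"
    have "f -` A \<inter> space (completion M) = ((g -` A \<inter> space M) - N) \<union> (f -` A \<inter> N \<inter> space M)"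
      using N(2) by auto
    also have "\<dots> \<in> sets (completion M)"
    proof (rule sets.Un)
      show "(g -` A \<inter> space M) - N \<in> sets (completion M)"
        using measurable_sets[OF g A] N(1) by (intro sets_completionI_sets) auto
      show "f -` A \<inter> N \<inter> space M \<in> sets (completion M)"
        using null_sets_completion_subset[OF _ null_sets_completionI[OF N(1)], of "f -` A \<inter> N \<inter> space M"] by auto
    qed
    finally show "f -` A \<inter> space (completion M) \<in> sets (completion M)" .
  qed auto
qed

text \<open>The bound C s^(-\<gamma>) is what the fractional heat kernel inherits from the volume growth. The two mass
  bounds are kept apart because symmetry is lost when the kernel is modified on a null set.\<close>
locale smoothing_kernel = sigma_finite_measure M
  for M :: "'a measure" +
  fixes k :: "real \<Rightarrow> 'a \<Rightarrow> 'a \<Rightarrow> real" and C \<gamma> :: real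
  assumes space_UNIV: "space M = UNIV"
    and kernel_measurable: "(\<lambda>(s, x, y). k s x y) \<in> borel_measurable (borel \<Otimes>\<^sub>M (M \<Otimes>\<^sub>M M))"
    and kernel_nonneg: "\<And>s x y. 0 \<le> k s x y"
    and kernel_mass_right: "\<And>s x. 0 < s \<Longrightarrow> (\<integral>\<^sup>+ y. ennreal (k s x y) \<partial>M) \<le> 1"
    and kernel_mass_left: "\<And>s y. 0 < s \<Longrightarrow> (\<integral>\<^sup>+ x. ennreal (k s x y) \<partial>M) \<le> 1"
    and kernel_bound: "\<And>s x y. 0 < s \<Longrightarrow> k s x y \<le> C * s powr (- \<gamma>)"
    and C_pos: "0 < C" and \<gamma>_nonneg: "0 \<le> \<gamma>"
begin

lemma kernel_measurable_comp [measurable (raw)]: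
  assumes [measurable]: "f \<in> borel_measurable N" "g \<in> measurable N M" "h \<in> measurable N M"
  shows "(\<lambda>z. k (f z) (g z) (h z)) \<in> borel_measurable N"
proof -
  have "(\<lambda>z. (f z, g z, h z)) \<in> measurable N (borel \<Otimes>\<^sub>M (M \<Otimes>\<^sub>M M))" by measurable
  from measurable_compose[OF this kernel_measurable] show ?thesis by simp
qed

lemma pair_sigma_finite_lborel_M: "pair_sigma_finite lborel M"
  by (rule pair_sigma_finite.intro) unfold_locales

lemma pair_sigma_finite_M_M: "pair_sigma_finite M M"
  by (rule pair_sigma_finite.intro) unfold_locales

text \<open>Integration is over the completion because the elements of L^p are measurable only with respect to it.\<close>
definition kernel_op :: "real \<Rightarrow> ('a \<Rightarrow> real) \<Rightarrow> 'a \<Rightarrow> real" where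
  "kernel_op s g x = (LINT y|completion M. k s x y * g y)"

definition kernel_abs :: "real \<Rightarrow> ('a \<Rightarrow> real) \<Rightarrow> 'a \<Rightarrow> ennreal" where
  "kernel_abs s g x = (\<integral>\<^sup>+ y. ennreal (k s x y * \<bar>g y\<bar>) \<partial>completion M)"

lemma kernel_op_cong_AE:
  assumes [measurable]: "f \<in> borel_measurable (completion M)" "g \<in> borel_measurable (completion M)"
    and "AE x in M. f x = g x"
  shows "kernel_op s f = kernel_op s g"
proof
  fix x
  have [measurable]: "(\<lambda>y. k s x y) \<in> borel_measurable (completion M)"
    by (rule measurable_completion) (simp add: space_UNIV)
  have "AE x in completion M. f x = g x" using assms(3) by (simp add: AE_completion_iff)
  then show "kernel_op s f x = kernel_op s g x" unfolding kernel_op_def by (intro integral_cong_AE) auto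
qed

text \<open>Jensen's inequality with weight k s x, whose mass is at most 1.\<close>
lemma kernel_abs_powr_bound:
  assumes [measurable]: "g \<in> borel_measurable (completion M)" and m: "1 \<le> m" and s: "0 < s"
    and Z: "(\<integral>\<^sup>+ y. ennreal (k s x y * \<bar>g y\<bar> powr m) \<partial>completion M) \<le> ennreal Z" "0 \<le> Z"
  shows "kernel_abs s g x \<le> ennreal (Z powr (1 / m))"
proof -
  have [measurable]: "(\<lambda>y. k s x y) \<in> borel_measurable (completion M)"
    by (rule measurable_completion) (simp add: space_UNIV)
  have "kernel_abs s g x \<le> ennreal (1 powr (1 - 1 / m) * Z powr (1 / m))"
    unfolding kernel_abs_def
    by (rule nn_integral_weighted_Jensen)
      (use m Z kernel_nonneg kernel_mass_right[OF s] in \<open>auto simp: nn_integral_completion\<close>)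
  then show ?thesis by simp
qed

lemma kernel_abs_sup_bound:
  assumes g[measurable]: "g \<in> borel_measurable (completion M)" and m: "1 \<le> m" and s: "0 < s"
    and F: "energy M m g \<le> ennreal (F powr m)" "0 \<le> F"
  shows "kernel_abs s g x \<le> ennreal ((C * s powr (- \<gamma>)) powr (1 / m) * F)"
proof -
  have [measurable]: "(\<lambda>y. k s x y) \<in> borel_measurable (completion M)"
    by (rule measurable_completion) (simp add: space_UNIV)
  have "(\<integral>\<^sup>+ y. ennreal (k s x y * \<bar>g y\<bar> powr m) \<partial>completion M)
      \<le> (\<integral>\<^sup>+ y. ennreal (C * s powr (- \<gamma>)) * ennreal (\<bar>g y\<bar> powr m) \<partial>completion M)"
    using C_pos by (intro nn_integral_mono)
      (auto simp: ennreal_mult[symmetric] intro!: ennreal_leI mult_right_mono kernel_bound[OF s])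
  also have "\<dots> = ennreal (C * s powr (- \<gamma>)) * energy M m g"
    unfolding energy_def by (simp add: nn_integral_cmult)
  also have "\<dots> \<le> ennreal (C * s powr (- \<gamma>)) * ennreal (F powr m)"
    by (intro mult_left_mono F) auto
  also have "\<dots> = ennreal (C * s powr (- \<gamma>) * F powr m)"
    using C_pos by (simp add: ennreal_mult)
  finally have "kernel_abs s g x \<le> ennreal ((C * s powr (- \<gamma>) * F powr m) powr (1 / m))"
    using C_pos by (intro kernel_abs_powr_bound[OF g m s]) auto
  then show ?thesis using C_pos m F by (simp add: powr_mult powr_powr)
qed

lemma kernel_integrable:
  assumes g[measurable]: "g \<in> borel_measurable (completion M)" and m: "1 \<le> m" and s: "0 < s"
    and F: "energy M m g < top"
  shows "integrable (completion M) (\<lambda>y. k s x y * g y)"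
proof -
  have [measurable]: "(\<lambda>y. k s x y) \<in> borel_measurable (completion M)"
    by (rule measurable_completion) (simp add: space_UNIV)
  obtain e where e: "0 \<le> e" "energy M m g = ennreal e"
    using F by (cases "energy M m g") auto
  have "kernel_abs s g x \<le> ennreal ((C * s powr (- \<gamma>)) powr (1 / m) * (e powr (1 / m)))"
    by (rule kernel_abs_sup_bound[OF g m s]) (use e m in \<open>auto simp: powr_powr\<close>)
  then have "kernel_abs s g x < top" by (rule le_less_trans) simp
  then show ?thesis
    unfolding kernel_abs_def using kernel_nonneg
    by (intro integrableI_bounded) (auto simp: abs_mult)
qed

lemma kernel_op_le_kernel_abs:
  "ennreal \<bar>kernel_op s g x\<bar> \<le> kernel_abs s g x"
proof (cases "integrable (completion M) (\<lambda>y. k s x y * g y)")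
  case True
  then show ?thesis
    using integral_norm_bound_ennreal[OF True] kernel_nonneg by (simp add: kernel_op_def kernel_abs_def abs_mult)
next
  case False
  then show ?thesis by (simp add: kernel_op_def not_integrable_integral_eq)
qed

lemma kernel_op_diff:
  assumes "f \<in> borel_measurable (completion M)" "g \<in> borel_measurable (completion M)" "1 \<le> m" "0 < s"
    "energy M m f < top" "energy M m g < top"
  shows "kernel_op s (\<lambda>y. f y - g y) x = kernel_op s f x - kernel_op s g x"
  unfolding kernel_op_def right_diff_distrib
  by (rule Bochner_Integration.integral_diff; rule kernel_integrable[where m = m]) (use assms in auto)

lemma kernel_op_measurable_comp:
  assumes [measurable]: "case_prod g \<in> borel_measurable (borel \<Otimes>\<^sub>M M)"
  shows "(\<lambda>(s, x). kernel_op s (g s) x) \<in> borel_measurable (borel \<Otimes>\<^sub>M M)"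
proof -
  have eq: "kernel_op s (g s) x = (LINT y|M. k s x y * g s y)" for s x
  proof -
    have [measurable]: "g s \<in> borel_measurable M"
      using measurable_compose[OF measurable_Pair1' assms, of s] by simp
    have [measurable]: "(\<lambda>y. k s x y) \<in> borel_measurable M"
      by (rule kernel_measurable_comp) (auto simp: space_UNIV)
    have "(\<lambda>y. k s x y * g s y) \<in> borel_measurable M" by measurable
    then show ?thesis unfolding kernel_op_def by (rule integral_completion)
  qed
  have "(\<lambda>(z, y). k (fst z) (snd z) y * g (fst z) y) \<in> borel_measurable ((borel \<Otimes>\<^sub>M M) \<Otimes>\<^sub>M M)"
    by measurable
  from borel_measurable_lebesgue_integral[OF this] show ?thesis
    by (simp add: eq split_beta')
qed

lemma kernel_op_measurable:
  assumes "g \<in> borel_measurable (completion M)"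
  shows "kernel_op s g \<in> borel_measurable M"
proof -
  obtain g' where g': "g' \<in> borel_measurable M" "AE x in M. g x = g' x"
    using borel_representative[OF assms] .
  have "case_prod (\<lambda>(s::real) y. g' y) \<in> borel_measurable (borel \<Otimes>\<^sub>M M)"
    using g'(1) by measurable
  from measurable_compose[OF measurable_Pair1' kernel_op_measurable_comp[OF this], of s]
  have "kernel_op s g' \<in> borel_measurable M" by simp
  moreover have "kernel_op s g = kernel_op s g'"
    by (rule kernel_op_cong_AE) (use assms g' measurable_completion in auto)
  ultimately show ?thesis by simp
qed

definition gain :: "real \<Rightarrow> real \<Rightarrow> real" where
  "gain m n = C powr (1 / m - 1 / n)"

lemma gain_pos: "0 < gain m n"
  using C_pos by (simp add: gain_def)

text \<open>With S the bound on the supremum of kernel_op s g that follows from the pointwise bound of the kernel,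
  the n-th power of kernel_op s g is at most S^(n - m) times its m-th power. The integral of the latter
  is controlled by Jensen's inequality in y and the mass bound in x.\<close>
lemma smoothing:
  assumes g: "g \<in> borel_measurable (completion M)" and m: "1 \<le> m" "m \<le> n" and s: "0 < s"
    and F: "energy M m g \<le> ennreal (F powr m)" "0 \<le> F"
  shows "energy M n (kernel_op s g) \<le> ennreal ((gain m n * s powr (- (\<gamma> * (1 / m - 1 / n))) * F) powr n)"
proof -
  obtain g' where g'[measurable]: "g' \<in> borel_measurable M" and eq: "AE x in M. g x = g' x"
    using borel_representative[OF g] .
  have g'c[measurable]: "g' \<in> borel_measurable (completion M)" by (rule measurable_completion) simp
  have opeq: "kernel_op s g = kernel_op s g'" by (rule kernel_op_cong_AE) (use g eq in auto)
  have F': "energy M m g' \<le> ennreal (F powr m)" using energy_cong_AE[OF eq] F(1) by simp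
  define S where "S = (C * s powr (- \<gamma>)) powr (1 / m) * F"
  have S0: "0 \<le> S" using C_pos F by (simp add: S_def)
  have sup: "\<bar>kernel_op s g' x\<bar> \<le> S" for x
  proof -
    have "ennreal \<bar>kernel_op s g' x\<bar> \<le> ennreal S"
      unfolding S_def by (rule order_trans[OF kernel_op_le_kernel_abs kernel_abs_sup_bound]) (use F' F m s in auto)
    then show ?thesis using S0 by simp
  qed
  have pw: "ennreal (\<bar>kernel_op s g' x\<bar> powr m) \<le> (\<integral>\<^sup>+ y. ennreal (k s x y * \<bar>g' y\<bar> powr m) \<partial>M)" for x
  proof (cases "(\<integral>\<^sup>+ y. ennreal (k s x y * \<bar>g' y\<bar> powr m) \<partial>M)")
    case (real Z)
    have "ennreal \<bar>kernel_op s g' x\<bar> \<le> ennreal (Z powr (1 / m))"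
      by (rule order_trans[OF kernel_op_le_kernel_abs kernel_abs_powr_bound])
        (use real m s in \<open>auto simp: nn_integral_completion\<close>)
    then have "\<bar>kernel_op s g' x\<bar> \<le> Z powr (1 / m)" by simp
    then have "\<bar>kernel_op s g' x\<bar> powr m \<le> (Z powr (1 / m)) powr m"
      using m by (intro powr_mono2) auto
    then show ?thesis using real m by (simp add: powr_powr ennreal_leI)
  qed simp
  interpret MM: pair_sigma_finite M M by (rule pair_sigma_finite_M_M)
  have opm[measurable]: "kernel_op s g' \<in> borel_measurable M" by (rule kernel_op_measurable) simp
  have em: "energy M m (kernel_op s g') \<le> ennreal (F powr m)"
  proof -
    have "energy M m (kernel_op s g') = (\<integral>\<^sup>+ x. ennreal (\<bar>kernel_op s g' x\<bar> powr m) \<partial>M)"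
      by (simp add: energy_def nn_integral_completion)
    also have "\<dots> \<le> (\<integral>\<^sup>+ x. \<integral>\<^sup>+ y. ennreal (k s x y * \<bar>g' y\<bar> powr m) \<partial>M \<partial>M)"
      by (intro nn_integral_mono pw)
    also have "\<dots> = (\<integral>\<^sup>+ y. \<integral>\<^sup>+ x. ennreal (k s x y * \<bar>g' y\<bar> powr m) \<partial>M \<partial>M)"
      by (rule MM.Fubini'[symmetric]) measurable
    also have "\<dots> = (\<integral>\<^sup>+ y. (\<integral>\<^sup>+ x. ennreal (k s x y) \<partial>M) * ennreal (\<bar>g' y\<bar> powr m) \<partial>M)"
      using space_UNIV kernel_nonneg by (intro nn_integral_cong) (simp add: ennreal_mult nn_integral_multc)
    also have "\<dots> \<le> (\<integral>\<^sup>+ y. 1 * ennreal (\<bar>g' y\<bar> powr m) \<partial>M)"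
      by (intro nn_integral_mono mult_right_mono kernel_mass_left s) auto
    also have "\<dots> = energy M m g'" by (simp add: energy_def nn_integral_completion)
    finally show ?thesis using F' by simp
  qed
  have "energy M n (kernel_op s g') \<le> (\<integral>\<^sup>+ x. ennreal (S powr (n - m)) * ennreal (\<bar>kernel_op s g' x\<bar> powr m) \<partial>completion M)"
    unfolding energy_def
  proof (intro nn_integral_mono)
    fix x
    have "\<bar>kernel_op s g' x\<bar> powr n = \<bar>kernel_op s g' x\<bar> powr (n - m) * \<bar>kernel_op s g' x\<bar> powr m"
      by (simp add: powr_add[symmetric])
    also have "\<dots> \<le> S powr (n - m) * \<bar>kernel_op s g' x\<bar> powr m"
      using m sup by (intro mult_right_mono powr_mono2) auto
    finally show "ennreal (\<bar>kernel_op s g' x\<bar> powr n) \<le> ennreal (S powr (n - m)) * ennreal (\<bar>kernel_op s g' x\<bar> powr m)"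
      by (simp add: ennreal_mult[symmetric] ennreal_leI)
  qed
  also have "\<dots> = ennreal (S powr (n - m)) * energy M m (kernel_op s g')"
    unfolding energy_def by (rule nn_integral_cmult) (use opm in \<open>simp add: measurable_completion\<close>)
  also have "\<dots> \<le> ennreal (S powr (n - m)) * ennreal (F powr m)"
    by (intro mult_left_mono em) auto
  also have "\<dots> = ennreal (S powr (n - m) * F powr m)"
    by (simp add: ennreal_mult)
  also have "S powr (n - m) * F powr m = (gain m n * s powr (- (\<gamma> * (1 / m - 1 / n))) * F) powr n"
  proof -
    have e: "(n - m) / m = (1 / m - 1 / n) * n" using m by (simp add: field_simps)
    have "S powr (n - m) = (C * s powr (- \<gamma>)) powr ((n - m) / m) * F powr (n - m)"
      using C_pos F by (simp add: S_def powr_mult powr_powr)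
    moreover have "F powr (n - m) * F powr m = F powr n"
      using m by (simp add: powr_add[symmetric])
    moreover have "(C * s powr (- \<gamma>)) powr ((n - m) / m)
        = (gain m n * s powr (- (\<gamma> * (1 / m - 1 / n)))) powr n"
      unfolding e using C_pos s by (simp add: gain_def powr_mult powr_powr mult_ac)
    ultimately show ?thesis
      using gain_pos[of m n] F s by (simp add: powr_mult)
  qed
  finally show ?thesis by (simp add: opeq)
qed

section \<open>Minkowski's inequality for integrals over time\<close>

text \<open>Minkowski's inequality for an integral over time, if N s bounds the L^n norm of W s. By Jensen's
  inequality with weight N, the n-th power of the time integral of |W s x| is at most I^(n-1) times
  the time integral Z x of N^(1-n) |W s x|^n, and the space integral of Z is at most the time integral of N.\<close>
lemma time_Minkowski:
  fixes W :: "real \<Rightarrow> 'a \<Rightarrow> real" and N :: "real \<Rightarrow> real"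
  assumes W[measurable]: "case_prod W \<in> borel_measurable (borel \<Otimes>\<^sub>M M)"
    and N[measurable]: "N \<in> borel_measurable borel" and N0: "\<And>s. 0 \<le> N s"
    and vanish: "\<And>s x. N s = 0 \<Longrightarrow> W s x = 0" and n: "1 \<le> n"
    and E: "AE s in lborel. energy M n (W s) \<le> ennreal (N s powr n)"
    and I: "(\<integral>\<^sup>+ s. ennreal (N s) \<partial>lborel) \<le> ennreal I" "0 < I"
  shows "AE x in M. integrable lborel (\<lambda>s. W s x)"
    and "(\<lambda>x. LINT s|lborel. W s x) \<in> borel_measurable M"
    and "energy M n (\<lambda>x. LINT s|lborel. W s x) \<le> ennreal (I powr n)"
proof -
  interpret LM: pair_sigma_finite lborel M by (rule pair_sigma_finite_lborel_M)
  have [measurable]: "(\<lambda>x. W s x) \<in> borel_measurable M" for s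
    using measurable_compose[OF measurable_Pair1' W, of s] by simp
  have Wsw[measurable]: "(\<lambda>s. W s x) \<in> borel_measurable borel" for x
    using measurable_compose[OF measurable_Pair2' W, of x] by (simp add: space_UNIV)
  have [measurable]: "case_prod W \<in> borel_measurable (lborel \<Otimes>\<^sub>M M)"
    using W by (simp cong: measurable_cong_sets)
  have sw: "(\<lambda>(x, s). W s x) \<in> borel_measurable (M \<Otimes>\<^sub>M lborel)"
    by measurable
  show "(\<lambda>x. LINT s|lborel. W s x) \<in> borel_measurable M"
    by (rule lborel.borel_measurable_lebesgue_integral[OF sw])
  define Z where "Z = (\<lambda>x. \<integral>\<^sup>+ s. ennreal (N s * (\<bar>W s x\<bar> / N s) powr n) \<partial>lborel)"
  have pw: "N s * (\<bar>W s x\<bar> / N s) powr n = N s powr (1 - n) * \<bar>W s x\<bar> powr n" for s x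
    using N0[of s] vanish[of s x] by (cases "N s = 0") (auto simp: powr_divide powr_diff)
  have [measurable]: "Z \<in> borel_measurable M"
    unfolding Z_def by measurable
  have ZI: "(\<integral>\<^sup>+ x. Z x \<partial>M) \<le> ennreal I"
  proof -
    have "(\<integral>\<^sup>+ x. Z x \<partial>M) = (\<integral>\<^sup>+ s. \<integral>\<^sup>+ x. ennreal (N s * (\<bar>W s x\<bar> / N s) powr n) \<partial>M \<partial>lborel)"
      unfolding Z_def by (rule LM.Fubini') measurable
    also have "\<dots> \<le> (\<integral>\<^sup>+ s. ennreal (N s) \<partial>lborel)"
    proof (rule nn_integral_mono_AE, rule AE_mp[OF E], intro AE_I2 impI)
      fix s assume e: "energy M n (W s) \<le> ennreal (N s powr n)"
      have "(\<integral>\<^sup>+ x. ennreal (N s * (\<bar>W s x\<bar> / N s) powr n) \<partial>M)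
          = (\<integral>\<^sup>+ x. ennreal (N s powr (1 - n)) * ennreal (\<bar>W s x\<bar> powr n) \<partial>M)"
        by (simp add: pw ennreal_mult)
      also have "\<dots> = ennreal (N s powr (1 - n)) * energy M n (W s)"
        by (simp add: nn_integral_cmult energy_def nn_integral_completion)
      also have "\<dots> \<le> ennreal (N s powr (1 - n)) * ennreal (N s powr n)"
        by (intro mult_left_mono e) auto
      also have "\<dots> = ennreal (N s)"
        using N0[of s] by (simp add: ennreal_mult[symmetric] powr_add[symmetric])
      finally show "(\<integral>\<^sup>+ x. ennreal (N s * (\<bar>W s x\<bar> / N s) powr n) \<partial>M) \<le> ennreal (N s)" .
    qed
    finally show ?thesis using I by simp
  qed
  have absW: "(\<integral>\<^sup>+ s. ennreal \<bar>W s x\<bar> \<partial>lborel) \<le> ennreal (I powr (1 - 1 / n) * z powr (1 / n))"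
    if z: "Z x = ennreal z" "0 \<le> z" for x z
  proof -
    have "(\<integral>\<^sup>+ s. ennreal (N s * (\<bar>W s x\<bar> / N s)) \<partial>lborel) \<le> ennreal (I powr (1 - 1 / n) * z powr (1 / n))"
      by (rule nn_integral_weighted_Jensen) (use z n I N0 in \<open>auto simp: Z_def\<close>)
    moreover have "N s * (\<bar>W s x\<bar> / N s) = \<bar>W s x\<bar>" for s
      using vanish[of s x] by auto
    ultimately show ?thesis by simp
  qed
  have "(\<integral>\<^sup>+ x. Z x \<partial>M) < top" using ZI by (rule le_less_trans) simp
  then have fin: "AE x in M. Z x \<noteq> top"
    by (intro nn_integral_PInf_AE[unfolded infinity_ennreal_def]) (auto simp: less_top)
  show "AE x in M. integrable lborel (\<lambda>s. W s x)"
  proof (rule AE_mp[OF fin], intro AE_I2 impI)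
    fix x assume "Z x \<noteq> top"
    then obtain z where "Z x = ennreal z" "0 \<le> z" by (cases "Z x") auto
    then have "(\<integral>\<^sup>+ s. ennreal \<bar>W s x\<bar> \<partial>lborel) < top"
      using absW by (meson ennreal_less_top le_less_trans)
    then show "integrable lborel (\<lambda>s. W s x)"
      by (intro integrableI_bounded) auto
  qed
  have "energy M n (\<lambda>x. LINT s|lborel. W s x) \<le> (\<integral>\<^sup>+ x. ennreal (I powr (n - 1)) * Z x \<partial>M)"
    unfolding energy_def nn_integral_completion
  proof (rule nn_integral_mono)
    fix x
    show "ennreal (\<bar>LINT s|lborel. W s x\<bar> powr n) \<le> ennreal (I powr (n - 1)) * Z x"
    proof (cases "Z x")
      case (real z)
      have "\<bar>LINT s|lborel. W s x\<bar> \<le> I powr (1 - 1 / n) * z powr (1 / n)"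
      proof (cases "integrable lborel (\<lambda>s. W s x)")
        case True
        from integral_norm_bound_ennreal[OF True]
        have "ennreal \<bar>LINT s|lborel. W s x\<bar> \<le> (\<integral>\<^sup>+ s. ennreal \<bar>W s x\<bar> \<partial>lborel)" by simp
        from order_trans[OF this absW] real show ?thesis by simp
      qed (simp add: not_integrable_integral_eq)
      then have "\<bar>LINT s|lborel. W s x\<bar> powr n \<le> (I powr (1 - 1 / n) * z powr (1 / n)) powr n"
        using n by (intro powr_mono2) auto
      also have "\<dots> = I powr (n - 1) * z"
        using n real I by (simp add: powr_mult powr_powr left_diff_distrib)
      finally show ?thesis using real by (simp add: ennreal_mult[symmetric] ennreal_leI)
    qed (use I in \<open>simp add: ennreal_mult_top\<close>)
  qed
  also have "\<dots> = ennreal (I powr (n - 1)) * (\<integral>\<^sup>+ x. Z x \<partial>M)" by (simp add: nn_integral_cmult)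
  also have "\<dots> \<le> ennreal (I powr (n - 1)) * ennreal I" by (intro mult_left_mono ZI) auto
  also have "\<dots> = ennreal (I powr n)" using I by (simp add: ennreal_mult[symmetric] powr_diff)
  finally show "energy M n (\<lambda>x. LINT s|lborel. W s x) \<le> ennreal (I powr n)" .
qed

text \<open>Measurability of a function of time with values in L^m, in a form that allows Tonelli's theorem:
  the approximants are jointly measurable, whereas g itself is a family of representatives chosen
  independently at each time and need not be.\<close>
definition strongly_measurable :: "real \<Rightarrow> (real \<Rightarrow> 'a \<Rightarrow> real) \<Rightarrow> bool" where
  "strongly_measurable m g \<longleftrightarrow>
     (\<forall>s. g s \<in> borel_measurable (completion M) \<and> energy M m (g s) < top) \<and>
     (\<exists>G :: nat \<Rightarrow> real \<Rightarrow> 'a \<Rightarrow> real. (\<forall>n. case_prod (G n) \<in> borel_measurable (borel \<Otimes>\<^sub>M M)) \<and>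
        (\<forall>s. (\<lambda>n. energy M m (\<lambda>x. G n s x - g s x)) \<longlonglongrightarrow> 0))"

definition flow :: "(real \<Rightarrow> 'a \<Rightarrow> real) \<Rightarrow> real \<Rightarrow> 'a \<Rightarrow> real" where
  "flow g s x = (if 0 < s then kernel_op s (g s) x else 0)"

text \<open>The kernel turns convergence in L^m into pointwise convergence, so the image of a strongly
  measurable function is jointly measurable without passing to another representative.\<close>
lemma flow_measurable:
  assumes g: "strongly_measurable m g" and m: "1 \<le> m"
  shows "case_prod (flow g) \<in> borel_measurable (borel \<Otimes>\<^sub>M M)"
proof -
  from g obtain G where G: "\<And>n. case_prod (G n) \<in> borel_measurable (borel \<Otimes>\<^sub>M M)"
    and lim: "\<And>s. (\<lambda>n. energy M m (\<lambda>x. G n s x - g s x)) \<longlonglongrightarrow> 0"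
    and gs: "\<And>s. g s \<in> borel_measurable (completion M)" "\<And>s. energy M m (g s) < top"
    unfolding strongly_measurable_def by blast
  have Gs: "G n s \<in> borel_measurable (completion M)" for n s
    using measurable_compose[OF measurable_Pair1' G, of s] by (intro measurable_completion) simp
  show ?thesis
  proof (rule borel_measurable_LIMSEQ_real)
    fix n
    have [measurable]: "(\<lambda>(s, x). kernel_op s (G n s) x) \<in> borel_measurable (borel \<Otimes>\<^sub>M M)"
      by (rule kernel_op_measurable_comp[OF G])
    have "(\<lambda>z. if 0 < fst z then (\<lambda>(s, x). kernel_op s (G n s) x) z else 0) \<in> borel_measurable (borel \<Otimes>\<^sub>M M)"
      by measurable
    then show "case_prod (flow (G n)) \<in> borel_measurable (borel \<Otimes>\<^sub>M M)"
      by (simp add: flow_def split_beta' cong: if_cong)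
  next
    fix z :: "real \<times> 'a" assume "z \<in> space (borel \<Otimes>\<^sub>M M)"
    obtain s x where z: "z = (s, x)" by (cases z)
    have "(\<lambda>n. kernel_op s (G n s) x) \<longlonglongrightarrow> kernel_op s (g s) x" if s: "0 < s"
    proof (rule LIMSEQ_I)
      fix e :: real assume e: "0 < e"
      define c where "c = (C * s powr (- \<gamma>)) powr (1 / m)"
      have c: "0 < c" using C_pos s by (simp add: c_def)
      have "\<forall>\<^sub>F n in sequentially. energy M m (\<lambda>x. G n s x - g s x) \<le> ennreal ((e / 2 / c) powr m)"
        using lim[of s] e c unfolding tendsto_0_ennreal_iff by simp
      then obtain n0 where n0: "\<And>n. n0 \<le> n \<Longrightarrow> energy M m (\<lambda>x. G n s x - g s x) \<le> ennreal ((e / 2 / c) powr m)"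
        by (auto simp: eventually_sequentially)
      have "norm (kernel_op s (G n s) x - kernel_op s (g s) x) < e" if n: "n0 \<le> n" for n
      proof -
        have "energy M m (G n s) = energy M m (\<lambda>x. (G n s x - g s x) + g s x)" by simp
        also have "\<dots> \<le> ennreal (2 powr m) * (energy M m (\<lambda>x. G n s x - g s x) + energy M m (g s))"
          using Gs[of n s] gs(1)[of s] m by (intro energy_add_le) auto
        also have "\<dots> < top"
          using n0[OF n] gs(2)[of s] by (auto simp: ennreal_mult_less_top intro: le_less_trans)
        finally have "kernel_op s (\<lambda>y. G n s y - g s y) x = kernel_op s (G n s) x - kernel_op s (g s) x"
          using Gs[of n s] gs[of s] m s by (intro kernel_op_diff[where m = m]) auto
        moreover have "ennreal \<bar>kernel_op s (\<lambda>y. G n s y - g s y) x\<bar> \<le> ennreal (c * (e / 2 / c))"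
          unfolding c_def
          by (rule order_trans[OF kernel_op_le_kernel_abs kernel_abs_sup_bound])
            (use Gs[of n s] gs(1)[of s] m s n0[OF n] e c in \<open>auto simp: c_def\<close>)
        ultimately show ?thesis using c e by simp
      qed
      then show "\<exists>no. \<forall>n\<ge>no. norm (kernel_op s (G n s) x - kernel_op s (g s) x) < e" by blast
    qed
    then show "(\<lambda>n. case_prod (flow (G n)) z) \<longlonglongrightarrow> case_prod (flow g) z"
      by (simp add: z flow_def)
  qed
qed

lemma strongly_measurable_diff:
  assumes g: "strongly_measurable m g" and h: "strongly_measurable m h" and m: "0 < m"
  shows "strongly_measurable m (\<lambda>s x. g s x - h s x)"
proof -
  from g obtain G where G[measurable]: "\<And>n. case_prod (G n) \<in> borel_measurable (borel \<Otimes>\<^sub>M M)"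
    and Glim: "\<And>s. (\<lambda>n. energy M m (\<lambda>x. G n s x - g s x)) \<longlonglongrightarrow> 0"
    and gs: "\<And>s. g s \<in> borel_measurable (completion M)" "\<And>s. energy M m (g s) < top"
    unfolding strongly_measurable_def by blast
  from h obtain H where H[measurable]: "\<And>n. case_prod (H n) \<in> borel_measurable (borel \<Otimes>\<^sub>M M)"
    and Hlim: "\<And>s. (\<lambda>n. energy M m (\<lambda>x. H n s x - h s x)) \<longlonglongrightarrow> 0"
    and hs: "\<And>s. h s \<in> borel_measurable (completion M)" "\<And>s. energy M m (h s) < top"
    unfolding strongly_measurable_def by blast
  have Gs: "G n s \<in> borel_measurable (completion M)" "H n s \<in> borel_measurable (completion M)" for n s
    using measurable_compose[OF measurable_Pair1' G, of s n] measurable_compose[OF measurable_Pair1' H, of s n]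
    by (auto intro!: measurable_completion)
  show ?thesis
    unfolding strongly_measurable_def
  proof (intro conjI allI exI[of _ "\<lambda>n s x. G n s x - H n s x"])
    fix s
    show "(\<lambda>x. g s x - h s x) \<in> borel_measurable (completion M)" using gs hs by measurable
    show "energy M m (\<lambda>x. g s x - h s x) < top"
      by (rule le_less_trans[OF energy_diff_le[OF gs(1) hs(1) m]])
        (use gs(2)[of s] hs(2)[of s] in \<open>auto simp: ennreal_mult_less_top\<close>)
    show "(\<lambda>n. energy M m (\<lambda>x. G n s x - H n s x - (g s x - h s x))) \<longlonglongrightarrow> 0"
    proof (rule tendsto_sandwich[OF _ _ tendsto_const])
      have "(\<lambda>n. ennreal (2 powr m) * (energy M m (\<lambda>x. G n s x - g s x) + energy M m (\<lambda>x. H n s x - h s x)))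
          \<longlonglongrightarrow> ennreal (2 powr m) * (0 + 0)"
        by (intro ennreal_tendsto_cmult tendsto_add Glim Hlim) auto
      then show "(\<lambda>n. ennreal (2 powr m) * (energy M m (\<lambda>x. G n s x - g s x) + energy M m (\<lambda>x. H n s x - h s x))) \<longlonglongrightarrow> 0"
        by simp
      have "energy M m (\<lambda>x. G n s x - H n s x - (g s x - h s x))
          \<le> ennreal (2 powr m) * (energy M m (\<lambda>x. G n s x - g s x) + energy M m (\<lambda>x. H n s x - h s x))" for n
      proof -
        have "(\<lambda>x. G n s x - H n s x - (g s x - h s x)) = (\<lambda>x. (G n s x - g s x) - (H n s x - h s x))" by auto
        then show ?thesis
          using energy_diff_le[of "\<lambda>x. G n s x - g s x" M "\<lambda>x. H n s x - h s x" m] Gs[of n s] gs(1)[of s] hs(1)[of s] m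
          by simp
      qed
      then show "\<forall>\<^sub>F n in sequentially. energy M m (\<lambda>x. G n s x - H n s x - (g s x - h s x))
          \<le> ennreal (2 powr m) * (energy M m (\<lambda>x. G n s x - g s x) + energy M m (\<lambda>x. H n s x - h s x))"
        by simp
    qed simp
  qed measurable
qed

text \<open>The function f seen backwards from time t. In these coordinates the kernel in the Duhamel integral
  does not depend on t, and extension by 0 gives all t the same domain of integration.\<close>
definition past :: "(real \<Rightarrow> 'a \<Rightarrow> real) \<Rightarrow> real \<Rightarrow> real \<Rightarrow> 'a \<Rightarrow> real" where
  "past f t s = (if 0 < s \<and> s < t then f (t - s) else (\<lambda>_. 0))"

text \<open>Replacing t - s by the largest multiple of 1 / (n + 1) below it makes the function piecewise
  constant in time; at each of the countably many times a Borel representative is used.\<close>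
lemma strongly_measurable_past:
  assumes f: "f \<in> C_Lp T M m" and m: "0 < m" and t: "t < T"
  shows "strongly_measurable m (past f t)"
proof -
  have "\<exists>g. g \<in> borel_measurable M \<and> (u \<in> {0..<T} \<longrightarrow> (AE x in M. f u x = g x))" for u
  proof (cases "u \<in> {0..<T}")
    case True
    show ?thesis
      using borel_representative[OF Lp_spaceD(1)[OF C_LpD(1)[OF f True] m]] by metis
  qed (auto intro!: exI[of _ "\<lambda>_. 0"])
  then obtain \<phi> where \<phi>[measurable]: "\<And>u. \<phi> u \<in> borel_measurable M"
    and \<phi>eq: "\<And>u. u \<in> {0..<T} \<Longrightarrow> AE x in M. f u x = \<phi> u x"
    by metis
  define \<tau> where "\<tau> = (\<lambda>(n::nat) s::real. \<lfloor>real (Suc n) * (t - s)\<rfloor>)"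
  define G where "G = (\<lambda>n s x. if 0 < s \<and> s < t then \<phi> (real_of_int (\<tau> n s) / real (Suc n)) x else 0)"
  have fT: "f (t - s) \<in> Lp_space M m" if "0 < s \<and> s < t" for s
    using that t by (intro C_LpD(1)[OF f]) auto
  show ?thesis
    unfolding strongly_measurable_def
  proof (intro conjI allI exI[of _ G])
    fix s
    show "past f t s \<in> borel_measurable (completion M)"
      using Lp_spaceD(1)[OF fT m] by (auto simp: past_def)
    show "energy M m (past f t s) < top"
      using Lp_spaceD(2)[OF fT m] energy_zero[OF m, of M] by (auto simp: past_def)
    fix n
    have [measurable]: "\<tau> n \<in> measurable borel (count_space UNIV)"
      unfolding \<tau>_def by measurable
    have "(\<lambda>z. (\<lambda>i z. \<phi> (real_of_int i / real (Suc n)) (snd z)) (\<tau> n (fst z)) z) \<in> borel_measurable (borel \<Otimes>\<^sub>M M)"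
      by (rule measurable_compose_countable) measurable
    then have [measurable]: "(\<lambda>z. \<phi> (real_of_int (\<tau> n (fst z)) / real (Suc n)) (snd z)) \<in> borel_measurable (borel \<Otimes>\<^sub>M M)"
      by simp
    have "(\<lambda>z. if 0 < fst z \<and> fst z < t then \<phi> (real_of_int (\<tau> n (fst z)) / real (Suc n)) (snd z) else 0)
       \<in> borel_measurable (borel \<Otimes>\<^sub>M M)"
      by measurable
    then show "case_prod (G n) \<in> borel_measurable (borel \<Otimes>\<^sub>M M)"
      by (simp add: G_def split_beta')
  next
    fix s
    show "(\<lambda>n. energy M m (\<lambda>x. G n s x - past f t s x)) \<longlonglongrightarrow> 0"
    proof (cases "0 < s \<and> s < t")
      case True
      define u where "u = (\<lambda>n. real_of_int (\<tau> n s) / real (Suc n))"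
      have u: "u n \<in> {0..<T}" "t - s - 1 / real (Suc n) \<le> u n" "u n \<le> t - s" for n
      proof -
        have "real (Suc n) * (t - s) - 1 \<le> real_of_int (\<tau> n s)" "real_of_int (\<tau> n s) \<le> real (Suc n) * (t - s)"
          unfolding \<tau>_def by linarith+
        then show 1: "t - s - 1 / real (Suc n) \<le> u n" "u n \<le> t - s"
          unfolding u_def
          by (simp_all add: pos_le_divide_eq pos_divide_le_eq right_diff_distrib mult.commute del: of_nat_Suc)
        have "0 \<le> \<tau> n s" using True by (simp add: \<tau>_def)
        then show "u n \<in> {0..<T}" using 1 True t by (simp add: u_def)
      qed
      have "u \<longlonglongrightarrow> t - s"
      proof (rule tendsto_sandwich[OF _ _ _ tendsto_const])
        show "(\<lambda>n. t - s - 1 / real (Suc n)) \<longlonglongrightarrow> t - s"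
          using tendsto_diff[OF tendsto_const LIMSEQ_inverse_real_of_nat, of "t - s"] by (simp add: inverse_eq_divide)
      qed (use u in auto)
      then have "(\<lambda>n. energy M m (\<lambda>x. f (u n) x - f (t - s) x)) \<longlonglongrightarrow> 0"
        by (rule C_Lp_LIMSEQ[OF f m u(1)]) (use True t in auto)
      moreover have "energy M m (\<lambda>x. G n s x - past f t s x) = energy M m (\<lambda>x. f (u n) x - f (t - s) x)" for n
        using True \<phi>eq[OF u(1)[of n]] by (intro energy_cong_AE) (auto simp: G_def past_def u_def)
      ultimately show ?thesis by simp
    next
      case False
      then have "(\<lambda>x. G n s x - past f t s x) = (\<lambda>x. 0)" for n
        by (auto simp: G_def past_def)
      then show ?thesis using energy_zero[OF m, of M] by simp
    qed
  qed
qed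

end

section \<open>Continuity of the Duhamel integral\<close>

lemma nn_integral_powr_from_0:
  fixes a t :: real
  assumes "a < 1" "0 \<le> t"
  shows "(\<integral>\<^sup>+ s. ennreal (if 0 < s \<and> s < t then s powr (- a) else 0) \<partial>lborel) = ennreal (t powr (1 - a) / (1 - a))"
proof -
  have "(\<integral>\<^sup>+ s. ennreal (if 0 < s \<and> s < t then s powr (- a) else 0) \<partial>lborel)
      = (\<integral>\<^sup>+ s. ennreal (indicator {0..t} s * s powr (- a)) \<partial>lborel)"
    by (rule nn_integral_cong_AE, rule AE_mp[OF AE_lborel_singleton[of t]]) (auto simp: indicator_def)
  also have "\<dots> = ennreal (t powr (1 - a) / (1 - a))"
    using has_integral_powr_from_0[of "- a" t] assms
    by (subst nn_integral_has_integral_lebesgue[where I = "t powr (1 - a) / (1 - a)"]) auto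
  finally show ?thesis .
qed

lemma nn_integral_powr_shifted:
  fixes a u v :: real
  assumes "a < 1" "u \<le> v"
  shows "(\<integral>\<^sup>+ s. ennreal (if u < s \<and> s < v then (s - u) powr (- a) else 0) \<partial>lborel)
    = ennreal ((v - u) powr (1 - a) / (1 - a))"
proof -
  have "(\<integral>\<^sup>+ s. ennreal (if u < s \<and> s < v then (s - u) powr (- a) else 0) \<partial>lborel)
    = (\<integral>\<^sup>+ s. ennreal (if 0 < s \<and> s < v - u then s powr (- a) else 0) \<partial>lborel)"
    by (subst nn_integral_real_affine[of _ 1 u]) (auto intro!: nn_integral_cong)
  then show ?thesis using nn_integral_powr_from_0[of a "v - u"] assms by simp
qed

lemma nn_integral_powr_reflected:
  fixes a t :: real
  assumes "a < 1" "0 \<le> t"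
  shows "(\<integral>\<^sup>+ s. ennreal (if 0 < s \<and> s < t then (t - s) powr (- a) else 0) \<partial>lborel)
    = ennreal (t powr (1 - a) / (1 - a))"
proof -
  have "(\<integral>\<^sup>+ s. ennreal (if 0 < s \<and> s < t then (t - s) powr (- a) else 0) \<partial>lborel)
    = (\<integral>\<^sup>+ s. ennreal (if 0 < s \<and> s < t then s powr (- a) else 0) \<partial>lborel)"
    by (subst nn_integral_real_affine[of _ "-1" t]) (auto intro!: nn_integral_cong)
  then show ?thesis using nn_integral_powr_from_0[OF assms] by simp
qed

lemma nn_integral_powr_to_inf:
  fixes d \<delta> :: real
  assumes "0 < d" "0 < \<delta>"
  shows "(\<integral>\<^sup>+ s. ennreal (if \<delta> \<le> s then s powr (- 1 - d) else 0) \<partial>lborel) = ennreal (\<delta> powr (- d) / d)"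
proof -
  have "(\<integral>\<^sup>+ s. ennreal (if \<delta> \<le> s then s powr (- 1 - d) else 0) \<partial>lborel)
      = (\<integral>\<^sup>+ s. ennreal (indicator {\<delta>..} s * s powr (- 1 - d)) \<partial>lborel)"
    by (intro nn_integral_cong) (auto simp: indicator_def)
  also have "\<dots> = ennreal (\<delta> powr (- d) / d)"
    using has_integral_powr_to_inf[of "- 1 - d" \<delta>] assms
    by (subst nn_integral_has_integral_lebesgue[where I = "\<delta> powr (- d) / d"]) auto
  finally show ?thesis .
qed

context smoothing_kernel
begin

definition duhamel_int :: "(real \<Rightarrow> 'a \<Rightarrow> real) \<Rightarrow> 'a \<Rightarrow> real" where
  "duhamel_int g x = (LINT s|lborel. flow g s x)"

lemma kernel_op_zero [simp]: "kernel_op s (\<lambda>_. 0) = (\<lambda>_. 0)"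
  by (simp add: kernel_op_def fun_eq_iff)

lemma duhamel_int_bound:
  assumes g: "strongly_measurable m g" and m: "1 \<le> m" and n: "1 \<le> n"
    and N: "N \<in> borel_measurable borel" "\<And>s. 0 \<le> N s" "\<And>s. N s = 0 \<Longrightarrow> 0 < s \<Longrightarrow> g s = (\<lambda>_. 0)"
    and E: "AE s in lborel. 0 < s \<longrightarrow> energy M n (kernel_op s (g s)) \<le> ennreal (N s powr n)"
    and I: "(\<integral>\<^sup>+ s. ennreal (N s) \<partial>lborel) \<le> ennreal I" "0 < I"
  shows "AE x in M. integrable lborel (\<lambda>s. flow g s x)"
    and "duhamel_int g \<in> borel_measurable M"
    and "energy M n (duhamel_int g) \<le> ennreal (I powr n)"
proof -
  have v: "flow g s x = 0" if "N s = 0" for s x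
    using N(3)[OF that] by (auto simp: flow_def)
  have e: "AE s in lborel. energy M n (flow g s) \<le> ennreal (N s powr n)"
  proof (rule AE_mp[OF E], intro AE_I2 impI)
    fix s assume *: "0 < s \<longrightarrow> energy M n (kernel_op s (g s)) \<le> ennreal (N s powr n)"
    show "energy M n (flow g s) \<le> ennreal (N s powr n)"
    proof (cases "0 < s")
      case True
      then have "flow g s = kernel_op s (g s)" by (auto simp: flow_def)
      then show ?thesis using * True by simp
    next
      case False
      then have "flow g s = (\<lambda>_. 0)" by (auto simp: flow_def)
      then show ?thesis using energy_zero[of n M] n by simp
    qed
  qed
  note mk = time_Minkowski[OF flow_measurable[OF g m] N(1,2) v n e I]
  show "AE x in M. integrable lborel (\<lambda>s. flow g s x)" by (rule mk(1))
  have "duhamel_int g = (\<lambda>x. LINT s|lborel. flow g s x)" by (auto simp: duhamel_int_def)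
  then show "duhamel_int g \<in> borel_measurable M" "energy M n (duhamel_int g) \<le> ennreal (I powr n)"
    using mk(2,3) by simp_all
qed

lemma duhamel_int_past_bound:
  assumes f: "f \<in> C_Lp T M m" and m: "1 \<le> m" and n: "1 \<le> n" and t: "t < T"
    and N: "N \<in> borel_measurable borel" "\<And>s. 0 < s \<Longrightarrow> s < t \<Longrightarrow> 0 < N s"
    and E: "\<And>s. 0 < s \<Longrightarrow> s < t \<Longrightarrow> energy M n (kernel_op s (f (t - s))) \<le> ennreal (N s powr n)"
    and I: "(\<integral>\<^sup>+ s. ennreal (if 0 < s \<and> s < t then N s else 0) \<partial>lborel) \<le> ennreal I" "0 < I"
  shows "AE x in M. integrable lborel (\<lambda>s. flow (past f t) s x)"
    and "duhamel_int (past f t) \<in> borel_measurable M"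
    and "energy M n (duhamel_int (past f t)) \<le> ennreal (I powr n)"
proof -
  define N' where "N' = (\<lambda>s. if 0 < s \<and> s < t then N s else 0)"
  have N': "N' \<in> borel_measurable borel" unfolding N'_def using N(1) by measurable
  have sm: "strongly_measurable m (past f t)" using m by (intro strongly_measurable_past[OF f _ t]) auto
  have N'0: "0 \<le> N' s" for s using N(2)[of s] by (simp add: N'_def less_imp_le)
  have v: "past f t s = (\<lambda>_. 0)" if "N' s = 0" "0 < s" for s
    using that N(2)[of s] by (auto simp: N'_def past_def split: if_splits)
  have e: "AE s in lborel. 0 < s \<longrightarrow> energy M n (kernel_op s (past f t s)) \<le> ennreal (N' s powr n)"
  proof (intro AE_I2 impI)
    fix s :: real assume "0 < s"
    then show "energy M n (kernel_op s (past f t s)) \<le> ennreal (N' s powr n)"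
      using E[of s] energy_zero[of n M] n by (auto simp: N'_def past_def)
  qed
  have I': "(\<integral>\<^sup>+ s. ennreal (N' s) \<partial>lborel) \<le> ennreal I" using I(1) by (simp add: N'_def)
  note jb = duhamel_int_bound[OF sm m n N' N'0 v e I' I(2)]
  show "AE x in M. integrable lborel (\<lambda>s. flow (past f t) s x)" by (rule jb(1))
  show "duhamel_int (past f t) \<in> borel_measurable M" by (rule jb(2))
  show "energy M n (duhamel_int (past f t)) \<le> ennreal (I powr n)" by (rule jb(3))
qed

lemma C_Lp_op_bound:
  assumes f: "f \<in> C_Lp T M m" and m: "1 \<le> m" "m \<le> n" and t: "t \<in> {0..<T}" and s: "0 < s"
    and F: "energy M m (f t) \<le> ennreal (F powr m)" "0 \<le> F"
  shows "energy M n (kernel_op s (f t)) \<le> ennreal ((gain m n * s powr (- (\<gamma> * (1 / m - 1 / n))) * F) powr n)"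
  using Lp_spaceD(1)[OF C_LpD(1)[OF f t]] m by (intro smoothing s F) auto

text \<open>On [0,t] the function f is bounded in L^m, so the integrand is dominated by a multiple of s^(-a).\<close>
lemma duhamel_int_past_basic:
  assumes f: "f \<in> C_Lp T M m" and m: "1 \<le> m" "m \<le> n" and a: "\<gamma> * (1 / m - 1 / n) < 1" and t: "t \<in> {0..<T}"
  shows "AE x in M. integrable lborel (\<lambda>s. flow (past f t) s x)"
    and "duhamel_int (past f t) \<in> Lp_space M n"
proof -
  let ?a = "\<gamma> * (1 / m - 1 / n)"
  obtain K where K: "0 < K" "\<And>u. u \<in> {0..t} \<Longrightarrow> energy M m (f u) \<le> ennreal (K powr m)"
    using C_Lp_bounded[OF f, of t] m t by auto
  let ?N = "\<lambda>s. gain m n * K * s powr (- ?a)"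
  let ?I = "gain m n * K * (t powr (1 - ?a) / (1 - ?a)) + 1"
  have I0: "0 < ?I"
    using gain_pos[of m n] K(1) a by (intro add_nonneg_pos mult_nonneg_nonneg divide_nonneg_nonneg) auto
  have N: "?N \<in> borel_measurable borel" by measurable
  have E: "energy M n (kernel_op s (f (t - s))) \<le> ennreal (?N s powr n)" if "0 < s" "s < t" for s
  proof -
    have "energy M n (kernel_op s (f (t - s))) \<le> ennreal ((gain m n * s powr (- ?a) * K) powr n)"
      using that t by (intro C_Lp_op_bound[OF f m _ _ K(2)]) (use K(1) in auto)
    then show ?thesis by (simp add: mult_ac)
  qed
  have "(\<integral>\<^sup>+ s. ennreal (if 0 < s \<and> s < t then ?N s else 0) \<partial>lborel)
      = (\<integral>\<^sup>+ s. ennreal (gain m n * K) * ennreal (if 0 < s \<and> s < t then s powr (- ?a) else 0) \<partial>lborel)"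
    using gain_pos[of m n] K(1) by (intro nn_integral_cong) (auto simp: ennreal_mult[symmetric])
  also have "\<dots> = ennreal (gain m n * K) * ennreal (t powr (1 - ?a) / (1 - ?a))"
    using a t by (subst nn_integral_cmult) (auto simp: nn_integral_powr_from_0)
  also have "\<dots> \<le> ennreal ?I"
    using gain_pos[of m n] K(1) a by (subst ennreal_mult[symmetric]) (auto intro!: ennreal_leI)
  finally have I: "(\<integral>\<^sup>+ s. ennreal (if 0 < s \<and> s < t then ?N s else 0) \<partial>lborel) \<le> ennreal ?I" .
  have n: "1 \<le> n" using m by simp
  have tT: "t < T" using t by simp
  have Np: "0 < ?N s" if "0 < s" "s < t" for s using gain_pos[of m n] K(1) that by simp
  note jb = duhamel_int_past_bound[OF f m(1) n tT N Np E I I0]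
  show "AE x in M. integrable lborel (\<lambda>s. flow (past f t) s x)" by (rule jb(1))
  show "duhamel_int (past f t) \<in> Lp_space M n"
    using jb(2,3) n by (intro Lp_spaceI measurable_completion) (auto intro: le_less_trans)
qed

text \<open>In the coordinates of past the increment of the Duhamel integral is the integral of the increment of
  past f. For s < u this is an increment of f, small by uniform continuity; for u < s < v it is a
  value of f, and only the length v - u makes it small.\<close>
lemma duhamel_int_past_increment:
  assumes f: "f \<in> C_Lp T M m" and m: "1 \<le> m" "m \<le> n" and a: "\<gamma> * (1 / m - 1 / n) < 1"
    and uv: "0 \<le> u" "u < v" "v < T" and \<epsilon>: "0 < \<epsilon>" and K: "0 < K"
    and eps: "\<And>s. 0 < s \<Longrightarrow> s < u \<Longrightarrow> energy M m (\<lambda>x. f (v - s) x - f (u - s) x) \<le> ennreal (\<epsilon> powr m)"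
    and bd: "\<And>s. s \<in> {0..v} \<Longrightarrow> energy M m (f s) \<le> ennreal (K powr m)"
  defines "a \<equiv> \<gamma> * (1 / m - 1 / n)"
  shows "Lp_enorm M n (\<lambda>x. duhamel_int (past f v) x - duhamel_int (past f u) x)
     \<le> ennreal (gain m n / (1 - a) * (\<epsilon> * v powr (1 - a) + K * (v - u) powr (1 - a)))"
proof -
  let ?c = "gain m n"
  have c: "0 < ?c" by (rule gain_pos)
  have a1: "a < 1" "0 \<le> a"
    using a m \<gamma>_nonneg by (auto simp: a_def intro!: mult_nonneg_nonneg divide_left_mono)
  have n: "1 \<le> n" using m by simp
  define g where "g = (\<lambda>s x. past f v s x - past f u s x)"
  have sm: "strongly_measurable m (past f v)" "strongly_measurable m (past f u)"
    using m uv by (auto intro!: strongly_measurable_past[OF f])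
  have smg: "strongly_measurable m g"
    unfolding g_def using sm m by (intro strongly_measurable_diff) auto
  have flow_g: "flow g s x = flow (past f v) s x - flow (past f u) s x" for s x
    using sm m by (auto simp: flow_def g_def strongly_measurable_def intro!: kernel_op_diff[where m = m])
  \<comment> \<open>s^(-a) is enlarged to (s - u)^(-a) on (u,v), which gives the small factor (v - u)^(1-a).\<close>
  define N where "N = (\<lambda>s. ?c * \<epsilon> * (if 0 < s \<and> s < v then s powr (- a) else 0)
      + ?c * K * (if u < s \<and> s < v then (s - u) powr (- a) else 0))"
  have N: "N \<in> borel_measurable borel" unfolding N_def by measurable
  have N0: "0 \<le> N s" for s using c \<epsilon> K by (auto simp: N_def)
  have vanish: "g s = (\<lambda>_. 0)" if "N s = 0" "0 < s" for s
  proof (cases "s < v")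
    case True
    then have "0 < N s"
      unfolding N_def using that c \<epsilon> K by (intro add_pos_nonneg) auto
    then show ?thesis using that by simp
  next
    case False
    then show ?thesis using uv by (auto simp: g_def past_def)
  qed
  have fm: "f w \<in> borel_measurable (completion M)" if "0 \<le> w" "w < T" for w
    using Lp_spaceD(1)[OF C_LpD(1)[OF f, of w]] that m by auto
  have E: "AE s in lborel. 0 < s \<longrightarrow> energy M n (kernel_op s (g s)) \<le> ennreal (N s powr n)"
  proof (rule AE_mp[OF AE_lborel_singleton[of u]], intro AE_I2 impI)
    fix s :: real assume s: "s \<noteq> u" "0 < s"
    consider "s < u" | "u < s" "s < v" | "v \<le> s" using s by linarith
    then show "energy M n (kernel_op s (g s)) \<le> ennreal (N s powr n)"
    proof cases
      case 1
      have gs: "g s = (\<lambda>x. f (v - s) x - f (u - s) x)" using 1 s uv by (auto simp: g_def past_def)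
      have "energy M n (kernel_op s (g s)) \<le> ennreal ((?c * s powr (- a) * \<epsilon>) powr n)"
        unfolding a_def gs
        by (intro smoothing m s(2) eps 1) (use fm[of "v - s"] fm[of "u - s"] 1 s uv \<epsilon> in auto)
      also have "\<dots> \<le> ennreal (N s powr n)"
        using c \<epsilon> K 1 s uv n by (intro ennreal_leI powr_mono2) (auto simp: N_def)
      finally show ?thesis .
    next
      case 2
      have gs: "g s = f (v - s)" using 2 s uv by (auto simp: g_def past_def)
      have "energy M n (kernel_op s (g s)) \<le> ennreal ((?c * s powr (- a) * K) powr n)"
        unfolding a_def gs by (intro C_Lp_op_bound[OF f m] bd s(2)) (use 2 s uv K in auto)
      also have "\<dots> \<le> ennreal (N s powr n)"
      proof (intro ennreal_leI powr_mono2)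
        have "s powr (- a) \<le> (s - u) powr (- a)"
          using 2 a1 uv by (intro powr_mono2') auto
        then have "?c * K * s powr (- a) \<le> ?c * K * (s - u) powr (- a)"
          using c K by (intro mult_left_mono) auto
        then show "?c * s powr (- a) * K \<le> N s"
          using 2 s c \<epsilon> by (simp add: N_def mult_ac add_increasing)
      qed (use c K n in auto)
      finally show ?thesis .
    next
      case 3
      then have "g s = (\<lambda>_. 0)" using uv by (auto simp: g_def past_def)
      then show ?thesis using energy_zero[of n M] n by simp
    qed
  qed
  let ?I = "?c / (1 - a) * (\<epsilon> * v powr (1 - a) + K * (v - u) powr (1 - a))"
  have I0: "0 < ?I"
    using c a1 \<epsilon> K uv by (intro mult_pos_pos divide_pos_pos add_pos_pos) auto
  have "(\<integral>\<^sup>+ s. ennreal (N s) \<partial>lborel)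
      = (\<integral>\<^sup>+ s. ennreal (?c * \<epsilon>) * ennreal (if 0 < s \<and> s < v then s powr (- a) else 0)
          + ennreal (?c * K) * ennreal (if u < s \<and> s < v then (s - u) powr (- a) else 0) \<partial>lborel)"
    unfolding N_def using c \<epsilon> K by (intro nn_integral_cong) (subst ennreal_lincomb, auto)
  also have "\<dots> = ennreal (?c * \<epsilon>) * ennreal (v powr (1 - a) / (1 - a)) + ennreal (?c * K) * ennreal ((v - u) powr (1 - a) / (1 - a))"
    using uv a1
    by (subst nn_integral_add) (auto simp: nn_integral_cmult nn_integral_powr_from_0 nn_integral_powr_shifted)
  also have "\<dots> = ennreal (?c * \<epsilon> * (v powr (1 - a) / (1 - a)) + ?c * K * ((v - u) powr (1 - a) / (1 - a)))"
    using c \<epsilon> K a1 by (intro ennreal_lincomb) auto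
  also have "?c * \<epsilon> * (v powr (1 - a) / (1 - a)) + ?c * K * ((v - u) powr (1 - a) / (1 - a)) = ?I"
    by (simp add: algebra_simps add_divide_distrib)
  finally have I: "(\<integral>\<^sup>+ s. ennreal (N s) \<partial>lborel) \<le> ennreal ?I" by simp
  note jb = duhamel_int_bound[OF smg m(1) n N N0 vanish E I I0]
  have "AE x in M. duhamel_int (past f v) x - duhamel_int (past f u) x = duhamel_int g x"
  proof -
    have "AE x in M. integrable lborel (\<lambda>s. flow (past f v) s x)" "AE x in M. integrable lborel (\<lambda>s. flow (past f u) s x)"
      using uv by (auto intro!: duhamel_int_past_basic(1)[OF f m a])
    then show ?thesis
      by eventually_elim (simp add: duhamel_int_def flow_g)
  qed
  then have "energy M n (\<lambda>x. duhamel_int (past f v) x - duhamel_int (past f u) x) = energy M n (duhamel_int g)"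
    by (rule energy_cong_AE)
  also have "\<dots> \<le> ennreal (?I powr n)" by (rule jb(3))
  finally show ?thesis using n I0 by (subst Lp_enorm_le_iff) auto
qed

lemma duhamel_int_past_C_Lp:
  assumes f: "f \<in> C_Lp T M m" and m: "1 \<le> m" "m \<le> n" and a: "\<gamma> * (1 / m - 1 / n) < 1"
  shows "(\<lambda>t. duhamel_int (past f t)) \<in> C_Lp T M n"
proof (rule C_LpI)
  fix t assume t: "t \<in> {0..<T}"
  show "duhamel_int (past f t) \<in> Lp_space M n" by (rule duhamel_int_past_basic(2)[OF f m a t])
  fix \<epsilon> :: real assume \<epsilon>: "0 < \<epsilon>"
  define a' where "a' = \<gamma> * (1 / m - 1 / n)"
  define R where "R = (t + T) / 2"
  have R: "t < R" "R < T" "0 < R" using t by (auto simp: R_def)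
  have m0: "0 < m" using m by simp
  obtain K where K: "0 < K" "\<And>s. s \<in> {0..R} \<Longrightarrow> energy M m (f s) \<le> ennreal (K powr m)"
    using C_Lp_bounded[OF f m0 R(2)] by blast
  define D where "D = gain m n / (1 - a')"
  have D: "0 < D" using gain_pos[of m n] a by (simp add: D_def a'_def)
  define e where "e = \<epsilon> / (2 * D * R powr (1 - a'))"
  have e: "0 < e" using D \<epsilon> R by (simp add: e_def)
  define d0 where "d0 = (\<epsilon> / (2 * D * K)) powr (1 / (1 - a'))"
  have d0: "0 < d0" using D \<epsilon> K by (simp add: d0_def)
  obtain d1 where d1: "0 < d1" "\<And>s u. s \<in> {0..R} \<Longrightarrow> u \<in> {0..R} \<Longrightarrow> \<bar>s - u\<bar> < d1 \<Longrightarrow>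
      energy M m (\<lambda>x. f s x - f u x) \<le> ennreal (e powr m)"
    using C_Lp_uniformly_continuous[OF f m0 R(2), of "e powr m"] e by auto
  have key: "Lp_enorm M n (\<lambda>x. duhamel_int (past f v) x - duhamel_int (past f u) x) \<le> ennreal \<epsilon>"
    if uv: "0 \<le> u" "u < v" "v \<le> R" "v - u < d0" "v - u < d1" for u v
  proof -
    have "Lp_enorm M n (\<lambda>x. duhamel_int (past f v) x - duhamel_int (past f u) x)
        \<le> ennreal (gain m n / (1 - a') * (e * v powr (1 - a') + K * (v - u) powr (1 - a')))"
      unfolding a'_def
      by (rule duhamel_int_past_increment[OF f m a _ _ _ e K(1)]) (use uv R in \<open>auto intro!: K(2) d1(2)\<close>)
    also have "\<dots> \<le> ennreal \<epsilon>"
    proof (rule ennreal_leI)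
      have "v powr (1 - a') \<le> R powr (1 - a')"
        using uv a by (intro powr_mono2) (auto simp: a'_def)
      then have "e * v powr (1 - a') \<le> e * R powr (1 - a')" using e by (intro mult_left_mono) auto
      also have "\<dots> = \<epsilon> / (2 * D)" using R by (simp add: e_def)
      finally have 1: "e * v powr (1 - a') \<le> \<epsilon> / (2 * D)" .
      have "(v - u) powr (1 - a') \<le> d0 powr (1 - a')"
        using uv a by (intro powr_mono2) (auto simp: a'_def)
      also have "\<dots> = \<epsilon> / (2 * D * K)" using a D K \<epsilon> by (simp add: d0_def powr_powr a'_def)
      finally have "K * (v - u) powr (1 - a') \<le> K * (\<epsilon> / (2 * D * K))" using K(1) by (intro mult_left_mono) auto
      also have "\<dots> = \<epsilon> / (2 * D)" using K(1) by simp
      finally have 2: "K * (v - u) powr (1 - a') \<le> \<epsilon> / (2 * D)" .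
      have "D * (e * v powr (1 - a') + K * (v - u) powr (1 - a')) \<le> D * (\<epsilon> / (2 * D) + \<epsilon> / (2 * D))"
        using 1 2 D by (intro mult_left_mono) auto
      then show "gain m n / (1 - a') * (e * v powr (1 - a') + K * (v - u) powr (1 - a')) \<le> \<epsilon>"
        using D by (simp add: D_def[symmetric])
    qed
    finally show ?thesis .
  qed
  show "\<exists>\<delta>>0. \<forall>s\<in>{0..<T}. \<bar>s - t\<bar> < \<delta> \<longrightarrow> Lp_enorm M n (\<lambda>x. duhamel_int (past f s) x - duhamel_int (past f t) x) \<le> ennreal \<epsilon>"
  proof (intro exI conjI ballI impI)
    show "0 < min (R - t) (min d0 d1)" using R d0 d1 by simp
    fix s assume s: "s \<in> {0..<T}" "\<bar>s - t\<bar> < min (R - t) (min d0 d1)"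
    consider "s = t" | "s < t" | "t < s" by linarith
    then show "Lp_enorm M n (\<lambda>x. duhamel_int (past f s) x - duhamel_int (past f t) x) \<le> ennreal \<epsilon>"
    proof cases
      case 1
      then show ?thesis using m by (simp add: Lp_enorm_def epow_def)
    next
      case 2
      then show ?thesis using key[of s t] s t R by (subst Lp_enorm_minus_commute) auto
    next
      case 3
      then show ?thesis using key[of t s] s t R by auto
    qed
  qed
qed

end

section \<open>The stable subordinator\<close>

text \<open>Lerch's uniqueness theorem, stated as an inequality that can be applied in both directions. The hypothesis says that f - g
  integrates to 0 against every power of e^(-s), hence, by the Weierstrass theorem on [0,1], against
  every continuous function of e^(-s). If f > g near s0, a tent function supported there contradicts
  this.\<close>
lemma laplace_transform_le:
  fixes f g :: "real \<Rightarrow> real"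
  assumes f: "continuous_on {0<..} f" "\<And>s. 0 < s \<Longrightarrow> 0 \<le> f s"
    and g: "continuous_on {0<..} g" "\<And>s. 0 < s \<Longrightarrow> 0 \<le> g s"
    and fin: "(\<integral>\<^sup>+ s\<in>{0<..}. ennreal (f s) \<partial>lborel) < top"
    and eq: "\<And>n::nat. (\<integral>\<^sup>+ s\<in>{0<..}. ennreal (exp (- real n * s) * f s) \<partial>lborel)
        = (\<integral>\<^sup>+ s\<in>{0<..}. ennreal (exp (- real n * s) * g s) \<partial>lborel)"
    and s0: "0 < s0"
  shows "f s0 \<le> g s0"
proof (rule ccontr)
  assume "\<not> f s0 \<le> g s0"
  then have gt: "g s0 < f s0" by simp
  define F where "F = (\<lambda>s. indicator {0<..} s * f s)"
  define G where "G = (\<lambda>s. indicator {0<..} s * g s)"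
  have [measurable]: "F \<in> borel_measurable borel" "G \<in> borel_measurable borel"
    using borel_measurable_continuous_on_indicator[OF _ f(1)] borel_measurable_continuous_on_indicator[OF _ g(1)]
    by (auto simp: F_def G_def)
  have FG0: "0 \<le> F s" "0 \<le> G s" for s using f g by (auto simp: F_def G_def indicator_def)
  have conv: "(\<integral>\<^sup>+ s\<in>{0<..}. ennreal (exp (- real n * s) * f s) \<partial>lborel) = (\<integral>\<^sup>+ s. ennreal (exp (- real n * s) * F s) \<partial>lborel)"
    "(\<integral>\<^sup>+ s\<in>{0<..}. ennreal (exp (- real n * s) * g s) \<partial>lborel) = (\<integral>\<^sup>+ s. ennreal (exp (- real n * s) * G s) \<partial>lborel)" for n
    by (auto intro!: nn_integral_cong simp: F_def G_def indicator_def)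
  have eqFG: "(\<integral>\<^sup>+ s. ennreal (exp (- real n * s) * F s) \<partial>lborel) = (\<integral>\<^sup>+ s. ennreal (exp (- real n * s) * G s) \<partial>lborel)" for n
    using eq[of n] unfolding conv .
  have iF: "integrable lborel F"
    using fin conv(1)[of 0] FG0 by (intro integrableI_nonneg) auto
  have iG: "integrable lborel G"
    using fin conv[of 0] eq[of 0] FG0 by (intro integrableI_nonneg) auto
  have weighted: "integrable lborel (\<lambda>s. w s * X s)"
    if [measurable]: "w \<in> borel_measurable borel" and "\<And>s. 0 < s \<Longrightarrow> \<bar>w s\<bar> \<le> B"
      and "integrable lborel X" and "\<And>s. s \<le> 0 \<Longrightarrow> X s = 0" for w X :: "real \<Rightarrow> real" and B
  proof (rule Bochner_Integration.integrable_bound)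
    show "integrable lborel (\<lambda>s. B * X s)" using that by simp
    show "(\<lambda>s. w s * X s) \<in> borel_measurable lborel" using that(3) by simp
    show "AE s in lborel. norm (w s * X s) \<le> norm (B * X s)"
    proof (intro AE_I2)
      fix s show "norm (w s * X s) \<le> norm (B * X s)"
      proof (cases "0 < s")
        case True
        have "\<bar>w s\<bar> \<le> \<bar>B\<bar>" using that(2)[OF True] by simp
        then show ?thesis by (simp add: abs_mult mult_right_mono)
      qed (use that(4) in simp)
    qed
  qed
  have FGneg: "F s = 0" "G s = 0" if "s \<le> 0" for s using that by (auto simp: F_def G_def)
  have monoF: "integrable lborel (\<lambda>s. exp (- real n * s) * F s)" "integrable lborel (\<lambda>s. exp (- real n * s) * G s)" for n
    by (rule weighted[where B = 1]; use iF iG FGneg in simp)+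
  have mono_eq: "(LINT s|lborel. exp (- real n * s) * F s) = (LINT s|lborel. exp (- real n * s) * G s)" for n
    using eqFG[of n] FG0 by (simp add: integral_eq_nn_integral)
  have poly_eq: "(LINT s|lborel. P (exp (- s)) * F s) = (LINT s|lborel. P (exp (- s)) * G s)"
    if Ppoly: "real_polynomial_function P" for P
  proof -
    obtain a n where P: "P = (\<lambda>x. \<Sum>i\<le>n. a i * x ^ i)"
      using Ppoly unfolding real_polynomial_function_iff_sum by blast
    have e: "P (exp (- s)) * X = (\<Sum>i\<le>n. a i * (exp (- real i * s) * X))" for s X
      unfolding P sum_distrib_right by (intro sum.cong) (auto simp: exp_of_nat_mult[symmetric])
    show ?thesis unfolding e using monoF mono_eq by simp
  qed
  have cont_eq: "(LINT s|lborel. \<phi> (exp (- s)) * (F s - G s)) = 0"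
    if \<phi>: "continuous_on {0..1} \<phi>" "\<phi> \<in> borel_measurable borel" for \<phi> :: "real \<Rightarrow> real"
  proof -
    define B where "B = (LINT s|lborel. F s + G s)"
    have B0: "0 \<le> B" unfolding B_def using FG0 by (intro Bochner_Integration.integral_nonneg) (simp add: add_nonneg_nonneg)
    have "\<bar>LINT s|lborel. \<phi> (exp (- s)) * (F s - G s)\<bar> \<le> e * B" if e: "0 < e" for e
    proof -
      obtain P where P: "real_polynomial_function P" "\<And>x. x \<in> {0..1} \<Longrightarrow> \<bar>\<phi> x - P x\<bar> < e"
        using Stone_Weierstrass_real_polynomial_function[OF _ \<phi>(1) e] by auto
      have [measurable]: "\<phi> \<in> borel_measurable borel" by (rule \<phi>(2))
      have contP: "continuous_on S P" for S
        by (intro continuous_at_imp_continuous_on ballI continuous_real_polymonial_function P(1))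
      have [measurable]: "P \<in> borel_measurable borel"
        by (rule borel_measurable_continuous_onI[OF contP])
      have "bounded (P ` {0..1})"
        using compact_continuous_image[OF contP[of "{0..1}"]] by (intro compact_imp_bounded) simp
      then obtain B1 where "\<forall>y\<in>P ` {0..1}. norm y \<le> B1"
        unfolding bounded_iff by blast
      then have B1: "\<bar>P x\<bar> \<le> B1" if "x \<in> {0..1}" for x using that by auto
      have iP: "integrable lborel (\<lambda>s. P (exp (- s)) * F s)" "integrable lborel (\<lambda>s. P (exp (- s)) * G s)"
        by (rule weighted[where B = B1]; use iF iG FGneg B1 in simp)+
      have iD: "integrable lborel (\<lambda>s. (\<phi> (exp (- s)) - P (exp (- s))) * F s)"
          "integrable lborel (\<lambda>s. (\<phi> (exp (- s)) - P (exp (- s))) * G s)"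
        by (rule weighted[where B = e]; use iF iG FGneg P(2) in \<open>simp add: less_imp_le\<close>)+
      have "(LINT s|lborel. \<phi> (exp (- s)) * (F s - G s))
          = (LINT s|lborel. ((\<phi> (exp (- s)) - P (exp (- s))) * F s - (\<phi> (exp (- s)) - P (exp (- s))) * G s)
               + (P (exp (- s)) * F s - P (exp (- s)) * G s))"
        by (intro Bochner_Integration.integral_cong) (auto simp: algebra_simps)
      also have "\<dots> = (LINT s|lborel. (\<phi> (exp (- s)) - P (exp (- s))) * F s - (\<phi> (exp (- s)) - P (exp (- s))) * G s)
          + (LINT s|lborel. P (exp (- s)) * F s - P (exp (- s)) * G s)"
        using iP iD by (intro Bochner_Integration.integral_add) auto
      also have "(LINT s|lborel. P (exp (- s)) * F s - P (exp (- s)) * G s) = 0"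
        using iP poly_eq[OF P(1)] by simp
      finally have "\<bar>LINT s|lborel. \<phi> (exp (- s)) * (F s - G s)\<bar>
          = \<bar>LINT s|lborel. (\<phi> (exp (- s)) - P (exp (- s))) * F s - (\<phi> (exp (- s)) - P (exp (- s))) * G s\<bar>" by simp
      also have "\<dots> \<le> (LINT s|lborel. e * (F s + G s))"
      proof (rule integral_abs_bound[THEN order_trans], rule integral_mono)
        show "integrable lborel (\<lambda>s. \<bar>(\<phi> (exp (- s)) - P (exp (- s))) * F s - (\<phi> (exp (- s)) - P (exp (- s))) * G s\<bar>)"
          using iD by (intro integrable_abs Bochner_Integration.integrable_diff)
        show "integrable lborel (\<lambda>s. e * (F s + G s))" using iF iG by simp
        fix s
        show "\<bar>(\<phi> (exp (- s)) - P (exp (- s))) * F s - (\<phi> (exp (- s)) - P (exp (- s))) * G s\<bar> \<le> e * (F s + G s)"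
        proof (cases "0 < s")
          case True
          have "\<bar>(\<phi> (exp (- s)) - P (exp (- s))) * F s - (\<phi> (exp (- s)) - P (exp (- s))) * G s\<bar>
              = \<bar>\<phi> (exp (- s)) - P (exp (- s))\<bar> * \<bar>F s - G s\<bar>"
            by (simp add: abs_mult[symmetric] right_diff_distrib)
          also have "\<dots> \<le> e * (F s + G s)"
            using True FG0[of s] P(2)[of "exp (- s)"] by (intro mult_mono) auto
          finally show ?thesis .
        qed (use FGneg in simp)
      qed
      also have "\<dots> = e * B" by (simp add: B_def)
      finally show ?thesis .
    qed
    note small = this
    have "\<bar>LINT s|lborel. \<phi> (exp (- s)) * (F s - G s)\<bar> \<le> 0"
    proof (rule field_le_epsilon)
      fix e :: real assume e: "0 < e"
      have "\<bar>LINT s|lborel. \<phi> (exp (- s)) * (F s - G s)\<bar> \<le> e / (B + 1) * B"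
        using B0 e by (intro small) auto
      also have "\<dots> \<le> 0 + e" using B0 e by (simp add: field_simps)
      finally show "\<bar>LINT s|lborel. \<phi> (exp (- s)) * (F s - G s)\<bar> \<le> 0 + e" .
    qed
    then show ?thesis by simp
  qed
  have "continuous_on {0<..} (\<lambda>s. f s - g s)" using f g by (intro continuous_intros)
  then obtain \<delta>' where \<delta>': "0 < \<delta>'" "\<And>s. 0 < s \<Longrightarrow> \<bar>s - s0\<bar> < \<delta>' \<Longrightarrow> \<bar>(f s - g s) - (f s0 - g s0)\<bar> < f s0 - g s0"
    unfolding continuous_on_iff dist_real_def using s0 gt
    by (metis diff_gt_0_iff_gt greaterThan_iff)
  define \<delta> where "\<delta> = min \<delta>' s0"
  have \<delta>: "0 < \<delta>" "\<delta> \<le> s0" using \<delta>'(1) s0 by (auto simp: \<delta>_def)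
  have pos: "g s < f s" "0 < s" if "\<bar>s - s0\<bar> < \<delta>" for s
  proof -
    show "0 < s" using that by (auto simp: \<delta>_def)
    then show "g s < f s" using \<delta>'(2)[of s] that by (auto simp: \<delta>_def)
  qed
  \<comment> \<open>the tent over the image of (s0 - \<delta>, s0 + \<delta>) under s \<mapsto> e^(-s)\<close>
  define \<phi> where "\<phi> = (\<lambda>x. max 0 (min (x - exp (- (s0 + \<delta>))) (exp (- (s0 - \<delta>)) - x)) :: real)"
  have \<phi>: "continuous_on S \<phi>" for S unfolding \<phi>_def by (intro continuous_intros)
  have \<phi>m[measurable]: "\<phi> \<in> borel_measurable borel" by (rule borel_measurable_continuous_onI[OF \<phi>])
  have \<phi>0: "0 \<le> \<phi> x" for x by (simp add: \<phi>_def)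
  have \<phi>1: "0 < \<phi> (exp (- s)) \<longleftrightarrow> \<bar>s - s0\<bar> < \<delta>" for s
    by (auto simp: \<phi>_def less_max_iff_disj abs_less_iff)
  have out: "\<phi> (exp (- s)) = 0" if "\<not> \<bar>s - s0\<bar> < \<delta>" for s using \<phi>1[of s] \<phi>0[of "exp (- s)"] that by linarith
  have \<phi>le: "\<bar>\<phi> (exp (- s))\<bar> \<le> 1" if "0 < s" for s
  proof -
    have "exp (- s) - exp (- (s0 + \<delta>)) \<le> 1"
    proof -
      have "exp (- s) \<le> 1" using that by simp
      moreover have "0 < exp (- (s0 + \<delta>))" by (rule exp_gt_zero)
      ultimately show ?thesis by linarith
    qed
    then show ?thesis by (simp add: \<phi>_def abs_le_iff min.coboundedI1)
  qed
  define H where "H = (\<lambda>s. \<phi> (exp (- s)) * (F s - G s))"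
  have H0: "0 \<le> H s" for s
    using out[of s] \<phi>0[of "exp (- s)"] pos[of s] by (cases "\<bar>s - s0\<bar> < \<delta>") (auto simp: H_def F_def G_def)
  have "integrable lborel (\<lambda>s. \<phi> (exp (- s)) * F s)" "integrable lborel (\<lambda>s. \<phi> (exp (- s)) * G s)"
    by (rule weighted[where B = 1]; use iF iG FGneg \<phi>le in simp)+
  then have iH: "integrable lborel H" unfolding H_def right_diff_distrib by simp
  have "AE s in lborel. H s = 0"
    using integral_nonneg_eq_0_iff_AE[OF iH] H0 cont_eq[OF \<phi> \<phi>m] by (simp add: H_def)
  then have "AE s in lborel. s \<notin> {s0 - \<delta> <..< s0 + \<delta>}"
  proof (rule AE_mp, intro AE_I2 impI notI)
    fix s assume "H s = 0" and s: "s \<in> {s0 - \<delta> <..< s0 + \<delta>}"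
    from s have s': "\<bar>s - s0\<bar> < \<delta>" by auto
    with pos[OF s'] \<phi>1[of s] have "0 < H s" by (simp add: H_def F_def G_def)
    with \<open>H s = 0\<close> show False by simp
  qed
  then have "{s0 - \<delta> <..< s0 + \<delta>} \<in> null_sets lborel"
    by (subst (asm) AE_iff_null_sets[symmetric]) auto
  then show False using \<delta> by (auto simp: null_sets_def)
qed

text \<open>Both sides have the Laplace transform exp (- t l^\<alpha>).\<close>
lemma subordination_scaling:
  assumes \<eta>: "subordination_density \<alpha> \<eta>" and \<alpha>: "0 < \<alpha>" and t: "0 < t" and s: "0 < s"
  shows "\<eta> t s = t powr (- 1 / \<alpha>) * \<eta> 1 (s * t powr (- 1 / \<alpha>))"
proof -
  define c where "c = t powr (- 1 / \<alpha>)"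
  have c: "0 < c" using t by (simp add: c_def)
  define g where "g = (\<lambda>s. c * \<eta> 1 (s * c))"
  note sd = \<eta>[unfolded subordination_density_def, rule_format]
  have cont: "continuous_on {0<..} (\<eta> t)" "continuous_on {0<..} (\<eta> 1)"
    and nn: "\<And>s. 0 < s \<Longrightarrow> 0 \<le> \<eta> t s" "\<And>s. 0 < s \<Longrightarrow> 0 \<le> \<eta> 1 s"
    using sd[OF t] sd[of 1] by auto
  have lap: "\<And>l. 0 \<le> l \<Longrightarrow> (\<integral>\<^sup>+ s\<in>{0<..}. ennreal (exp (- l * s) * \<eta> t s) \<partial>lborel) = ennreal (exp (- t * l powr \<alpha>))"
    using sd[OF t] by blast
  have lap1: "\<And>l. 0 \<le> l \<Longrightarrow> (\<integral>\<^sup>+ s\<in>{0<..}. ennreal (exp (- l * s) * \<eta> 1 s) \<partial>lborel) = ennreal (exp (- 1 * l powr \<alpha>))"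
    using sd[OF zero_less_one] by blast
  have contg: "continuous_on {0<..} g"
    unfolding g_def using c
    by (intro continuous_intros continuous_on_compose2[OF cont(2)]) auto
  have nng: "0 \<le> g s" if "0 < s" for s using nn(2)[of "s * c"] c that by (simp add: g_def)
  have [measurable]: "(\<lambda>s. indicator {0<..} s * \<eta> 1 s) \<in> borel_measurable borel"
    using borel_measurable_continuous_on_indicator[OF _ cont(2)] by simp
  have lapg: "(\<integral>\<^sup>+ s\<in>{0<..}. ennreal (exp (- l * s) * g s) \<partial>lborel) = ennreal (exp (- t * l powr \<alpha>))" if l: "0 \<le> l" for l
  proof -
    have "ennreal (exp (- t * l powr \<alpha>)) = ennreal (exp (- 1 * (l / c) powr \<alpha>))"
      using l t \<alpha> by (simp add: c_def powr_divide powr_powr powr_minus powr_mult field_simps)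
    also have "\<dots> = (\<integral>\<^sup>+ s\<in>{0<..}. ennreal (exp (- (l / c) * s) * \<eta> 1 s) \<partial>lborel)"
      using l c by (subst lap1) auto
    also have "\<dots> = (\<integral>\<^sup>+ s. ennreal (exp (- (l / c) * s) * (indicator {0<..} s * \<eta> 1 s)) \<partial>lborel)"
      by (intro nn_integral_cong) (auto simp: indicator_def)
    also have "\<dots> = ennreal c * (\<integral>\<^sup>+ s. ennreal (exp (- (l / c) * (0 + c * s)) * (indicator {0<..} (0 + c * s) * \<eta> 1 (0 + c * s))) \<partial>lborel)"
      using c by (subst nn_integral_real_affine[where c = c and t = 0]) auto
    also have "\<dots> = (\<integral>\<^sup>+ s. ennreal c * ennreal (exp (- (l / c) * (0 + c * s)) * (indicator {0<..} (0 + c * s) * \<eta> 1 (0 + c * s))) \<partial>lborel)"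
      by (subst nn_integral_cmult) auto
    also have "\<dots> = (\<integral>\<^sup>+ s\<in>{0<..}. ennreal (exp (- l * s) * g s) \<partial>lborel)"
      using c nn(2) by (intro nn_integral_cong)
        (auto simp: indicator_def g_def ennreal_mult[symmetric] zero_less_mult_iff mult_ac)
    finally show ?thesis ..
  qed
  have fin: "(\<integral>\<^sup>+ s\<in>{0<..}. ennreal (\<eta> t s) \<partial>lborel) < top" "(\<integral>\<^sup>+ s\<in>{0<..}. ennreal (g s) \<partial>lborel) < top"
    using lap[of 0] lapg[of 0] by simp_all
  have same: "(\<integral>\<^sup>+ s\<in>{0<..}. ennreal (exp (- real n * s) * \<eta> t s) \<partial>lborel)
      = (\<integral>\<^sup>+ s\<in>{0<..}. ennreal (exp (- real n * s) * g s) \<partial>lborel)" for n :: nat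
    by (rule trans[OF lap[of "real n"] lapg[of "real n", symmetric]]) auto
  have "\<eta> t s \<le> g s"
    by (rule laplace_transform_le[OF cont(1) nn(1) contg nng fin(1) same s])
  moreover have "g s \<le> \<eta> t s"
    by (rule laplace_transform_le[OF contg nng cont(1) nn(1) fin(2) same[symmetric] s])
  ultimately have "\<eta> t s = g s" by simp
  then show ?thesis by (simp add: g_def c_def)
qed

lemma summable_powr_exp_powr:
  fixes g \<alpha> :: real
  assumes "0 < \<alpha>"
  shows "summable (\<lambda>j::nat. real (Suc j) powr g * exp (- (real (Suc j) powr \<alpha>)))"
proof -
  have "(\<lambda>j::nat. real j powr g * exp (- (real j powr \<alpha>))) \<in> O(\<lambda>j. real j powr (- 2))"
    using assms by real_asymp
  then have "summable (\<lambda>j::nat. real j powr g * exp (- (real j powr \<alpha>)))"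
    by (rule summable_comparison_test_bigo[rotated]) (simp add: summable_real_powr_iff)
  then show ?thesis by (rule summable_Suc_iff[THEN iffD2])
qed

text \<open>For s < 1 the summand with index about 1 / s alone is large enough. The sum is a substitute for the
  integral representation of s^(-g) and reduces negative moments to Laplace transforms at integers.\<close>
lemma powr_neg_le_exp_sum:
  fixes g s :: real
  assumes g: "0 \<le> g" and s: "0 < s"
  shows "ennreal (s powr (- g)) \<le> 1 + ennreal (exp 2) * (\<Sum>j. ennreal (real (Suc j) powr g * exp (- real (Suc j) * s)))"
proof (cases "1 \<le> s")
  case True
  have "s powr (- g) \<le> s powr 0" using True g by (intro powr_mono) auto
  then have "ennreal (s powr (- g)) \<le> 1" using s by (simp add: ennreal_leI)
  then show ?thesis by (rule order_trans) simp
next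
  case False
  \<comment> \<open>This index i satisfies 1 \<le> i s \<le> 2.\<close>
  define i where "i = nat \<lceil>1 / s\<rceil>"
  have i: "1 / s \<le> real i" "real i \<le> 2 / s" "0 < i"
  proof -
    show "1 / s \<le> real i" unfolding i_def by linarith
    have "real i \<le> 1 / s + 1" using s by (simp add: i_def)
    also have "\<dots> \<le> 2 / s" using False s by (simp add: field_simps)
    finally show "real i \<le> 2 / s" .
    show "0 < i" using s by (simp add: i_def)
  qed
  obtain j where j: "i = Suc j" using i(3) by (cases i) auto
  have "s powr (- g) = (1 / s) powr g" using s by (simp add: powr_divide powr_minus field_simps)
  also have "\<dots> \<le> real i powr g" using i(1) s g by (intro powr_mono2) auto
  also have "\<dots> \<le> real i powr g * (exp 2 * exp (- real i * s))"
  proof -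
    have "real i * s \<le> 2" using i(2) s by (simp add: field_simps)
    then have "1 \<le> exp 2 * exp (- real i * s)" by (simp add: exp_add[symmetric])
    then show ?thesis by (intro mult_le_cancel_left1[THEN iffD2]) auto
  qed
  finally have "ennreal (s powr (- g)) \<le> ennreal (exp 2) * ennreal (real (Suc j) powr g * exp (- real (Suc j) * s))"
    by (simp add: ennreal_mult[symmetric] j ennreal_leI mult_ac del: of_nat_Suc)
  also have "\<dots> \<le> ennreal (exp 2) * (\<Sum>j. ennreal (real (Suc j) powr g * exp (- real (Suc j) * s)))"
    by (intro mult_left_mono sum_le_suminf[where I = "{j}", simplified]) auto
  also have "\<dots> \<le> 1 + \<dots>" by simp
  finally show ?thesis .
qed

text \<open>For t = 1 the moment is at most 1 plus a constant times the sum of j^g exp (- j^\<alpha>); scaling gives all t.\<close>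
lemma subordination_negative_moment:
  assumes \<eta>: "subordination_density \<alpha> \<eta>" and \<alpha>: "0 < \<alpha>" and g: "0 \<le> g"
  obtains Q where "0 < Q" "\<And>t. 0 < t \<Longrightarrow>
    (\<integral>\<^sup>+ s\<in>{0<..}. ennreal (s powr (- g) * \<eta> t s) \<partial>lborel) \<le> ennreal (Q * t powr (- (g / \<alpha>)))"
proof -
  note sd = \<eta>[unfolded subordination_density_def, rule_format, OF zero_less_one]
  have cont: "continuous_on {0<..} (\<eta> 1)"
    and nn: "\<And>s. 0 < s \<Longrightarrow> 0 \<le> \<eta> 1 s"
    using sd by auto
  have lap: "\<And>l. 0 \<le> l \<Longrightarrow> (\<integral>\<^sup>+ s\<in>{0<..}. ennreal (exp (- l * s) * \<eta> 1 s) \<partial>lborel) = ennreal (exp (- 1 * l powr \<alpha>))"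
    using sd by blast
  define X where "X = (\<lambda>s. indicator {0<..} s * \<eta> 1 s)"
  have [measurable]: "X \<in> borel_measurable borel"
    unfolding X_def using borel_measurable_continuous_on_indicator[OF _ cont] by simp
  have X0: "0 \<le> X s" for s using nn by (auto simp: X_def indicator_def)
  have lapX: "(\<integral>\<^sup>+ s. ennreal (exp (- l * s) * X s) \<partial>lborel) = ennreal (exp (- (l powr \<alpha>)))" if "0 \<le> l" for l
    using lap[OF that] by (subst (asm) nn_integral_cong[where v = "\<lambda>s. ennreal (exp (- l * s) * X s)"])
      (auto simp: X_def indicator_def)
  let ?S = "\<lambda>j::nat. real (Suc j) powr g * exp (- (real (Suc j) powr \<alpha>))"
  have "(\<integral>\<^sup>+ s. ennreal (s powr (- g) * X s) \<partial>lborel)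
     \<le> (\<integral>\<^sup>+ s. ennreal (X s) + ennreal (exp 2) * (\<Sum>j. ennreal (real (Suc j) powr g * (exp (- real (Suc j) * s) * X s))) \<partial>lborel)"
  proof (rule nn_integral_mono)
    fix s
    show "ennreal (s powr (- g) * X s) \<le> ennreal (X s) + ennreal (exp 2) * (\<Sum>j. ennreal (real (Suc j) powr g * (exp (- real (Suc j) * s) * X s)))"
    proof (cases "0 < s")
      case True
      have "ennreal (s powr (- g) * X s) = ennreal (s powr (- g)) * ennreal (X s)"
        using X0 by (simp add: ennreal_mult)
      also have "\<dots> \<le> (1 + ennreal (exp 2) * (\<Sum>j. ennreal (real (Suc j) powr g * exp (- real (Suc j) * s)))) * ennreal (X s)"
        by (intro mult_right_mono powr_neg_le_exp_sum g True) auto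
      also have "\<dots> = ennreal (X s) + ennreal (exp 2) * (\<Sum>j. ennreal (real (Suc j) powr g * exp (- real (Suc j) * s)) * ennreal (X s))"
        by (simp add: distrib_right ennreal_suminf_multc mult.assoc del: of_nat_Suc)
      also have "\<dots> = ennreal (X s) + ennreal (exp 2) * (\<Sum>j. ennreal (real (Suc j) powr g * (exp (- real (Suc j) * s) * X s)))"
        using X0 by (simp add: ennreal_mult[symmetric] mult.assoc del: of_nat_Suc)
      finally show ?thesis .
    qed (auto simp: X_def)
  qed
  also have "\<dots> = (\<integral>\<^sup>+ s. ennreal (X s) \<partial>lborel)
      + ennreal (exp 2) * (\<Sum>j. (\<integral>\<^sup>+ s. ennreal (real (Suc j) powr g * (exp (- real (Suc j) * s) * X s)) \<partial>lborel))"
    by (simp add: nn_integral_add nn_integral_cmult nn_integral_suminf del: of_nat_Suc)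
  also have "(\<lambda>j. \<integral>\<^sup>+ s. ennreal (real (Suc j) powr g * (exp (- real (Suc j) * s) * X s)) \<partial>lborel) = (\<lambda>j. ennreal (?S j))"
  proof
    fix j
    have "(\<integral>\<^sup>+ s. ennreal (real (Suc j) powr g * (exp (- real (Suc j) * s) * X s)) \<partial>lborel)
        = (\<integral>\<^sup>+ s. ennreal (real (Suc j) powr g) * ennreal (exp (- real (Suc j) * s) * X s) \<partial>lborel)"
      using X0 by (simp add: ennreal_mult del: of_nat_Suc)
    also have "\<dots> = ennreal (real (Suc j) powr g) * ennreal (exp (- (real (Suc j) powr \<alpha>)))"
      by (subst nn_integral_cmult) (simp_all only: lapX of_nat_0_le_iff, measurable)
    finally show "(\<integral>\<^sup>+ s. ennreal (real (Suc j) powr g * (exp (- real (Suc j) * s) * X s)) \<partial>lborel) = ennreal (?S j)"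
      by (simp add: ennreal_mult del: of_nat_Suc)
  qed
  also have "(\<Sum>j. ennreal (?S j)) = ennreal (\<Sum>j. ?S j)"
    by (rule suminf_ennreal2[OF _ summable_powr_exp_powr[OF \<alpha>]]) simp
  also have "(\<integral>\<^sup>+ s. ennreal (X s) \<partial>lborel) = 1" using lapX[of 0] by simp
  also have "1 + ennreal (exp 2) * ennreal (\<Sum>j. ?S j) = ennreal (1 + exp 2 * (\<Sum>j. ?S j))"
    using suminf_nonneg[OF summable_powr_exp_powr[OF \<alpha>, of g]]
    by (simp add: ennreal_mult del: of_nat_Suc)
  finally have fin: "(\<integral>\<^sup>+ s. ennreal (s powr (- g) * X s) \<partial>lborel) \<le> ennreal (1 + exp 2 * (\<Sum>j. ?S j))" .
  define Q where "Q = 1 + exp 2 * (\<Sum>j. ?S j)"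
  have Q: "0 < Q"
    unfolding Q_def by (intro add_pos_nonneg suminf_nonneg[OF summable_powr_exp_powr[OF \<alpha>]] mult_nonneg_nonneg) auto
  show ?thesis
  proof (rule that[OF Q])
    fix t :: real assume t: "0 < t"
    define c where "c = t powr (- 1 / \<alpha>)"
    have c: "0 < c" using t by (simp add: c_def)
    have "(\<integral>\<^sup>+ s\<in>{0<..}. ennreal (s powr (- g) * \<eta> t s) \<partial>lborel)
        = (\<integral>\<^sup>+ s. ennreal c * ennreal (s powr (- g) * X (0 + c * s)) \<partial>lborel)"
    proof (rule nn_integral_cong)
      fix s
      show "ennreal (s powr (- g) * \<eta> t s) * indicator {0<..} s = ennreal c * ennreal (s powr (- g) * X (0 + c * s))"
      proof (cases "0 < s")
        case True
        have "\<eta> t s = c * \<eta> 1 (c * s)"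
          using subordination_scaling[OF \<eta> \<alpha> t True] by (simp add: c_def mult.commute)
        then show ?thesis
          using True c nn[of "c * s"]
          by (simp add: X_def zero_less_mult_iff ennreal_mult[symmetric] mult_ac)
      qed (use c in \<open>simp add: X_def zero_less_mult_iff\<close>)
    qed
    also have "\<dots> = ennreal c * (\<integral>\<^sup>+ s. ennreal (s powr (- g) * X (0 + c * s)) \<partial>lborel)"
      by (rule nn_integral_cmult) measurable
    also have "\<dots> = ennreal c * (\<integral>\<^sup>+ s. ennreal (((0 + c * s) / c) powr (- g) * X (0 + c * s)) \<partial>lborel)"
      using c by simp
    also have "\<dots> = (\<integral>\<^sup>+ s. ennreal ((s / c) powr (- g) * X s) \<partial>lborel)"
      using c by (subst nn_integral_real_affine[where c = c and t = 0 and f = "\<lambda>s. ennreal ((s / c) powr (- g) * X s)"]) auto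
    also have "\<dots> = (\<integral>\<^sup>+ s. ennreal (c powr g) * ennreal (s powr (- g) * X s) \<partial>lborel)"
    proof (rule nn_integral_cong)
      fix s
      show "ennreal ((s / c) powr (- g) * X s) = ennreal (c powr g) * ennreal (s powr (- g) * X s)"
        using c X0[of s] by (cases "0 < s")
          (auto simp: X_def powr_divide powr_minus ennreal_mult[symmetric] field_simps)
    qed
    also have "\<dots> = ennreal (c powr g) * (\<integral>\<^sup>+ s. ennreal (s powr (- g) * X s) \<partial>lborel)"
      by (rule nn_integral_cmult) measurable
    also have "\<dots> \<le> ennreal (c powr g) * ennreal Q"
      unfolding Q_def by (intro mult_left_mono fin) auto
    also have "\<dots> = ennreal (Q * t powr (- (g / \<alpha>)))"
      using Q by (simp add: ennreal_mult[symmetric] c_def powr_powr mult.commute)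
    finally show "(\<integral>\<^sup>+ s\<in>{0<..}. ennreal (s powr (- g) * \<eta> t s) \<partial>lborel) \<le> ennreal (Q * t powr (- (g / \<alpha>)))" .
  qed
qed

section \<open>A jointly measurable version of the fractional heat kernel\<close>

lemma (in sigma_finite_measure) AE_fst_snd:
  assumes "AE x in M. P x"
  shows "AE z in M \<Otimes>\<^sub>M M. P (fst z)" "AE z in M \<Otimes>\<^sub>M M. P (snd z)"
proof -
  obtain N where N: "N \<in> null_sets M" "{x \<in> space M. \<not> P x} \<subseteq> N"
    using assms by (auto simp: eventually_ae_filter)
  have "N \<times> space M \<in> null_sets (M \<Otimes>\<^sub>M M)" "space M \<times> N \<in> null_sets (M \<Otimes>\<^sub>M M)"
    using N(1) by (auto simp: null_sets_def emeasure_pair_measure_Times)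
  moreover have "{z \<in> space (M \<Otimes>\<^sub>M M). \<not> P (fst z)} \<subseteq> N \<times> space M"
    "{z \<in> space (M \<Otimes>\<^sub>M M). \<not> P (snd z)} \<subseteq> space M \<times> N"
    using N(2) by (auto simp: space_pair_measure)
  ultimately show "AE z in M \<Otimes>\<^sub>M M. P (fst z)" "AE z in M \<Otimes>\<^sub>M M. P (snd z)"
    by (auto intro: AE_I')
qed

text \<open>The total measure must not vanish, since the
  defining properties hold almost everywhere and would be void otherwise.\<close>
locale bounded_heat_kernel = sigma_finite_measure M
  for M :: "'a measure" +
  fixes h :: "real \<Rightarrow> 'a \<Rightarrow> 'a \<Rightarrow> real" and c g :: real
  assumes space_UNIV: "space M = UNIV"
    and nontrivial: "emeasure M UNIV \<noteq> 0"
    and heat: "heat_kernel M h"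
    and h_nonneg: "\<And>s x y. 0 < s \<Longrightarrow> 0 \<le> h s x y"
    and h_le: "\<And>s x y. 0 < s \<Longrightarrow> h s x y \<le> c * s powr (- g)"
    and c_pos: "0 < c" and g_nonneg: "0 \<le> g"
begin

lemma h_measurable: "0 < t \<Longrightarrow> (\<lambda>(x, y). h t x y) \<in> borel_measurable (M \<Otimes>\<^sub>M M)"
  using heat by (simp add: heat_kernel_def)

lemma h_measurable_right: "0 < t \<Longrightarrow> (\<lambda>y. h t x y) \<in> borel_measurable M"
  using measurable_compose[OF measurable_Pair1' h_measurable, of x t] by (simp add: space_UNIV)

lemma h_measurable_left: "0 < t \<Longrightarrow> (\<lambda>x. h t x y) \<in> borel_measurable M"
  using measurable_compose[OF measurable_Pair2' h_measurable, of y t] by (simp add: space_UNIV)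

definition regular_pair :: "'a \<Rightarrow> 'a \<Rightarrow> bool" where
  "regular_pair x y \<longleftrightarrow> (\<forall>s>0. \<forall>t>0.
        0 \<le> h t x y \<and>
        (\<integral>\<^sup>+ z. ennreal (h t x z) \<partial>M) \<le> 1 \<and>
        h t x y = h t y x \<and>
        ennreal (h (s + t) x y) = (\<integral>\<^sup>+ z. ennreal (h s x z * h t z y) \<partial>M))"

lemma regular_pairD:
  assumes "regular_pair x y" "0 < t"
  shows "(\<integral>\<^sup>+ z. ennreal (h t x z) \<partial>M) \<le> 1" "h t x y = h t y x"
    "0 < s \<Longrightarrow> ennreal (h (s + t) x y) = (\<integral>\<^sup>+ z. ennreal (h s x z * h t z y) \<partial>M)"
  using assms unfolding regular_pair_def by blast+

lemma AE_regular_pair: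
  "AE z in M \<Otimes>\<^sub>M M. regular_pair (fst z) (snd z)"
  "AE x in M. AE y in M. regular_pair x y" "AE y in M. AE x in M. regular_pair x y"
proof -
  interpret MM: pair_sigma_finite M M by (rule pair_sigma_finite.intro) unfold_locales
  show 0: "AE z in M \<Otimes>\<^sub>M M. regular_pair (fst z) (snd z)"
    using heat by (simp add: heat_kernel_def regular_pair_def split_beta')
  then obtain N where N: "N \<in> null_sets (M \<Otimes>\<^sub>M M)" "{z \<in> space (M \<Otimes>\<^sub>M M). \<not> regular_pair (fst z) (snd z)} \<subseteq> N"
    by (auto simp: eventually_ae_filter)
  have sub: "regular_pair x y" if "(x, y) \<notin> N" for x y
    using that subsetD[OF N(2), of "(x, y)"] by (auto simp: space_pair_measure space_UNIV)
  have ae: "AE x in M. AE y in M. (x, y) \<notin> N"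
    by (rule MM.AE_pair[OF AE_not_in[OF N(1)]])
  have "{z \<in> space (M \<Otimes>\<^sub>M M). (fst z, snd z) \<notin> N} = space (M \<Otimes>\<^sub>M M) - N" by auto
  then have "{z \<in> space (M \<Otimes>\<^sub>M M). (fst z, snd z) \<notin> N} \<in> sets (M \<Otimes>\<^sub>M M)"
    using N(1) by (auto intro: sets.Diff)
  from MM.AE_commute[OF this] ae have ae': "AE y in M. AE x in M. (x, y) \<notin> N" by simp
  show "AE x in M. AE y in M. regular_pair x y"
    using ae by (rule eventually_mono) (erule eventually_mono, erule sub)
  show "AE y in M. AE x in M. regular_pair x y"
    using ae' by (rule eventually_mono) (erule eventually_mono, erule sub)
qed

lemma AE_mass_right: "AE x in M. \<forall>t>0. (\<integral>\<^sup>+ z. ennreal (h t x z) \<partial>M) \<le> 1"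
  using AE_regular_pair(2)
proof eventually_elim
  case (elim x)
  have "\<exists>y. regular_pair x y"
  proof (rule ccontr)
    assume "\<nexists>y. regular_pair x y"
    with elim have "AE y in M. False" by simp
    then have "ae_filter M = bot" by (simp add: trivial_limit_def)
    then show False using nontrivial by (simp add: ae_filter_eq_bot_iff space_UNIV)
  qed
  then show ?case using regular_pairD(1) by blast
qed

lemma AE_mass_left: "AE y in M. \<forall>t>0. (\<integral>\<^sup>+ z. ennreal (h t z y) \<partial>M) \<le> 1"
  using AE_regular_pair(3) AE_mass_right
proof eventually_elim
  case (elim y)
  show ?case
  proof (intro allI impI)
    fix t :: real assume t: "0 < t"
    have "(\<integral>\<^sup>+ z. ennreal (h t z y) \<partial>M) = (\<integral>\<^sup>+ z. ennreal (h t y z) \<partial>M)"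
      by (rule nn_integral_cong_AE, rule eventually_mono[OF elim(1)])
        (use t in \<open>simp add: regular_pairD(2)[of _ y]\<close>)
    then show "(\<integral>\<^sup>+ z. ennreal (h t z y) \<partial>M) \<le> 1" using elim(2) t by simp
  qed
qed

lemma energy2_le_mass:
  assumes "0 < s"
  shows "energy M 2 (\<lambda>z. h s x z) \<le> ennreal (c * s powr (- g)) * (\<integral>\<^sup>+ z. ennreal (h s x z) \<partial>M)"
proof -
  have "energy M 2 (\<lambda>z. h s x z) \<le> (\<integral>\<^sup>+ z. ennreal (c * s powr (- g)) * ennreal (h s x z) \<partial>M)"
    unfolding energy_def nn_integral_completion
  proof (rule nn_integral_mono)
    fix z
    have "\<bar>h s x z\<bar> powr 2 = h s x z * h s x z"
      using h_nonneg[OF assms, of x z] by (simp add: power2_eq_square)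
    also have "\<dots> \<le> (c * s powr (- g)) * h s x z"
      by (intro mult_right_mono h_le h_nonneg assms)
    finally show "ennreal (\<bar>h s x z\<bar> powr 2) \<le> ennreal (c * s powr (- g)) * ennreal (h s x z)"
      using h_nonneg[OF assms, of x z] c_pos by (simp add: ennreal_mult[symmetric] ennreal_leI)
  qed
  also have "\<dots> = ennreal (c * s powr (- g)) * (\<integral>\<^sup>+ z. ennreal (h s x z) \<partial>M)"
    using h_measurable_right[OF assms, of x] by (intro nn_integral_cmult) simp
  finally show ?thesis .
qed

text \<open>The function h s x is in L^2, and by the semigroup law and symmetry h (s + u) x is its image under the
  semigroup at time u. Strong continuity applied to it gives right-continuity in s.\<close>
lemma AE_right_continuous_L2:
  "AE x in M. \<forall>s>0. \<forall>e>0. \<forall>\<^sub>F u in at_right 0. energy M 2 (\<lambda>z. h (s + u) x z - h s x z) \<le> ennreal e"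
  using AE_regular_pair(2) AE_mass_right
proof eventually_elim
  case (elim x)
  show ?case
  proof (intro allI impI)
    fix s e :: real assume s: "0 < s" and e: "0 < e"
    note hm = h_measurable_right[OF s, of x]
    have "energy M 2 (h s x) < top"
      by (rule le_less_trans[OF energy2_le_mass[OF s]])
        (use elim(2) s in \<open>auto simp: ennreal_mult_less_top intro: le_less_trans\<close>)
    then have "h s x \<in> Lp_space M 2"
      using hm by (intro Lp_spaceI measurable_completion) auto
    then have "((\<lambda>t. Lp_enorm M 2 (\<lambda>y. heat_op M h t (h s x) y - h s x y)) \<longlongrightarrow> 0) (at_right 0)"
      using heat by (simp add: heat_kernel_def)
    then have "\<forall>\<^sub>F u in at_right 0. Lp_enorm M 2 (\<lambda>y. heat_op M h u (h s x) y - h s x y) \<le> ennreal (e powr (1 / 2))"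
      using e by (auto dest!: order_tendstoD(2)[where a = "ennreal (e powr (1 / 2))"] elim!: eventually_mono)
    then show "\<forall>\<^sub>F u in at_right 0. energy M 2 (\<lambda>z. h (s + u) x z - h s x z) \<le> ennreal e"
      using eventually_at_right_less[of 0]
    proof eventually_elim
      case (elim u)
      then have u: "0 < u" by simp
      have "AE y in M. heat_op M h u (h s x) y = h (s + u) x y"
        using \<open>AE y in M. regular_pair x y\<close> AE_regular_pair(3)
      proof eventually_elim
        case (elim y)
        have "heat_op M h u (h s x) y = (LINT z|M. h u y z * h s x z)"
          unfolding heat_op_def
          using hm h_measurable_right[OF u, of y] by (intro integral_completion) simp
        also have "\<dots> = enn2real (\<integral>\<^sup>+ z. ennreal (h u y z * h s x z) \<partial>M)"
          using hm h_measurable_right[OF u, of y] h_nonneg s u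
          by (intro integral_eq_nn_integral) auto
        also have "(\<integral>\<^sup>+ z. ennreal (h u y z * h s x z) \<partial>M) = (\<integral>\<^sup>+ z. ennreal (h s x z * h u z y) \<partial>M)"
          by (rule nn_integral_cong_AE, rule eventually_mono[OF elim(2)])
            (use u in \<open>simp add: regular_pairD(2)[of _ y] mult.commute\<close>)
        also have "\<dots> = ennreal (h (s + u) x y)"
          by (rule regular_pairD(3)[OF elim(1) u s, symmetric])
        finally show ?case using h_nonneg[of "s + u" x y] s u by simp
      qed
      then have "energy M 2 (\<lambda>z. h (s + u) x z - h s x z) = energy M 2 (\<lambda>y. heat_op M h u (h s x) y - h s x y)"
        by (intro energy_cong_AE) auto
      also have "\<dots> \<le> ennreal ((e powr (1 / 2)) powr 2)"
        using elim(1) by (subst (asm) Lp_enorm_le_iff) auto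
      finally show ?case using e by (simp add: powr_powr)
    qed
  qed
qed

text \<open>Writing h (s + u + t) x y and h (s + t) x y through the semigroup law as integrals against h t z y, their
  difference is controlled by the L^2 increment and Jensen's inequality with weight h t z y. This is
  how continuity in L^2 becomes continuity at individual points.\<close>
lemma increment_le:
  assumes x: "regular_pair x y" and y: "\<forall>t>0. (\<integral>\<^sup>+ z. ennreal (h t z y) \<partial>M) \<le> 1"
    and s: "0 < s" "0 < t" "0 < u" and d: "0 < d"
    and e: "energy M 2 (\<lambda>z. h (s + u) x z - h s x z) \<le> ennreal (d\<^sup>2 / (c * t powr (- g)))"
  shows "\<bar>h (s + u + t) x y - h (s + t) x y\<bar> \<le> d"
proof -
  have [measurable]: "h s x \<in> borel_measurable M" "h (s + u) x \<in> borel_measurable M" "(\<lambda>z. h t z y) \<in> borel_measurable M"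
    using h_measurable_right h_measurable_left s by auto
  define D where "D = (\<integral>\<^sup>+ z. ennreal (h t z y * \<bar>h (s + u) x z - h s x z\<bar>) \<partial>M)"
  have K: "0 < c * t powr (- g)" using c_pos s by simp
  have "(\<integral>\<^sup>+ z. ennreal (h t z y * \<bar>h (s + u) x z - h s x z\<bar> powr 2) \<partial>M)
      \<le> (\<integral>\<^sup>+ z. ennreal (c * t powr (- g)) * ennreal (\<bar>h (s + u) x z - h s x z\<bar> powr 2) \<partial>M)"
    using K by (intro nn_integral_mono)
      (auto simp: ennreal_mult[symmetric] simp del: powr_numeral intro!: ennreal_leI mult_right_mono h_le s)
  also have "\<dots> = ennreal (c * t powr (- g)) * energy M 2 (\<lambda>z. h (s + u) x z - h s x z)"
    unfolding energy_def nn_integral_completion by (rule nn_integral_cmult) measurable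
  also have "\<dots> \<le> ennreal (c * t powr (- g)) * ennreal (d\<^sup>2 / (c * t powr (- g)))"
    by (intro mult_left_mono e) auto
  also have "\<dots> = ennreal (c * t powr (- g) * (d\<^sup>2 / (c * t powr (- g))))"
    using K by (intro ennreal_mult[symmetric]) (auto intro!: divide_nonneg_pos)
  also have "c * t powr (- g) * (d\<^sup>2 / (c * t powr (- g))) = d\<^sup>2"
    using less_imp_neq[OF K] by (metis nonzero_mult_div_cancel_left times_divide_eq_right)
  finally have "D \<le> ennreal (1 powr (1 - 1 / 2) * (d\<^sup>2) powr (1 / 2))"
    unfolding D_def
    by (intro nn_integral_weighted_Jensen) (use y s h_nonneg in auto)
  also have "1 powr (1 - 1 / 2) * (d\<^sup>2) powr (1 / 2) = d"
    using d by (simp add: powr_half_sqrt)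
  finally have D: "D \<le> ennreal d" .
  have sg: "ennreal (h (s + u + t) x y) = (\<integral>\<^sup>+ z. ennreal (h (s + u) x z * h t z y) \<partial>M)"
      "ennreal (h (s + t) x y) = (\<integral>\<^sup>+ z. ennreal (h s x z * h t z y) \<partial>M)"
    using s by (auto intro!: regular_pairD(3)[OF x])
  have split: "(\<integral>\<^sup>+ z. ennreal (a z * h t z y) \<partial>M) \<le> (\<integral>\<^sup>+ z. ennreal (b z * h t z y) \<partial>M) + ennreal d"
    if ab: "\<And>z. 0 \<le> b z" "\<And>z. a z \<le> b z + \<bar>h (s + u) x z - h s x z\<bar>"
      and [measurable]: "b \<in> borel_measurable M" for a b
  proof -
    have "(\<integral>\<^sup>+ z. ennreal (a z * h t z y) \<partial>M)
        \<le> (\<integral>\<^sup>+ z. ennreal (b z * h t z y) + ennreal (h t z y * \<bar>h (s + u) x z - h s x z\<bar>) \<partial>M)"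
    proof (rule nn_integral_mono)
      fix z
      have "a z * h t z y \<le> (b z + \<bar>h (s + u) x z - h s x z\<bar>) * h t z y"
        using ab(2) h_nonneg s by (intro mult_right_mono) auto
      then have "ennreal (a z * h t z y) \<le> ennreal (b z * h t z y + h t z y * \<bar>h (s + u) x z - h s x z\<bar>)"
        by (intro ennreal_leI) (simp add: algebra_simps)
      also have "\<dots> = ennreal (b z * h t z y) + ennreal (h t z y * \<bar>h (s + u) x z - h s x z\<bar>)"
        using ab(1)[of z] h_nonneg[OF s(2), of z y] by (intro ennreal_plus) auto
      finally show "ennreal (a z * h t z y) \<le> ennreal (b z * h t z y) + ennreal (h t z y * \<bar>h (s + u) x z - h s x z\<bar>)" .
    qed
    also have "\<dots> = (\<integral>\<^sup>+ z. ennreal (b z * h t z y) \<partial>M) + D"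
      unfolding D_def by (rule nn_integral_add) measurable
    also have "\<dots> \<le> (\<integral>\<^sup>+ z. ennreal (b z * h t z y) \<partial>M) + ennreal d" by (intro add_left_mono D)
    finally show ?thesis .
  qed
  have h0: "0 \<le> h (s + u + t) x y" "0 \<le> h (s + t) x y" using h_nonneg s by auto
  have "ennreal (h (s + u + t) x y) \<le> ennreal (h (s + t) x y) + ennreal d"
    unfolding sg by (rule split) (use h_nonneg s in auto)
  moreover have "ennreal (h (s + t) x y) \<le> ennreal (h (s + u + t) x y) + ennreal d"
    unfolding sg by (rule split) (use h_nonneg[of "s + u"] s in auto)
  ultimately show ?thesis
    using h0 d by (simp add: ennreal_plus[symmetric] del: ennreal_plus)
qed

text \<open>A property of almost every point x, or y, holds for almost every pair (x,y), so the mass bounds and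
  the right-continuity can be collected in a single exceptional set.\<close>
lemma exceptional_set:
  obtains N where "N \<in> null_sets (M \<Otimes>\<^sub>M M)"
    "\<And>x y s. (x, y) \<notin> N \<Longrightarrow> 0 < s \<Longrightarrow> (\<integral>\<^sup>+ z. ennreal (h s x z) \<partial>M) \<le> 1"
    "\<And>x y s. (x, y) \<notin> N \<Longrightarrow> 0 < s \<Longrightarrow> (\<integral>\<^sup>+ z. ennreal (h s z y) \<partial>M) \<le> 1"
    "\<And>x y s. (x, y) \<notin> N \<Longrightarrow> 0 < s \<Longrightarrow> ((\<lambda>u. h u x y) \<longlongrightarrow> h s x y) (at_right s)"
proof -
  define Q where "Q = (\<lambda>z. (\<forall>s>0. (\<integral>\<^sup>+ w. ennreal (h s (fst z) w) \<partial>M) \<le> 1) \<and>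
      (\<forall>s>0. (\<integral>\<^sup>+ w. ennreal (h s w (snd z)) \<partial>M) \<le> 1) \<and>
      (\<forall>s>0. ((\<lambda>u. h u (fst z) (snd z)) \<longlongrightarrow> h s (fst z) (snd z)) (at_right s)))"
  have "AE z in M \<Otimes>\<^sub>M M. Q z"
    using AE_regular_pair(1) AE_fst_snd(1)[OF AE_mass_right] AE_fst_snd(2)[OF AE_mass_left]
      AE_fst_snd(1)[OF AE_right_continuous_L2]
  proof eventually_elim
    case (elim z)
    have "((\<lambda>u. h u (fst z) (snd z)) \<longlongrightarrow> h s (fst z) (snd z)) (at_right s)" if s: "0 < s" for s
      unfolding filterlim_at_right_to_0[of _ _ s]
    proof (rule tendstoI)
      fix d :: real assume d: "0 < d"
      have K: "0 < c * (s / 2) powr (- g)" using c_pos s by simp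
      have "\<forall>\<^sub>F u in at_right 0. energy M 2 (\<lambda>w. h (s / 2 + u) (fst z) w - h (s / 2) (fst z) w)
          \<le> ennreal ((d / 2)\<^sup>2 / (c * (s / 2) powr (- g)))"
        using elim(4) s d K by (auto simp del: power_divide)
      then show "\<forall>\<^sub>F u in at_right 0. dist (h (u + s) (fst z) (snd z)) (h s (fst z) (snd z)) < d"
        using eventually_at_right_less[of 0]
      proof eventually_elim
        case (elim u)
        have "\<bar>h (s / 2 + u + s / 2) (fst z) (snd z) - h (s / 2 + s / 2) (fst z) (snd z)\<bar> \<le> d / 2"
          by (rule increment_le[OF \<open>regular_pair _ _\<close> _ _ _ _ _ elim(1)])
            (use s d elim(2) \<open>\<forall>s>0. (\<integral>\<^sup>+ w. ennreal (h s w (snd z)) \<partial>M) \<le> 1\<close> in auto)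
        then show ?case using d by (simp add: dist_real_def add.commute)
      qed
    qed
    then show ?case using elim unfolding Q_def by blast
  qed
  then obtain N where N: "N \<in> null_sets (M \<Otimes>\<^sub>M M)"
    "{z \<in> space (M \<Otimes>\<^sub>M M). \<not> Q z} \<subseteq> N"
    by (auto simp: eventually_ae_filter)
  have "(\<forall>s>0. (\<integral>\<^sup>+ w. ennreal (h s x w) \<partial>M) \<le> 1) \<and>
      (\<forall>s>0. (\<integral>\<^sup>+ w. ennreal (h s w y) \<partial>M) \<le> 1) \<and>
      (\<forall>s>0. ((\<lambda>u. h u x y) \<longlongrightarrow> h s x y) (at_right s))" if "(x, y) \<notin> N" for x y
    using that subsetD[OF N(2), of "(x, y)"] by (auto simp: Q_def space_pair_measure space_UNIV)
  then show ?thesis by (intro that[OF N(1)]) blast+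
qed

text \<open>Setting the kernel to 0 on the exceptional set changes the fractional kernel at almost no pair and
  makes it jointly measurable, with the mass bounds at every point.\<close>
lemma fractional_kernel:
  assumes \<eta>: "subordination_density \<alpha> \<eta>" and \<alpha>: "0 < \<alpha>"
  obtains N k C where "N \<in> null_sets (M \<Otimes>\<^sub>M M)" "smoothing_kernel M k C (g / \<alpha>)"
    "\<And>t x y. 0 < t \<Longrightarrow> (x, y) \<notin> N \<Longrightarrow> frac_heat_kernel \<eta> h t x y = k t x y"
    "\<And>t x y. 0 < t \<Longrightarrow> (x, y) \<notin> N \<Longrightarrow> set_integrable lborel {0<..} (\<lambda>\<sigma>. \<eta> t \<sigma> * h \<sigma> x y)"
proof -
  obtain N where N: "N \<in> null_sets (M \<Otimes>\<^sub>M M)"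
    and mr: "\<And>x y s. (x, y) \<notin> N \<Longrightarrow> 0 < s \<Longrightarrow> (\<integral>\<^sup>+ z. ennreal (h s x z) \<partial>M) \<le> 1"
    and ml: "\<And>x y s. (x, y) \<notin> N \<Longrightarrow> 0 < s \<Longrightarrow> (\<integral>\<^sup>+ z. ennreal (h s z y) \<partial>M) \<le> 1"
    and rc: "\<And>x y s. (x, y) \<notin> N \<Longrightarrow> 0 < s \<Longrightarrow> ((\<lambda>u. h u x y) \<longlongrightarrow> h s x y) (at_right s)"
    using exceptional_set by blast
  have Ns[measurable]: "N \<in> sets (M \<Otimes>\<^sub>M M)" using N by auto
  obtain Q where Q: "0 < Q" "\<And>t. 0 < t \<Longrightarrow>
    (\<integral>\<^sup>+ s\<in>{0<..}. ennreal (s powr (- g) * \<eta> t s) \<partial>lborel) \<le> ennreal (Q * t powr (- (g / \<alpha>)))"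
    using subordination_negative_moment[OF \<eta> \<alpha> g_nonneg] by blast
  have \<eta>nn: "0 \<le> \<eta> t s" if "0 < t" "0 < s" for t s
    using \<eta> that by (auto simp: subordination_density_def)
  have cont1: "continuous_on {0<..} (\<eta> 1)"
    using \<eta> by (auto simp: subordination_density_def)
  define X where "X = (\<lambda>s. indicator {0<..} s * \<eta> 1 s)"
  have [measurable]: "X \<in> borel_measurable borel"
    unfolding X_def using borel_measurable_continuous_on_indicator[OF _ cont1] by simp
  \<comment> \<open>the density in scaled form, which is visibly measurable in both variables\<close>
  define e where "e = (\<lambda>t s. if 0 < t \<and> 0 < s then t powr (- 1 / \<alpha>) * X (s * t powr (- 1 / \<alpha>)) else 0)"
  have e_eq: "e t s = \<eta> t s" if "0 < t" "0 < s" for t s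
    using that subordination_scaling[OF \<eta> \<alpha> that] by (simp add: e_def X_def)
  have e0: "0 \<le> e t s" for t s
    using \<eta>nn[of t s] by (cases "0 < t \<and> 0 < s") (auto simp: e_eq, auto simp: e_def)
  have em: "(\<lambda>z. e (fst z) (snd z)) \<in> borel_measurable (borel \<Otimes>\<^sub>M borel)"
    unfolding e_def by measurable
  have em2[measurable (raw)]: "(\<lambda>z. e (a z) (b z)) \<in> borel_measurable L"
    if [measurable]: "a \<in> borel_measurable L" "b \<in> borel_measurable L" for a b and L :: "'c measure"
    using measurable_compose[OF _ em, of "\<lambda>z. (a z, b z)" L] by simp
  have emass: "(\<integral>\<^sup>+ s. ennreal (e t s) \<partial>lborel) \<le> 1" for t
  proof (cases "0 < t")
    case True
    have "(\<integral>\<^sup>+ s. ennreal (e t s) \<partial>lborel) = (\<integral>\<^sup>+ s\<in>{0<..}. ennreal (exp (- 0 * s) * \<eta> t s) \<partial>lborel)"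
      by (intro nn_integral_cong) (use True in \<open>auto simp: e_eq indicator_def\<close>, auto simp: e_def)
    also have "\<dots> = ennreal (exp (- t * 0 powr \<alpha>))"
      using \<eta> True unfolding subordination_density_def by blast
    finally show ?thesis by simp
  qed (simp add: e_def)
  define H where "H = (\<lambda>s x y. if 0 < s \<and> (x, y) \<notin> N then h s x y else 0)"
  have H0: "0 \<le> H s x y" for s x y using h_nonneg by (auto simp: H_def)
  have Hle: "H s x y \<le> c * s powr (- g)" for s x y using h_le c_pos by (auto simp: H_def)
  have Hm: "(\<lambda>z. H (fst z) (fst (snd z)) (snd (snd z))) \<in> borel_measurable (borel \<Otimes>\<^sub>M (M \<Otimes>\<^sub>M M))"
  proof (rule borel_measurable_LIMSEQ_real)
    fix n :: nat
    \<comment> \<open>Rounding s strictly upwards makes the approximating times approach s from the right.\<close>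
    define \<tau> where "\<tau> = (\<lambda>s::real. \<lfloor>real (Suc n) * s\<rfloor> + 1)"
    have [measurable]: "\<tau> \<in> measurable borel (count_space UNIV)"
      unfolding \<tau>_def by measurable
    have hm: "(\<lambda>z. if 0 < i then h (real_of_int i / real (Suc n)) (fst (snd z)) (snd (snd z)) else 0)
        \<in> borel_measurable (borel \<Otimes>\<^sub>M (M \<Otimes>\<^sub>M M))" for i :: int
    proof (cases "0 < i")
      case True
      then have "0 < real_of_int i / real (Suc n)" by simp
      from measurable_compose[OF measurable_snd h_measurable[OF this]] True show ?thesis
        by (simp add: split_beta')
    qed simp
    have [measurable]: "(\<lambda>z. if 0 < \<tau> (fst z) then h (real_of_int (\<tau> (fst z)) / real (Suc n)) (fst (snd z)) (snd (snd z)) else 0)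
        \<in> borel_measurable (borel \<Otimes>\<^sub>M (M \<Otimes>\<^sub>M M))"
      by (rule measurable_compose_countable[OF hm, of "\<lambda>z. \<tau> (fst z)"]) measurable
    show "(\<lambda>z. if 0 < fst z \<and> snd z \<notin> N then
         (if 0 < \<tau> (fst z) then h (real_of_int (\<tau> (fst z)) / real (Suc n)) (fst (snd z)) (snd (snd z)) else 0) else 0)
       \<in> borel_measurable (borel \<Otimes>\<^sub>M (M \<Otimes>\<^sub>M M))"
      by measurable
  next
    fix z :: "real \<times> 'a \<times> 'a"
    obtain s x y where z: "z = (s, x, y)" by (metis surj_pair)
    define u where "u = (\<lambda>n::nat. real_of_int (\<lfloor>real (Suc n) * s\<rfloor> + 1) / real (Suc n))"
    have "(\<lambda>n. h (u n) x y) \<longlonglongrightarrow> h s x y" and "\<And>n. 0 < \<lfloor>real (Suc n) * s\<rfloor> + 1"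
      if s: "0 < s" "(x, y) \<notin> N"
    proof -
      show "0 < \<lfloor>real (Suc n) * s\<rfloor> + 1" for n
      proof -
        have "0 \<le> \<lfloor>real (Suc n) * s\<rfloor>" using s by simp
        then show ?thesis by linarith
      qed
      have u: "s < u n" "u n \<le> s + 1 / real (Suc n)" for n
      proof -
        have "real (Suc n) * s < real_of_int (\<lfloor>real (Suc n) * s\<rfloor> + 1)"
          "real_of_int (\<lfloor>real (Suc n) * s\<rfloor> + 1) \<le> real (Suc n) * s + 1" by linarith+
        then show "s < u n" "u n \<le> s + 1 / real (Suc n)"
          unfolding u_def
          by (simp_all add: pos_less_divide_eq pos_divide_le_eq distrib_left distrib_right mult.commute del: of_nat_Suc of_int_add)
      qed
      have "u \<longlonglongrightarrow> s"
      proof (rule tendsto_sandwich[OF _ _ tendsto_const])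
        show "(\<lambda>n. s + 1 / real (Suc n)) \<longlonglongrightarrow> s"
          using tendsto_add[OF tendsto_const LIMSEQ_inverse_real_of_nat, of s] by (simp add: inverse_eq_divide)
      qed (use u in \<open>auto intro!: always_eventually less_imp_le\<close>)
      then have "filterlim u (at_right s) sequentially"
        using u by (auto simp: filterlim_at intro!: always_eventually)
      then show "(\<lambda>n. h (u n) x y) \<longlonglongrightarrow> h s x y"
        by (rule filterlim_compose[OF rc[OF s(2,1)]])
    qed
    then show "(\<lambda>n. if 0 < fst z \<and> snd z \<notin> N then
         (if 0 < \<lfloor>real (Suc n) * fst z\<rfloor> + 1 then h (real_of_int (\<lfloor>real (Suc n) * fst z\<rfloor> + 1) / real (Suc n)) (fst (snd z)) (snd (snd z)) else 0) else 0)
       \<longlonglongrightarrow> H (fst z) (fst (snd z)) (snd (snd z))"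
      by (auto simp: z H_def u_def)
  qed
  have Hm2[measurable (raw)]: "(\<lambda>z. H (a z) (b z) (d z)) \<in> borel_measurable L"
    if [measurable]: "a \<in> borel_measurable L" "b \<in> measurable L M" "d \<in> measurable L M" for a b d and L :: "'c measure"
    using measurable_compose[OF _ Hm, of "\<lambda>z. (a z, b z, d z)" L] by simp
  have Hm3: "(\<lambda>z. H (a z) (b z) (d z)) \<in> borel_measurable L"
    if [measurable]: "a \<in> borel_measurable L" "b \<in> measurable L M" "d \<in> measurable L M" for a b d and L :: "real measure"
    using measurable_compose[OF _ Hm, of "\<lambda>z. (a z, b z, d z)" L] by simp
  define k where "k = (\<lambda>t x y. LINT s|lborel. e t s * H s x y)"
  define C where "C = c * Q"
  have bound: "(\<integral>\<^sup>+ s. ennreal (e t s * H s x y) \<partial>lborel) \<le> ennreal (C * t powr (- (g / \<alpha>)))" for t x y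
  proof (cases "0 < t")
    case True
    have "(\<integral>\<^sup>+ s. ennreal (e t s * H s x y) \<partial>lborel) \<le> (\<integral>\<^sup>+ s. ennreal c * (ennreal (s powr (- g) * \<eta> t s) * indicator {0<..} s) \<partial>lborel)"
    proof (rule nn_integral_mono)
      fix s
      show "ennreal (e t s * H s x y) \<le> ennreal c * (ennreal (s powr (- g) * \<eta> t s) * indicator {0<..} s)"
      proof (cases "0 < s")
        case s: True
        have "e t s * H s x y \<le> e t s * (c * s powr (- g))" by (intro mult_left_mono Hle e0)
        then show ?thesis
          using s True c_pos \<eta>nn[OF True s] by (simp add: e_eq ennreal_mult[symmetric] ennreal_leI mult_ac)
      qed (simp add: e_def)
    qed
    also have "\<dots> = (\<integral>\<^sup>+ s. ennreal c * ennreal (s powr (- g) * e t s) \<partial>lborel)"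
      by (intro nn_integral_cong) (use True in \<open>auto simp: e_eq indicator_def\<close>, auto simp: e_def)
    also have "\<dots> = ennreal c * (\<integral>\<^sup>+ s. ennreal (s powr (- g) * e t s) \<partial>lborel)"
      by (rule nn_integral_cmult) measurable
    also have "(\<integral>\<^sup>+ s. ennreal (s powr (- g) * e t s) \<partial>lborel) = (\<integral>\<^sup>+ s\<in>{0<..}. ennreal (s powr (- g) * \<eta> t s) \<partial>lborel)"
      by (intro nn_integral_cong) (use True in \<open>auto simp: e_eq indicator_def\<close>, auto simp: e_def)
    also have "ennreal c * \<dots> \<le> ennreal c * ennreal (Q * t powr (- (g / \<alpha>)))"
      by (intro mult_left_mono Q(2) True) auto
    also have "\<dots> = ennreal (C * t powr (- (g / \<alpha>)))"
      using c_pos Q(1) by (simp add: C_def ennreal_mult[symmetric] mult.assoc)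
    finally show ?thesis .
  qed (simp add: e_def)
  have int: "integrable lborel (\<lambda>s. e t s * H s x y)" for t x y
  proof (rule integrableI_nonneg)
    have [measurable]: "(\<lambda>s. H s x y) \<in> borel_measurable lborel" by (rule Hm3) (auto simp: space_UNIV)
    show "(\<lambda>s. e t s * H s x y) \<in> borel_measurable lborel" by measurable
    show "(\<integral>\<^sup>+ s. ennreal (e t s * H s x y) \<partial>lborel) < \<infinity>"
      using bound[of t x y] by (auto intro: le_less_trans)
  qed (simp add: e0 H0)
  have k_nn: "ennreal (k t x y) = (\<integral>\<^sup>+ s. ennreal (e t s * H s x y) \<partial>lborel)" for t x y
    unfolding k_def by (rule nn_integral_eq_integral[symmetric, OF int]) (simp add: e0 H0)
  interpret LM: pair_sigma_finite lborel M by (rule pair_sigma_finite.intro) unfold_locales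
  have mass: "(\<integral>\<^sup>+ y. \<integral>\<^sup>+ s. ennreal (e t s * A s y) \<partial>lborel \<partial>M) \<le> 1"
    if [measurable]: "case_prod A \<in> borel_measurable (borel \<Otimes>\<^sub>M M)" and A0: "\<And>s y. 0 \<le> A s y"
      and A1: "\<And>s. 0 < s \<Longrightarrow> (\<integral>\<^sup>+ y. ennreal (A s y) \<partial>M) \<le> 1" for t A
  proof -
    have [measurable]: "case_prod A \<in> borel_measurable (lborel \<Otimes>\<^sub>M M)"
      using that(1) by (simp cong: measurable_cong_sets)
    have As: "A s \<in> borel_measurable M" for s
      using measurable_compose[OF measurable_Pair1' that(1), of s] by simp
    have "(\<integral>\<^sup>+ y. \<integral>\<^sup>+ s. ennreal (e t s * A s y) \<partial>lborel \<partial>M) = (\<integral>\<^sup>+ s. \<integral>\<^sup>+ y. ennreal (e t s * A s y) \<partial>M \<partial>lborel)"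
      by (rule LM.Fubini') measurable
    also have "\<dots> = (\<integral>\<^sup>+ s. ennreal (e t s) * (\<integral>\<^sup>+ y. ennreal (A s y) \<partial>M) \<partial>lborel)"
      using As A0 e0 by (intro nn_integral_cong) (simp add: ennreal_mult nn_integral_cmult)
    also have "\<dots> \<le> (\<integral>\<^sup>+ s. ennreal (e t s) \<partial>lborel)"
    proof (rule nn_integral_mono)
      fix s
      show "ennreal (e t s) * (\<integral>\<^sup>+ y. ennreal (A s y) \<partial>M) \<le> ennreal (e t s)"
        using mult_left_mono[OF A1[of s], of "ennreal (e t s)"] by (cases "0 < s") (auto simp: e_def)
    qed
    also have "\<dots> \<le> 1" by (rule emass)
    finally show ?thesis .
  qed
  have Hright: "(\<integral>\<^sup>+ y. ennreal (H s x y) \<partial>M) \<le> 1" if s: "0 < s" for s x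
  proof (cases "\<exists>y0. (x, y0) \<notin> N")
    case True
    then obtain y0 where "(x, y0) \<notin> N" ..
    then have "(\<integral>\<^sup>+ y. ennreal (h s x y) \<partial>M) \<le> 1" using mr s by blast
    moreover have "(\<integral>\<^sup>+ y. ennreal (H s x y) \<partial>M) \<le> (\<integral>\<^sup>+ y. ennreal (h s x y) \<partial>M)"
      by (intro nn_integral_mono) (auto simp: H_def)
    ultimately show ?thesis by simp
  qed (simp add: H_def)
  have Hleft: "(\<integral>\<^sup>+ x. ennreal (H s x y) \<partial>M) \<le> 1" if s: "0 < s" for s y
  proof (cases "\<exists>x0. (x0, y) \<notin> N")
    case True
    then obtain x0 where "(x0, y) \<notin> N" ..
    then have "(\<integral>\<^sup>+ x. ennreal (h s x y) \<partial>M) \<le> 1" using ml s by blast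
    moreover have "(\<integral>\<^sup>+ x. ennreal (H s x y) \<partial>M) \<le> (\<integral>\<^sup>+ x. ennreal (h s x y) \<partial>M)"
      by (intro nn_integral_mono) (auto simp: H_def)
    ultimately show ?thesis by simp
  qed (simp add: H_def)
  have "smoothing_kernel M k C (g / \<alpha>)"
  proof (unfold_locales)
    show "space M = UNIV" by (rule space_UNIV)
    show "(\<lambda>(s, x, y). k s x y) \<in> borel_measurable (borel \<Otimes>\<^sub>M M \<Otimes>\<^sub>M M)"
    proof -
      have 1: "(\<lambda>w. e (fst (fst w)) (snd w)) \<in> borel_measurable ((borel \<Otimes>\<^sub>M (M \<Otimes>\<^sub>M M)) \<Otimes>\<^sub>M lborel)"
        using measurable_compose[OF _ em, of "\<lambda>w. (fst (fst w), snd w)" "(borel \<Otimes>\<^sub>M (M \<Otimes>\<^sub>M M)) \<Otimes>\<^sub>M lborel"] by simp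
      have 2: "(\<lambda>w. H (snd w) (fst (snd (fst w))) (snd (snd (fst w)))) \<in> borel_measurable ((borel \<Otimes>\<^sub>M (M \<Otimes>\<^sub>M M)) \<Otimes>\<^sub>M lborel)"
        using measurable_compose[OF _ Hm, of "\<lambda>w. (snd w, fst (snd (fst w)), snd (snd (fst w)))" "(borel \<Otimes>\<^sub>M (M \<Otimes>\<^sub>M M)) \<Otimes>\<^sub>M lborel"] by simp
      have "(\<lambda>(z, s). e (fst z) s * H s (fst (snd z)) (snd (snd z))) \<in> borel_measurable ((borel \<Otimes>\<^sub>M (M \<Otimes>\<^sub>M M)) \<Otimes>\<^sub>M lborel)"
        using borel_measurable_times[OF 1 2] by (simp add: split_beta')
      from lborel.borel_measurable_lebesgue_integral[OF this] show ?thesis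
        by (simp add: k_def split_beta')
    qed
    show "0 \<le> k s x y" for s x y
      unfolding k_def by (intro Bochner_Integration.integral_nonneg) (simp add: e0 H0)
    show "(\<integral>\<^sup>+ y. ennreal (k s x y) \<partial>M) \<le> 1" for s x
    proof -
      have "(\<lambda>z. H (fst z) x (snd z)) \<in> borel_measurable (borel \<Otimes>\<^sub>M M)"
        using measurable_compose[OF _ Hm, of "\<lambda>w. (fst w, x, snd w)" "borel \<Otimes>\<^sub>M M"] by (simp add: space_UNIV)
      then show ?thesis unfolding k_nn by (intro mass H0 Hright) (simp_all add: split_beta')
    qed
    show "(\<integral>\<^sup>+ x. ennreal (k s x y) \<partial>M) \<le> 1" for s y
    proof -
      have "(\<lambda>z. H (fst z) (snd z) y) \<in> borel_measurable (borel \<Otimes>\<^sub>M M)"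
        using measurable_compose[OF _ Hm, of "\<lambda>w. (fst w, snd w, y)" "borel \<Otimes>\<^sub>M M"] by (simp add: space_UNIV)
      then show ?thesis unfolding k_nn by (intro mass[of "\<lambda>s x. H s x y"] H0 Hleft) (simp_all add: split_beta')
    qed
    show "k s x y \<le> C * s powr (- (g / \<alpha>))" for s x y
    proof -
      have "ennreal (k s x y) \<le> ennreal (C * s powr (- (g / \<alpha>)))" unfolding k_nn by (rule bound)
      then show ?thesis using c_pos Q(1) by (simp add: C_def)
    qed
    show "0 < C" using c_pos Q(1) by (simp add: C_def)
    show "0 \<le> g / \<alpha>" using g_nonneg \<alpha> by simp
  qed
  moreover have "set_integrable lborel {0<..} (\<lambda>\<sigma>. \<eta> t \<sigma> * h \<sigma> x y)" "frac_heat_kernel \<eta> h t x y = k t x y"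
    if t: "0 < t" and xy: "(x, y) \<notin> N" for t x y
  proof -
    have eq: "(\<lambda>s. indicator {0<..} s *\<^sub>R (\<eta> t s * h s x y)) = (\<lambda>s. e t s * H s x y)"
    proof
      fix s
      show "indicator {0<..} s *\<^sub>R (\<eta> t s * h s x y) = e t s * H s x y"
        using t xy e_eq[OF t, of s] by (cases "0 < s") (simp_all add: H_def)
    qed
    show "set_integrable lborel {0<..} (\<lambda>\<sigma>. \<eta> t \<sigma> * h \<sigma> x y)"
      unfolding set_integrable_def eq by (rule int)
    show "frac_heat_kernel \<eta> h t x y = k t x y"
      unfolding frac_heat_kernel_def set_lebesgue_integral_def eq k_def ..
  qed
  ultimately show ?thesis using that[OF N] by blast
qed

end

section \<open>Quantitative bounds for the Duhamel integral\<close>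

lemma nn_integral_reflect:
  fixes F :: "real \<Rightarrow> real"
  assumes "F \<in> borel_measurable borel"
  shows "(\<integral>\<^sup>+ s. ennreal (F (t - s)) \<partial>lborel) = (\<integral>\<^sup>+ s. ennreal (F s) \<partial>lborel)"
  using assms by (subst (2) nn_integral_real_affine[of _ "-1" t]) auto

context smoothing_kernel
begin

text \<open>One of s and t - s is at least t / 2. Bounding the corresponding power by its value at t / 2 splits the
  Beta integral into two integrals of powers.\<close>
lemma duhamel_int_past_weighted:
  assumes f: "f \<in> C_Lp T M m" and m: "1 \<le> m" "m \<le> n" and t: "0 < t" "t < T"
    and aw: "\<gamma> * (1 / m - 1 / n) = a" "a < 1" "0 \<le> w" "w < 1" and X: "0 < X"
    and bd: "\<And>\<tau>. 0 < \<tau> \<Longrightarrow> \<tau> < T \<Longrightarrow> energy M m (f \<tau>) \<le> ennreal ((X * \<tau> powr (- w)) powr m)"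
  shows "energy M n (duhamel_int (past f t))
    \<le> ennreal ((gain m n * (2 powr w / (1 - a) + 2 powr a / (1 - w)) * X * t powr (1 - a - w)) powr n)"
proof -
  have a0: "0 \<le> a" unfolding aw(1)[symmetric]
    using m \<gamma>_nonneg by (intro mult_nonneg_nonneg) (auto intro!: divide_left_mono)
  let ?K = "gain m n * X"
  have K: "0 < ?K" using gain_pos[of m n] X by simp
  let ?A = "\<lambda>s. if 0 < s \<and> s < t then s powr (- a) else 0"
  let ?B = "\<lambda>s. if 0 < s \<and> s < t then (t - s) powr (- w) else 0"
  define N where "N = (\<lambda>s. ?K * (t / 2) powr (- w) * ?A s + ?K * (t / 2) powr (- a) * ?B s)"
  have N: "N \<in> borel_measurable borel" unfolding N_def by measurable
  have Npos: "0 < N s" if "0 < s" "s < t" for s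
    unfolding N_def using that gain_pos[of m n] X t by (intro add_pos_pos mult_pos_pos) auto
  have E: "energy M n (kernel_op s (f (t - s))) \<le> ennreal (N s powr n)" if s: "0 < s" "s < t" for s
  proof -
    have "energy M n (kernel_op s (f (t - s))) \<le> ennreal ((gain m n * s powr (- a) * (X * (t - s) powr (- w))) powr n)"
      unfolding aw(1)[symmetric]
      by (rule C_Lp_op_bound[OF f m _ s(1) bd]) (use s t X in auto)
    also have "\<dots> \<le> ennreal (N s powr n)"
    proof (intro ennreal_leI powr_mono2)
      have "s powr (- a) * (t - s) powr (- w) \<le> (t / 2) powr (- w) * s powr (- a) + (t / 2) powr (- a) * (t - s) powr (- w)"
      proof (cases "s \<le> t / 2")
        case True
        then have "(t - s) powr (- w) \<le> (t / 2) powr (- w)" using aw t by (intro powr_mono2') auto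
        then have "s powr (- a) * (t - s) powr (- w) \<le> s powr (- a) * (t / 2) powr (- w)" by (intro mult_left_mono) auto
        also have "\<dots> = (t / 2) powr (- w) * s powr (- a)" by simp
        finally show ?thesis by (intro add_increasing2) auto
      next
        case False
        then have "s powr (- a) \<le> (t / 2) powr (- a)" using a0 t by (intro powr_mono2') auto
        then have "s powr (- a) * (t - s) powr (- w) \<le> (t / 2) powr (- a) * (t - s) powr (- w)"
          by (intro mult_right_mono) auto
        then show ?thesis by (intro add_increasing) auto
      qed
      then have "?K * (s powr (- a) * (t - s) powr (- w)) \<le> ?K * ((t / 2) powr (- w) * s powr (- a) + (t / 2) powr (- a) * (t - s) powr (- w))"
        using K by (intro mult_left_mono) auto
      then show "gain m n * s powr (- a) * (X * (t - s) powr (- w)) \<le> N s"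
        using s by (simp add: N_def algebra_simps)
    qed (use m X gain_pos[of m n] in \<open>auto intro!: mult_nonneg_nonneg\<close>)
    finally show ?thesis .
  qed
  let ?I = "gain m n * (2 powr w / (1 - a) + 2 powr a / (1 - w)) * X * t powr (1 - a - w)"
  have I0: "0 < ?I" using gain_pos[of m n] X t aw by (intro mult_pos_pos add_pos_pos divide_pos_pos) auto
  have "(\<integral>\<^sup>+ s. ennreal (if 0 < s \<and> s < t then N s else 0) \<partial>lborel)
      = (\<integral>\<^sup>+ s. ennreal (?K * (t / 2) powr (- w)) * ennreal (?A s) + ennreal (?K * (t / 2) powr (- a)) * ennreal (?B s) \<partial>lborel)"
  proof (rule nn_integral_cong)
    fix s
    have "ennreal (if 0 < s \<and> s < t then N s else 0) = ennreal (?K * (t / 2) powr (- w) * ?A s + ?K * (t / 2) powr (- a) * ?B s)"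
      by (simp add: N_def)
    also have "\<dots> = ennreal (?K * (t / 2) powr (- w)) * ennreal (?A s) + ennreal (?K * (t / 2) powr (- a)) * ennreal (?B s)"
      using K by (intro ennreal_lincomb[symmetric]) auto
    finally show "ennreal (if 0 < s \<and> s < t then N s else 0)
      = ennreal (?K * (t / 2) powr (- w)) * ennreal (?A s) + ennreal (?K * (t / 2) powr (- a)) * ennreal (?B s)" .
  qed
  also have "\<dots> = ennreal (?K * (t / 2) powr (- w)) * ennreal (t powr (1 - a) / (1 - a))
      + ennreal (?K * (t / 2) powr (- a)) * ennreal (t powr (1 - w) / (1 - w))"
    using t aw
    by (subst nn_integral_add) (auto simp: nn_integral_cmult nn_integral_powr_from_0 nn_integral_powr_reflected)
  also have "\<dots> = ennreal (?K * (t / 2) powr (- w) * (t powr (1 - a) / (1 - a)) + ?K * (t / 2) powr (- a) * (t powr (1 - w) / (1 - w)))"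
    using K aw by (intro ennreal_lincomb) auto
  also have "?K * (t / 2) powr (- w) * (t powr (1 - a) / (1 - a)) + ?K * (t / 2) powr (- a) * (t powr (1 - w) / (1 - w)) = ?I"
  proof -
    have 1: "(t / 2) powr (- w) * t powr (1 - a) = 2 powr w * t powr (1 - a - w)"
      using t by (simp add: powr_divide powr_minus powr_diff powr_add field_simps)
    have 2: "(t / 2) powr (- a) * t powr (1 - w) = 2 powr a * t powr (1 - a - w)"
      using t by (simp add: powr_divide powr_minus powr_diff powr_add field_simps)
    have "?K * (t / 2) powr (- w) * (t powr (1 - a) / (1 - a)) + ?K * (t / 2) powr (- a) * (t powr (1 - w) / (1 - w))
      = ?K * (((t / 2) powr (- w) * t powr (1 - a)) / (1 - a) + ((t / 2) powr (- a) * t powr (1 - w)) / (1 - w))"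
      by (simp add: algebra_simps)
    also have "\<dots> = ?I" unfolding 1 2 by (simp add: algebra_simps)
    finally show ?thesis .
  qed
  finally have I: "(\<integral>\<^sup>+ s. ennreal (if 0 < s \<and> s < t then N s else 0) \<partial>lborel) \<le> ennreal ?I" by simp
  have n: "1 \<le> n" using m by simp
  show ?thesis by (rule duhamel_int_past_bound(3)[OF f m(1) n t(2) N Npos E I I0])
qed

text \<open>The bounds with m1 and m2 behave like X \<tau>^(-1) times (\<tau> / \<delta>)^d and (\<tau> / \<delta>)^(-d), up to powers of t, where
  \<tau> = t - s and \<delta> = t L^(1/d). Using the first for \<tau> < \<delta> and the second for \<tau> \<ge> \<delta>, the integral over the
  half \<tau> \<le> t / 2 has a bound that does not depend on L. On the other half \<tau> is of size t, and the bound
  that is better for the given L is used.\<close>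
lemma duhamel_int_past_critical:
  assumes f: "f \<in> C_Lp T M m1" "f \<in> C_Lp T M m2" and m: "1 \<le> m1" "m1 \<le> n" "1 \<le> m2" "m2 \<le> n"
    and t: "0 < t" "t < T"
    and e: "\<gamma> * (1 / m1 - 1 / n) = \<kappa> + d" "\<gamma> * (1 / m2 - 1 / n) = \<kappa> - d"
    and d: "0 < d" "d \<le> \<kappa>" "\<kappa> + d < 1" and X: "0 < X" and L: "0 < L"
    and bd1: "\<And>\<tau>. 0 < \<tau> \<Longrightarrow> \<tau> < T \<Longrightarrow> energy M m1 (f \<tau>) \<le> ennreal ((X / L * \<tau> powr (d - 1)) powr m1)"
    and bd2: "\<And>\<tau>. 0 < \<tau> \<Longrightarrow> \<tau> < T \<Longrightarrow> energy M m2 (f \<tau>) \<le> ennreal ((X * L * \<tau> powr (- 1 - d)) powr m2)"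
  shows "energy M n (duhamel_int (past f t))
    \<le> ennreal ((4 * (gain m1 n + gain m2 n) * (2 / d + 1 / (1 - \<kappa> - d)) * X * t powr (- \<kappa>)) powr n)"
proof -
  define G where "G = 4 * (gain m1 n + gain m2 n) * X"
  have G: "0 < G" using gain_pos[of m1 n] gain_pos[of m2 n] X by (simp add: G_def)
  \<comment> \<open>the time at which the two bounds agree, for s of the size of t\<close>
  define \<delta> where "\<delta> = t * L powr (1 / d)"
  have \<delta>: "0 < \<delta>" using t L by (simp add: \<delta>_def)
  have \<delta>d: "\<delta> powr d = t powr d * L" using t L d by (simp add: \<delta>_def powr_mult powr_powr)
  define P1 where "P1 = (\<lambda>\<tau>. if 0 < \<tau> \<and> \<tau> < \<delta> then \<tau> powr (- (1 - d)) else 0)"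
  define P2 where "P2 = (\<lambda>\<tau>. if \<delta> \<le> \<tau> then \<tau> powr (- 1 - d) else 0)"
  define \<epsilon> where "\<epsilon> = (if 1 \<le> L then \<kappa> + d else \<kappa> - d)"
  define P3 where "P3 = (\<lambda>s. if 0 < s \<and> s < t then s powr (- \<epsilon>) else 0)"
  have P[measurable]: "P1 \<in> borel_measurable borel" "P2 \<in> borel_measurable borel" "P3 \<in> borel_measurable borel"
    unfolding P1_def P2_def P3_def by measurable
  have P0: "0 \<le> P1 \<tau>" "0 \<le> P2 \<tau>" "0 \<le> P3 \<tau>" for \<tau> by (auto simp: P1_def P2_def P3_def)
  \<comment> \<open>The three summands of N dominate the integrand for \<tau> < \<delta> and for \<tau> \<ge> \<delta> in the half \<tau> \<le> t / 2, and in the other half.\<close>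
  define c1 where "c1 = G * t powr (- (\<kappa> + d)) / L"
  define c2 where "c2 = G * t powr (- (\<kappa> - d)) * L"
  define c3 where "c3 = G * t powr (\<epsilon> - \<kappa> - 1)"
  have c: "0 < c1" "0 < c2" "0 < c3" using G L t by (auto simp: c1_def c2_def c3_def)
  define N where "N = (\<lambda>s. c1 * P1 (t - s) + c2 * P2 (t - s) + c3 * P3 s)"
  have N: "N \<in> borel_measurable borel" unfolding N_def by measurable
  have Npos: "0 < N s" if "0 < s" "s < t" for s
    unfolding N_def using that c P0
    by (intro add_nonneg_pos add_nonneg_nonneg mult_nonneg_nonneg mult_pos_pos) (auto simp: P3_def less_imp_le)
  have n: "1 \<le> n" using m by simp
  have pw: "2 powr x \<le> 4" if "x \<le> 2" for x :: real
    using powr_mono[of x 2 2] that by simp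
  have half: "(t / 2) powr (- x) = 2 powr x * t powr (- x)" for x
    using t by (simp add: powr_divide powr_minus field_simps)
  have E: "energy M n (kernel_op s (f (t - s))) \<le> ennreal (N s powr n)" if s: "0 < s" "s < t" for s
  proof -
    define \<tau> where "\<tau> = t - s"
    have \<tau>: "0 < \<tau>" "\<tau> < T" using s t by (auto simp: \<tau>_def)
    have b1: "energy M n (kernel_op s (f \<tau>)) \<le> ennreal ((gain m1 n * s powr (- (\<kappa> + d)) * (X / L * \<tau> powr (d - 1))) powr n)"
      unfolding e(1)[symmetric] by (rule C_Lp_op_bound[OF f(1) m(1,2) _ s(1) bd1]) (use \<tau> X L in auto)
    have b2: "energy M n (kernel_op s (f \<tau>)) \<le> ennreal ((gain m2 n * s powr (- (\<kappa> - d)) * (X * L * \<tau> powr (- 1 - d))) powr n)"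
      unfolding e(2)[symmetric] by (rule C_Lp_op_bound[OF f(2) m(3,4) _ s(1) bd2]) (use \<tau> X L in auto)
    have use1: ?thesis if "gain m1 n * s powr (- (\<kappa> + d)) * (X / L * \<tau> powr (d - 1)) \<le> N s"
    proof -
      have "ennreal ((gain m1 n * s powr (- (\<kappa> + d)) * (X / L * \<tau> powr (d - 1))) powr n) \<le> ennreal (N s powr n)"
        using that n gain_pos[of m1 n] X L by (intro ennreal_leI powr_mono2 mult_nonneg_nonneg) (auto simp: less_imp_le)
      with b1 show ?thesis unfolding \<tau>_def by (rule order_trans)
    qed
    have use2: ?thesis if "gain m2 n * s powr (- (\<kappa> - d)) * (X * L * \<tau> powr (- 1 - d)) \<le> N s"
    proof -
      have "ennreal ((gain m2 n * s powr (- (\<kappa> - d)) * (X * L * \<tau> powr (- 1 - d))) powr n) \<le> ennreal (N s powr n)"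
        using that n gain_pos[of m2 n] X L by (intro ennreal_leI powr_mono2 mult_nonneg_nonneg) (auto simp: less_imp_le)
      with b2 show ?thesis unfolding \<tau>_def by (rule order_trans)
    qed
    have gG: "gain m1 n * y * X \<le> G" "gain m2 n * y * X \<le> G" if "0 \<le> y" "y \<le> 4" for y
    proof -
      have "gain m1 n * y * X \<le> gain m1 n * 4 * X" "gain m2 n * y * X \<le> gain m2 n * 4 * X"
        using that gain_pos[of m1 n] gain_pos[of m2 n] X by (auto intro!: mult_right_mono mult_left_mono)
      moreover have "gain m1 n * 4 * X \<le> G" "gain m2 n * 4 * X \<le> G"
        using gain_pos[of m1 n] gain_pos[of m2 n] X by (auto simp: G_def algebra_simps)
      ultimately show "gain m1 n * y * X \<le> G" "gain m2 n * y * X \<le> G" by linarith+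
    qed
    have N1: "c1 * P1 \<tau> \<le> N s" "c2 * P2 \<tau> \<le> N s" "c3 * P3 s \<le> N s"
      using c P0 by (auto simp: N_def \<tau>_def add_nonneg_nonneg)
    show ?thesis
    proof (cases "\<tau> \<le> t / 2")
      case True
      then have st: "t / 2 \<le> s" by (simp add: \<tau>_def)
      show ?thesis
      proof (cases "\<tau> < \<delta>")
        case near: True
        have "s powr (- (\<kappa> + d)) \<le> (t / 2) powr (- (\<kappa> + d))"
          using st d t by (intro powr_mono2') auto
        then have "gain m1 n * s powr (- (\<kappa> + d)) * (X / L * \<tau> powr (d - 1))
            \<le> gain m1 n * (t / 2) powr (- (\<kappa> + d)) * (X / L * \<tau> powr (d - 1))"
          using gain_pos[of m1 n] X L by (intro mult_right_mono mult_left_mono) auto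
        also have "\<dots> = gain m1 n * 2 powr (\<kappa> + d) * X * (t powr (- (\<kappa> + d)) / L * \<tau> powr (d - 1))"
          unfolding half by simp
        also have "\<dots> \<le> G * (t powr (- (\<kappa> + d)) / L * \<tau> powr (d - 1))"
          using d L pw[of "\<kappa> + d"] by (intro mult_right_mono gG) auto
        also have "\<dots> = c1 * P1 \<tau>" using near \<tau> by (simp add: c1_def P1_def)
        finally show ?thesis using N1 by (intro use1) simp
      next
        case far: False
        have "s powr (- (\<kappa> - d)) \<le> (t / 2) powr (- (\<kappa> - d))"
          using st d t by (intro powr_mono2') auto
        then have "gain m2 n * s powr (- (\<kappa> - d)) * (X * L * \<tau> powr (- 1 - d))
            \<le> gain m2 n * (t / 2) powr (- (\<kappa> - d)) * (X * L * \<tau> powr (- 1 - d))"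
          using gain_pos[of m2 n] X L by (intro mult_right_mono mult_left_mono) auto
        also have "\<dots> = gain m2 n * 2 powr (\<kappa> - d) * X * (t powr (- (\<kappa> - d)) * L * \<tau> powr (- 1 - d))"
          unfolding half by simp
        also have "\<dots> \<le> G * (t powr (- (\<kappa> - d)) * L * \<tau> powr (- 1 - d))"
          using d L pw[of "\<kappa> - d"] by (intro mult_right_mono gG) auto
        also have "\<dots> = c2 * P2 \<tau>" using far \<tau> by (simp add: c2_def P2_def)
        finally show ?thesis using N1 by (intro use2) simp
      qed
    next
      case False
      then have tt: "t / 2 \<le> \<tau>" by simp
      show ?thesis
      proof (cases "1 \<le> L")
        case True
        have "\<tau> powr (d - 1) \<le> (t / 2) powr (- (1 - d))"
          using tt d t powr_mono2'[of "- (1 - d)" "t / 2" \<tau>] by simp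
        moreover have "X / L \<le> X / 1" using True X by (intro divide_left_mono) auto
        ultimately have "X / L * \<tau> powr (d - 1) \<le> X * (t / 2) powr (- (1 - d))"
          using X by (intro mult_mono) auto
        then have "gain m1 n * s powr (- (\<kappa> + d)) * (X / L * \<tau> powr (d - 1))
            \<le> gain m1 n * s powr (- (\<kappa> + d)) * (X * (t / 2) powr (- (1 - d)))"
          using gain_pos[of m1 n] by (intro mult_left_mono) auto
        also have "\<dots> = gain m1 n * 2 powr (1 - d) * X * (t powr (- (1 - d)) * s powr (- (\<kappa> + d)))"
          unfolding half by simp
        also have "\<dots> \<le> G * (t powr (- (1 - d)) * s powr (- (\<kappa> + d)))"
          using d pw[of "1 - d"] by (intro mult_right_mono gG) auto
        also have "\<dots> = c3 * P3 s" using True s by (simp add: c3_def P3_def \<epsilon>_def)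
        finally show ?thesis using N1 by (intro use1) simp
      next
        case False
        have "\<tau> powr (- 1 - d) \<le> (t / 2) powr (- (1 + d))"
          using tt d t powr_mono2'[of "- (1 + d)" "t / 2" \<tau>] by simp
        moreover have "X * L \<le> X * 1" using False X by (intro mult_left_mono) auto
        ultimately have "X * L * \<tau> powr (- 1 - d) \<le> X * (t / 2) powr (- (1 + d))"
          using X by (intro mult_mono) auto
        then have "gain m2 n * s powr (- (\<kappa> - d)) * (X * L * \<tau> powr (- 1 - d))
            \<le> gain m2 n * s powr (- (\<kappa> - d)) * (X * (t / 2) powr (- (1 + d)))"
          using gain_pos[of m2 n] by (intro mult_left_mono) auto
        also have "\<dots> = gain m2 n * 2 powr (1 + d) * X * (t powr (- (1 + d)) * s powr (- (\<kappa> - d)))"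
          unfolding half by simp
        also have "\<dots> \<le> G * (t powr (- (1 + d)) * s powr (- (\<kappa> - d)))"
          using d pw[of "1 + d"] by (intro mult_right_mono gG) auto
        also have "\<dots> = c3 * P3 s"
        proof -
          have "\<epsilon> = \<kappa> - d" "\<epsilon> - \<kappa> - 1 = - (1 + d)" using False by (auto simp: \<epsilon>_def)
          then show ?thesis using s by (simp only: c3_def P3_def) simp
        qed
        finally show ?thesis using N1 by (intro use2) simp
      qed
    qed
  qed
  have \<epsilon>: "\<epsilon> < 1" "1 - \<kappa> - d \<le> 1 - \<epsilon>" using d by (auto simp: \<epsilon>_def)
  let ?I = "4 * (gain m1 n + gain m2 n) * (2 / d + 1 / (1 - \<kappa> - d)) * X * t powr (- \<kappa>)"
  have I0: "0 < ?I"
    using gain_pos[of m1 n] gain_pos[of m2 n] X t d by (intro mult_pos_pos add_pos_pos divide_pos_pos) auto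
  have i1: "(\<integral>\<^sup>+ s. ennreal (P1 (t - s)) \<partial>lborel) = ennreal (\<delta> powr d / d)"
    using nn_integral_reflect[OF P(1), of t] nn_integral_powr_from_0[of "1 - d" \<delta>] \<delta> d by (simp add: P1_def)
  have i2: "(\<integral>\<^sup>+ s. ennreal (P2 (t - s)) \<partial>lborel) = ennreal (\<delta> powr (- d) / d)"
    using nn_integral_reflect[OF P(2), of t] nn_integral_powr_to_inf[of d \<delta>] \<delta> d by (simp add: P2_def)
  have i3: "(\<integral>\<^sup>+ s. ennreal (P3 s) \<partial>lborel) = ennreal (t powr (1 - \<epsilon>) / (1 - \<epsilon>))"
    unfolding P3_def by (rule nn_integral_powr_from_0) (use \<epsilon> t in auto)
  have "(\<integral>\<^sup>+ s. ennreal (if 0 < s \<and> s < t then N s else 0) \<partial>lborel)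
      \<le> (\<integral>\<^sup>+ s. (ennreal c1 * ennreal (P1 (t - s)) + ennreal c2 * ennreal (P2 (t - s))) + ennreal c3 * ennreal (P3 s) \<partial>lborel)"
  proof (rule nn_integral_mono)
    fix s
    have "ennreal (if 0 < s \<and> s < t then N s else 0) \<le> ennreal (N s)"
      using c P0 by (auto simp: N_def intro!: ennreal_leI)
    also have "\<dots> = ennreal (c1 * P1 (t - s) + c2 * P2 (t - s)) + ennreal (c3 * P3 s)"
      unfolding N_def using c P0 by (intro ennreal_plus) auto
    also have "\<dots> = (ennreal c1 * ennreal (P1 (t - s)) + ennreal c2 * ennreal (P2 (t - s))) + ennreal c3 * ennreal (P3 s)"
      using c P0 by (subst ennreal_lincomb) (auto simp: ennreal_mult)
    finally show "ennreal (if 0 < s \<and> s < t then N s else 0)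
      \<le> (ennreal c1 * ennreal (P1 (t - s)) + ennreal c2 * ennreal (P2 (t - s))) + ennreal c3 * ennreal (P3 s)" .
  qed
  also have "\<dots> = (ennreal c1 * ennreal (\<delta> powr d / d) + ennreal c2 * ennreal (\<delta> powr (- d) / d))
      + ennreal c3 * ennreal (t powr (1 - \<epsilon>) / (1 - \<epsilon>))"
    by (simp add: nn_integral_add nn_integral_cmult i1 i2 i3)
  also have "\<dots> = ennreal (c1 * (\<delta> powr d / d) + c2 * (\<delta> powr (- d) / d)) + ennreal (c3 * (t powr (1 - \<epsilon>) / (1 - \<epsilon>)))"
    using c d \<epsilon> by (intro arg_cong2[where f = "(+)"] ennreal_lincomb ennreal_mult[symmetric]) auto
  also have "\<dots> = ennreal (c1 * (\<delta> powr d / d) + c2 * (\<delta> powr (- d) / d) + c3 * (t powr (1 - \<epsilon>) / (1 - \<epsilon>)))"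
    using c d \<epsilon> by (intro ennreal_plus[symmetric]) auto
  also have "c1 * (\<delta> powr d / d) = G * t powr (- \<kappa>) / d"
    using L t by (simp add: c1_def \<delta>d powr_add[symmetric])
  also have "c2 * (\<delta> powr (- d) / d) = G * t powr (- \<kappa>) / d"
  proof -
    have "t powr (- (\<kappa> - d)) * \<delta> powr (- d) * L = t powr (- \<kappa>)"
      using L t by (simp add: powr_minus \<delta>d powr_diff field_simps)
    then show ?thesis by (simp add: c2_def) (metis mult.assoc mult.commute)
  qed
  also have "c3 * (t powr (1 - \<epsilon>) / (1 - \<epsilon>)) = G * t powr (- \<kappa>) / (1 - \<epsilon>)"
    using t by (simp add: c3_def powr_add[symmetric])
  also have "ennreal (G * t powr (- \<kappa>) / d + G * t powr (- \<kappa>) / d + G * t powr (- \<kappa>) / (1 - \<epsilon>)) \<le> ennreal ?I"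
  proof (rule ennreal_leI)
    have "G * t powr (- \<kappa>) / (1 - \<epsilon>) \<le> G * t powr (- \<kappa>) / (1 - \<kappa> - d)"
      using G \<epsilon> d by (intro divide_left_mono) auto
    moreover have "?I = (2 / d + 1 / (1 - \<kappa> - d)) * (G * t powr (- \<kappa>))" by (simp add: G_def)
    then have "?I = G * t powr (- \<kappa>) / d + G * t powr (- \<kappa>) / d + G * t powr (- \<kappa>) / (1 - \<kappa> - d)"
      by (simp add: distrib_right)
    ultimately show "G * t powr (- \<kappa>) / d + G * t powr (- \<kappa>) / d + G * t powr (- \<kappa>) / (1 - \<epsilon>) \<le> ?I"
      by linarith
  qed
  finally have I: "(\<integral>\<^sup>+ s. ennreal (if 0 < s \<and> s < t then N s else 0) \<partial>lborel) \<le> ennreal ?I" .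
  show ?thesis by (rule duhamel_int_past_bound(3)[OF f(1) m(1) n t(2) N Npos E I I0])
qed

end

text \<open>The energies are raised to the powers p \<theta> / S and r (1 - \<theta>) / S with S = \<theta> p + (1 - \<theta>) r; the identities for m
  in the proof turn these into \<theta> (b + 1) m / r and (1 - \<theta>) (b + 1) m / p. For \<theta> = 0 the exponent m
  is p / (b + 1), and there is nothing to interpolate.\<close>
lemma C_Lp_interpolation:
  fixes b p r :: real
  assumes f: "f \<in> C_Lp T M (p / (b + 1))" and b: "0 < b" and rp: "0 < r" "r < p"
    and \<theta>: "0 \<le> \<theta>" "\<theta> < 1" and A: "0 < A" and B: "0 < B"
    and bdA: "\<theta> = 0 \<or> (\<forall>\<tau>\<in>{0..<T}. energy M (r / (b + 1)) (f \<tau>) \<le> ennreal (A powr r))"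
    and bdB: "\<And>\<tau>. 0 < \<tau> \<Longrightarrow> \<tau> < T \<Longrightarrow> energy M (p / (b + 1)) (f \<tau>) \<le> ennreal ((B * \<tau> powr (- \<kappa>)) powr p)"
    and m: "0 < m" "1 / m = (b + 1) * (\<theta> / r + (1 - \<theta>) / p)"
  shows "f \<in> C_Lp T M m"
    and "\<And>\<tau>. 0 < \<tau> \<Longrightarrow> \<tau> < T \<Longrightarrow> energy M m (f \<tau>)
      \<le> ennreal ((A powr (\<theta> * (b + 1)) * B powr ((1 - \<theta>) * (b + 1)) * \<tau> powr (- (\<kappa> * ((1 - \<theta>) * (b + 1))))) powr m)"
proof -
  define S where "S = \<theta> * p + (1 - \<theta>) * r"
  have S: "r \<le> S" "S < p" "\<theta> \<noteq> 0 \<Longrightarrow> r < S" "0 < S"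
  proof -
    have s1: "S = r + \<theta> * (p - r)" and s2: "S = p - (1 - \<theta>) * (p - r)"
      by (simp_all add: S_def algebra_simps)
    show "r \<le> S" unfolding s1 using \<theta> rp by simp
    then show "0 < S" using rp by simp
    show "S < p" unfolding s2 using \<theta> rp by simp
    show "r < S" if "\<theta> \<noteq> 0" unfolding s1 using that \<theta> rp by simp
  qed
  have "1 / m = (b + 1) * S / (r * p)" using m(2) rp by (simp add: S_def field_simps)
  then have "1 / (1 / m) = r * p / ((b + 1) * S)" by simp
  then have m_eq: "m = r * p / ((b + 1) * S)" using m(1) by simp
  have mS: "m = r / (b + 1) * (p / S)" "m = p / (b + 1) * (r / S)"
    by (simp_all add: m_eq mult.commute)
  have order: "r / (b + 1) < m" "m \<le> p / (b + 1)"
  proof -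
    have "r / (b + 1) * 1 < r / (b + 1) * (p / S)"
      using S rp b by (intro mult_strict_left_mono) auto
    moreover have "p / (b + 1) * (r / S) \<le> p / (b + 1) * 1"
      using S rp b by (intro mult_left_mono) auto
    ultimately show "r / (b + 1) < m" "m \<le> p / (b + 1)" unfolding mS[symmetric] by simp_all
  qed
  have pw: "(B * \<tau> powr (- \<kappa>)) powr x = B powr x * \<tau> powr (- (\<kappa> * x))" if "0 < \<tau>" for \<tau> x
    using B that by (simp add: powr_mult powr_powr)
  show "f \<in> C_Lp T M m"
  proof (cases "\<theta> = 0")
    case True
    then have "m = p / (b + 1)" using m_eq rp by (simp add: S_def)
    then show ?thesis using f by simp
  next
    case False
    then show ?thesis
      using order bdA False rp b by (intro C_Lp_intermediate[OF f, of "r / (b + 1)" m "A powr r"]) auto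
  qed
  fix \<tau> assume \<tau>: "0 < \<tau>" "\<tau> < T"
  show "energy M m (f \<tau>)
      \<le> ennreal ((A powr (\<theta> * (b + 1)) * B powr ((1 - \<theta>) * (b + 1)) * \<tau> powr (- (\<kappa> * ((1 - \<theta>) * (b + 1))))) powr m)"
  proof (cases "\<theta> = 0")
    case True
    then have "m = p / (b + 1)" using m_eq rp by (simp add: S_def)
    moreover have "(B * \<tau> powr (- \<kappa>)) powr p = ((B * \<tau> powr (- \<kappa>)) powr (b + 1)) powr (p / (b + 1))"
      using b by (simp add: powr_powr)
    ultimately show ?thesis using bdB[OF \<tau>] True A pw[OF \<tau>(1)] by simp
  next
    case False
    let ?m0 = "r / (b + 1)" and ?m1 = "p / (b + 1)"
    have ord: "0 < ?m0" "?m0 < m" "m \<le> ?m1"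
      using order rp b by auto
    have fm: "f \<tau> \<in> borel_measurable (completion M)"
      using Lp_spaceD(1)[OF C_LpD(1)[OF f, of \<tau>]] \<tau> rp b by auto
    have "energy M m (f \<tau>) \<le> ennreal ((A powr r) powr ((?m1 - m) / (?m1 - ?m0)) *
        ((B * \<tau> powr (- \<kappa>)) powr p) powr ((m - ?m0) / (?m1 - ?m0)))"
      by (rule energy_interpolation[OF fm ord]) (use bdA False \<tau> A bdB[OF \<tau>] in auto)
    also have "(A powr r) powr ((?m1 - m) / (?m1 - ?m0)) * ((B * \<tau> powr (- \<kappa>)) powr p) powr ((m - ?m0) / (?m1 - ?m0))
       = (A powr (\<theta> * (b + 1)) * B powr ((1 - \<theta>) * (b + 1)) * \<tau> powr (- (\<kappa> * ((1 - \<theta>) * (b + 1))))) powr m"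
    proof -
      have x1: "(?m1 - m) / (?m1 - ?m0) = p * \<theta> / S"
      proof -
        have "?m1 - m = p / (b + 1) * (1 - r / S)" by (simp only: mS(2) right_diff_distrib mult_1_right)
        also have "1 - r / S = (S - r) / S" using S by (simp add: diff_divide_distrib)
        also have "S - r = \<theta> * (p - r)" by (simp add: S_def algebra_simps)
        finally have "?m1 - m = (p * \<theta> / S) * ((p - r) / (b + 1))" by (simp add: mult_ac)
        moreover have "?m1 - ?m0 = (p - r) / (b + 1)" by (simp add: diff_divide_distrib)
        ultimately show ?thesis using rp b by simp
      qed
      have x2: "(m - ?m0) / (?m1 - ?m0) = r * (1 - \<theta>) / S"
      proof -
        have "m - ?m0 = r / (b + 1) * (p / S - 1)" by (simp only: mS(1) right_diff_distrib mult_1_right)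
        also have "p / S - 1 = (p - S) / S" using S by (simp add: diff_divide_distrib)
        also have "p - S = (1 - \<theta>) * (p - r)" by (simp add: S_def algebra_simps)
        finally have "m - ?m0 = (r * (1 - \<theta>) / S) * ((p - r) / (b + 1))" by (simp add: mult_ac)
        moreover have "?m1 - ?m0 = (p - r) / (b + 1)" by (simp add: diff_divide_distrib)
        ultimately show ?thesis using rp b by simp
      qed
      have y1: "r * (p * \<theta> / S) = \<theta> * (b + 1) * m" and y2: "p * (r * (1 - \<theta>) / S) = (1 - \<theta>) * (b + 1) * m"
      proof -
        have "(b + 1) * m = r * p / S" using b by (simp add: m_eq)
        then show "r * (p * \<theta> / S) = \<theta> * (b + 1) * m" "p * (r * (1 - \<theta>) / S) = (1 - \<theta>) * (b + 1) * m"
          unfolding mult.assoc by (simp_all add: mult_ac)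
      qed
      have "(A powr r) powr ((?m1 - m) / (?m1 - ?m0)) * ((B * \<tau> powr (- \<kappa>)) powr p) powr ((m - ?m0) / (?m1 - ?m0))
        = A powr (\<theta> * (b + 1) * m) * (B * \<tau> powr (- \<kappa>)) powr ((1 - \<theta>) * (b + 1) * m)"
        unfolding x1 x2 powr_powr y1 y2 ..
      also have "\<dots> = (A powr (\<theta> * (b + 1)) * (B * \<tau> powr (- \<kappa>)) powr ((1 - \<theta>) * (b + 1))) powr m"
        by (simp add: powr_mult powr_powr mult.assoc)
      also have "\<dots> = (A powr (\<theta> * (b + 1)) * B powr ((1 - \<theta>) * (b + 1)) * \<tau> powr (- (\<kappa> * ((1 - \<theta>) * (b + 1))))) powr m"
        unfolding pw[OF \<tau>(1)] by (simp add: mult.assoc)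
      finally show ?thesis .
    qed
    finally show ?thesis .
  qed
qed

section \<open>The weighted norms and the Duhamel term\<close>

text \<open>This covers q = \<infinity> as \<kappa> = 0. At t = 0 it fails in that case, because 0 powr 0 is 0; there the Duhamel
  integral vanishes anyway.\<close>
lemma time_weight_powr:
  assumes "1 / q = ennreal \<kappa>" "0 \<le> \<kappa>" "0 < t"
  shows "time_weight q t = t powr \<kappa>"
proof (cases q)
  case (real x)
  have "x \<noteq> 0"
  proof
    assume "x = 0"
    then have "1 / q = top" using real by (simp add: ennreal_divide_zero)
    then show False using assms(1) by simp
  qed
  then have x: "0 < x" using real by simp
  then have "ennreal (1 / x) = ennreal \<kappa>"
    using assms(1) real divide_ennreal[of 1 x] by simp
  then have "1 / x = \<kappa>" using x assms(2) by (simp add: ennreal_inj)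
  then show ?thesis using real by (simp add: time_weight_def)
next
  case top
  then have "\<kappa> = 0" using assms by simp
  then show ?thesis using top assms by (simp add: time_weight_def)
qed

lemma one_div_divide_ennreal:
  assumes "1 / q = ennreal \<kappa>" "0 \<le> \<kappa>" "0 < c"
  shows "1 / (q / ennreal c) = ennreal (c * \<kappa>)"
proof (cases q)
  case (real x)
  have "x \<noteq> 0"
  proof
    assume "x = 0"
    then have "1 / q = top" using real by (simp add: ennreal_divide_zero)
    then show False using assms(1) by simp
  qed
  then have x: "0 < x" using real by simp
  then have "ennreal (1 / x) = ennreal \<kappa>"
    using assms(1) real divide_ennreal[of 1 x] by simp
  then have k: "1 / x = \<kappa>" using x assms(2) by (simp add: ennreal_inj)
  have "1 / (q / ennreal c) = 1 / ennreal (x / c)" using real x assms(3) by (simp add: divide_ennreal)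
  also have "\<dots> = ennreal (1 / (x / c))" using x assms(3) divide_ennreal[of 1 "x / c"] by simp
  also have "1 / (x / c) = c * \<kappa>" unfolding k[symmetric] by simp
  finally show ?thesis .
next
  case top
  then have "\<kappa> = 0" using assms by simp
  then show ?thesis using top assms by (simp add: ennreal_top_divide)
qed

lemma C_norm_energy_bound:
  assumes "C_norm T \<sigma> M p F = ennreal B" "0 \<le> B" "0 < p" "0 < t" "t < T" "time_weight \<sigma> t = t powr w"
  shows "energy M p (F t) \<le> ennreal ((B * t powr (- w)) powr p)"
proof -
  have F: "F \<in> C_Lp T M p" using assms(1) by (auto simp: C_norm_def split: if_splits)
  have "ennreal (time_weight \<sigma> t) * Lp_enorm M p (F t) \<le> C_norm T \<sigma> M p F"
    unfolding C_norm_def if_P[OF F] by (rule SUP_upper) (use assms(4,5) in auto)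
  then have *: "ennreal (t powr w) * Lp_enorm M p (F t) \<le> ennreal B"
    using assms by simp
  have "Lp_enorm M p (F t) = ennreal (t powr (- w)) * (ennreal (t powr w) * Lp_enorm M p (F t))"
    using assms(4) by (simp add: mult.assoc[symmetric] ennreal_mult[symmetric] powr_add[symmetric])
  also have "\<dots> \<le> ennreal (t powr (- w)) * ennreal B" by (intro mult_left_mono *) auto
  also have "\<dots> = ennreal (B * t powr (- w))" using assms by (simp add: ennreal_mult[symmetric] mult.commute)
  finally show ?thesis using assms by (subst (asm) Lp_enorm_le_iff) auto
qed

lemma C_norm_le:
  assumes F: "F \<in> C_Lp T M p" and p: "0 < p" and Y: "0 \<le> Y"
    and w: "\<And>t. 0 < t \<Longrightarrow> time_weight \<sigma> t = t powr w"
    and bd: "\<And>t. 0 < t \<Longrightarrow> t < T \<Longrightarrow> energy M p (F t) \<le> ennreal ((Y * t powr (- w)) powr p)"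
    and 0: "energy M p (F 0) = 0"
  shows "C_norm T \<sigma> M p F \<le> ennreal Y"
proof -
  have "ennreal (time_weight \<sigma> t) * Lp_enorm M p (F t) \<le> ennreal Y" if "t \<in> {0..<T}" for t
  proof (cases "t = 0")
    case True
    have "Lp_enorm M p (F 0) \<le> ennreal 0" using 0 p by (subst Lp_enorm_le_iff) auto
    then show ?thesis using True by simp
  next
    case False
    then have t: "0 < t" "t < T" using that by auto
    have "Lp_enorm M p (F t) \<le> ennreal (Y * t powr (- w))"
      using bd[OF t] p Y by (subst Lp_enorm_le_iff) auto
    then have "ennreal (time_weight \<sigma> t) * Lp_enorm M p (F t) \<le> ennreal (t powr w) * ennreal (Y * t powr (- w))"
      unfolding w[OF t(1)] by (intro mult_left_mono) auto
    also have "\<dots> = ennreal Y"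
      using t Y by (simp add: ennreal_mult[symmetric] powr_add[symmetric] mult.left_commute)
    finally show ?thesis .
  qed
  then show ?thesis unfolding C_norm_def if_P[OF F] by (rule SUP_least)
qed

lemma Linf_norm_energy_bound:
  assumes "Linf_norm T M p F = ennreal A" "0 \<le> A" "0 < p"
  shows "AE t in lebesgue_on {0..<T}. energy M p (F t) \<le> ennreal (A powr p)"
proof -
  have "esssup (lebesgue_on {0..<T}) (\<lambda>t. Lp_enorm M p (F t)) = ennreal A"
    using assms(1) by (auto simp: Linf_norm_def split: if_splits)
  with esssup_AE[of "\<lambda>t. Lp_enorm M p (F t)" "lebesgue_on {0..<T}"]
  show ?thesis using assms by (simp add: Lp_enorm_le_iff)
qed

lemma energy_root:
  assumes "0 < b"
  shows "energy M p (\<lambda>x. \<bar>f x\<bar> powr (1 / (b + 1))) = energy M (p / (b + 1)) f"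
  by (simp add: energy_def powr_powr)

lemma C_Lp_cong_AE:
  assumes F: "F \<in> C_Lp T M p" and p: "0 < p"
    and eq: "\<And>t. t \<in> {0..<T} \<Longrightarrow> AE x in M. G t x = F t x"
  shows "G \<in> C_Lp T M p"
proof -
  have en: "Lp_enorm M p (\<lambda>x. G s x - G t x) = Lp_enorm M p (\<lambda>x. F s x - F t x)"
    if "s \<in> {0..<T}" "t \<in> {0..<T}" for s t
  proof -
    have "AE x in M. G s x - G t x = F s x - F t x"
      using eq[OF that(1)] eq[OF that(2)] by eventually_elim simp
    then have "energy M p (\<lambda>x. G s x - G t x) = energy M p (\<lambda>x. F s x - F t x)"
      by (rule energy_cong_AE)
    then show ?thesis by (simp add: Lp_enorm_def energy_def)
  qed
  have mem: "G t \<in> Lp_space M p" if t: "t \<in> {0..<T}" for t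
  proof (rule Lp_spaceI[OF _ _ p])
    obtain g where g: "g \<in> borel_measurable M" "AE x in M. F t x = g x"
      using borel_representative[OF Lp_spaceD(1)[OF C_LpD(1)[OF F t] p]] .
    have "AE x in M. G t x = g x" using eq[OF t] g(2) by eventually_elim simp
    then show "G t \<in> borel_measurable (completion M)"
      by (rule borel_measurable_completion_AE[OF g(1)])
    show "energy M p (G t) < top"
      using energy_cong_AE[OF eq[OF t], of p] Lp_spaceD(2)[OF C_LpD(1)[OF F t] p] by simp
  qed
  show ?thesis
    unfolding C_Lp_def
  proof (intro CollectI ballI conjI mem)
    fix t assume t: "t \<in> {0..<T}"
    show "((\<lambda>s. Lp_enorm M p (\<lambda>x. G s x - G t x)) \<longlongrightarrow> 0) (at t within {0..<T})"
      using C_LpD(2)[OF F t]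
      by (rule Lim_transform_eventually) (auto simp: eventually_at_filter en[OF _ t])
  qed
qed

lemma C_Lp_zero: "0 < p \<Longrightarrow> (\<lambda>t x. 0) \<in> C_Lp T M p"
  by (auto simp: C_Lp_def Lp_enorm_def epow_def Lp_space_def)

text \<open>The product on the right is 0 if one factor is 0 and the other one infinite, so vanishing factors
  have to be treated separately. An infinite factor whose exponent is 0 counts as 1, which is why
  the bound for s = 0 must not involve L.\<close>
lemma le_product_of_epow:
  fixes X L K :: ennreal and D s u :: real
  assumes D: "0 < D" and s: "0 \<le> s" and u: "0 < u"
    and zero: "K = 0 \<Longrightarrow> X = 0" "L = 0 \<Longrightarrow> s \<noteq> 0 \<Longrightarrow> X = 0"
    and main: "\<And>A B. 0 < A \<Longrightarrow> 0 < B \<Longrightarrow> K = ennreal B \<Longrightarrow> s = 0 \<or> L = ennreal A \<Longrightarrow>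
      X \<le> ennreal (D * (A powr s * B powr u))"
  shows "X \<le> ennreal D * epow L s * epow K u"
proof (cases "K = 0 \<or> (L = 0 \<and> s \<noteq> 0)")
  case True
  then show ?thesis using zero by auto
next
  case False
  have pos: "0 < epow Z a" if "Z \<noteq> 0" for Z a
    using that by (cases Z) (auto simp: epow_def)
  have Lpos: "0 < epow L s" using False pos[of L s] by (cases "s = 0") (auto simp: epow_def)
  show ?thesis
  proof (cases K)
    case top
    then have "epow K u = top" using u by (simp add: epow_def)
    moreover have "ennreal D * epow L s \<noteq> 0" using D Lpos by auto
    ultimately show ?thesis by (simp add: ennreal_mult_top)
  next
    case (real B)
    have B: "0 < B" using False real by auto
    have Ku: "epow K u = ennreal (B powr u)" using real u by (simp add: epow_ennreal)
    show ?thesis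
    proof (cases "s = 0")
      case True
      then have "X \<le> ennreal (D * (1 powr s * B powr u))" using B real by (intro main) auto
      moreover have "epow L s = 1" using True by (simp add: epow_def)
      ultimately show ?thesis unfolding Ku using True D by (simp add: ennreal_mult)
    next
      case sn: False
      show ?thesis
      proof (cases L)
        case top
        then have "epow L s = top" using sn by (simp add: epow_def)
        moreover have "epow K u \<noteq> 0" "ennreal D \<noteq> 0" using False pos[of K u] D by auto
        ultimately show ?thesis by (simp only: ennreal_mult_top ennreal_top_mult if_False top_greatest)
      next
        case (real A)
        have A: "0 < A" using False sn real by auto
        have "X \<le> ennreal (D * (A powr s * B powr u))"
          using A B real \<open>K = ennreal B\<close> by (intro main) simp_all
        also have "ennreal (D * (A powr s * B powr u)) = ennreal D * epow L s * epow K u"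
          unfolding Ku using D real sn by (simp add: epow_ennreal ennreal_mult mult.assoc)
        finally show ?thesis .
      qed
    qed
  qed
qed

section \<open>The Duhamel term of a fractional heat kernel\<close>

locale duhamel_kernel = smoothing_kernel M k C \<gamma>
  for M :: "'a measure" and k :: "real \<Rightarrow> 'a \<Rightarrow> 'a \<Rightarrow> real" and C \<gamma> :: real +
  fixes h :: "real \<Rightarrow> 'a \<Rightarrow> 'a \<Rightarrow> real" and \<eta> :: "real \<Rightarrow> real \<Rightarrow> real" and N :: "('a \<times> 'a) set"
  assumes N_null: "N \<in> null_sets (M \<Otimes>\<^sub>M M)"
    and kernel_eq: "\<And>t x y. 0 < t \<Longrightarrow> (x, y) \<notin> N \<Longrightarrow> frac_heat_kernel \<eta> h t x y = k t x y"
    and density_integrable: "\<And>t x y. 0 < t \<Longrightarrow> (x, y) \<notin> N \<Longrightarrow> set_integrable lborel {0<..} (\<lambda>\<sigma>. \<eta> t \<sigma> * h \<sigma> x y)"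
begin

lemma AE_regular_point: "AE x in M. AE y in M. (x, y) \<notin> N"
proof -
  interpret MM: pair_sigma_finite M M by (rule pair_sigma_finite_M_M)
  show ?thesis by (rule MM.AE_pair[OF AE_not_in[OF N_null]])
qed

lemma frac_heat_op_eq:
  assumes x: "AE y in M. (x, y) \<notin> N" and s: "0 < s" and g[measurable]: "g \<in> borel_measurable (completion M)"
  shows "frac_heat_op M \<eta> h s g x = kernel_op s g x"
    and "integrable (completion M) (\<lambda>y. frac_heat_kernel \<eta> h s x y * g y) \<longleftrightarrow> integrable (completion M) (\<lambda>y. k s x y * g y)"
proof -
  have kM: "(\<lambda>y. k s x y) \<in> borel_measurable M" by (simp add: space_UNIV)
  have [measurable]: "(\<lambda>y. k s x y) \<in> borel_measurable (completion M)" by (rule measurable_completion[OF kM])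
  have eq: "AE y in M. frac_heat_kernel \<eta> h s x y = k s x y"
    using x by eventually_elim (rule kernel_eq[OF s])
  have [measurable]: "(\<lambda>y. frac_heat_kernel \<eta> h s x y) \<in> borel_measurable (completion M)"
    by (rule borel_measurable_completion_AE[OF kM eq])
  have eq': "AE y in completion M. frac_heat_kernel \<eta> h s x y * g y = k s x y * g y"
    unfolding AE_completion_iff using eq by eventually_elim simp
  show "frac_heat_op M \<eta> h s g x = kernel_op s g x"
    unfolding frac_heat_op_def kernel_op_def by (rule integral_cong_AE[OF _ _ eq']) measurable
  show "integrable (completion M) (\<lambda>y. frac_heat_kernel \<eta> h s x y * g y) \<longleftrightarrow> integrable (completion M) (\<lambda>y. k s x y * g y)"
    by (rule integrable_cong_AE[OF _ _ eq']) measurable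
qed

lemma integrand_eq_flow:
  assumes x: "AE y in M. (x, y) \<notin> N" and f: "\<And>\<tau>. 0 < \<tau> \<Longrightarrow> \<tau> < t \<Longrightarrow> f \<tau> \<in> borel_measurable (completion M)"
  shows "indicator {0<..<t} \<tau> *\<^sub>R frac_heat_op M \<eta> h (t - \<tau>) (f \<tau>) x = flow (past f t) (t + (- 1) * \<tau>) x"
proof (cases "0 < \<tau> \<and> \<tau> < t")
  case True
  then show ?thesis using frac_heat_op_eq(1)[OF x _ f, of "t - \<tau>" \<tau>] by (simp add: flow_def past_def)
next
  case False
  then show ?thesis by (auto simp: flow_def past_def)
qed

text \<open>At every point x whose section of the exceptional set is null, the Duhamel term is the integral of
  the regular kernel, after the reflection \<tau> = t - s.\<close>
lemma duhamel_eq: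
  assumes x: "AE y in M. (x, y) \<notin> N" and f: "\<And>\<tau>. 0 < \<tau> \<Longrightarrow> \<tau> < t \<Longrightarrow> f \<tau> \<in> borel_measurable (completion M)"
  shows "duhamel M \<eta> h f t x = duhamel_int (past f t) x"
    and "set_integrable lborel {0<..<t} (\<lambda>\<tau>. frac_heat_op M \<eta> h (t - \<tau>) (f \<tau>) x)
      \<longleftrightarrow> integrable lborel (\<lambda>s. flow (past f t) s x)"
proof -
  have eq: "indicator {0<..<t} \<tau> *\<^sub>R frac_heat_op M \<eta> h (t - \<tau>) (f \<tau>) x = flow (past f t) (t + (- 1) * \<tau>) x" for \<tau>
    by (rule integrand_eq_flow[OF x f])
  show "duhamel M \<eta> h f t x = duhamel_int (past f t) x"
    unfolding duhamel_def set_lebesgue_integral_def duhamel_int_def eq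
    using lborel_integral_real_affine[of "-1" "\<lambda>s. flow (past f t) s x" t] by simp
  show "set_integrable lborel {0<..<t} (\<lambda>\<tau>. frac_heat_op M \<eta> h (t - \<tau>) (f \<tau>) x)
      \<longleftrightarrow> integrable lborel (\<lambda>s. flow (past f t) s x)"
    unfolding set_integrable_def eq by (rule lborel_integrable_real_affine_iff) simp
qed

lemma C_Lp_measurable:
  assumes "f \<in> C_Lp T M m" "0 < m" "0 < \<tau>" "\<tau> < T"
  shows "f \<tau> \<in> borel_measurable (completion M)"
  using Lp_spaceD(1)[OF C_LpD(1)[OF assms(1), of \<tau>] assms(2)] assms(3,4) by auto

lemma duhamel_converges:
  assumes f: "f \<in> C_Lp T M m" and m: "1 \<le> m" "m \<le> n" and a: "\<gamma> * (1 / m - 1 / n) < 1" and t: "t \<in> {0..<T}"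
  shows "duhamel_converges M \<eta> h f t"
  unfolding duhamel_converges_def
  using AE_regular_point duhamel_int_past_basic(1)[OF f m a t]
proof eventually_elim
  case (elim x)
  have fm: "f \<tau> \<in> borel_measurable (completion M)" if "0 < \<tau>" "\<tau> < t" for \<tau>
    using C_Lp_measurable[OF f] m t that by auto
  show ?case
  proof (intro conjI)
    show "AE y in M. \<forall>s>0. set_integrable lborel {0<..} (\<lambda>\<sigma>. \<eta> s \<sigma> * h \<sigma> x y)"
      using elim(1) by eventually_elim (auto intro: density_integrable)
    show "AE \<tau> in lborel. \<tau> \<in> {0<..<t} \<longrightarrow> integrable (completion M) (\<lambda>y. frac_heat_kernel \<eta> h (t - \<tau>) x y * f \<tau> y)"
    proof (intro AE_I2 impI)
      fix \<tau> assume \<tau>: "\<tau> \<in> {0<..<t}"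
      have "energy M m (f \<tau>) < top"
        using Lp_spaceD(2)[OF C_LpD(1)[OF f, of \<tau>]] \<tau> t m by auto
      then have "integrable (completion M) (\<lambda>y. k (t - \<tau>) x y * f \<tau> y)"
        using fm[of \<tau>] \<tau> m by (intro kernel_integrable[where m = m]) auto
      then show "integrable (completion M) (\<lambda>y. frac_heat_kernel \<eta> h (t - \<tau>) x y * f \<tau> y)"
        using frac_heat_op_eq(2)[OF elim(1) _ fm, of "t - \<tau>" \<tau>] \<tau> by auto
    qed
    show "set_integrable lborel {0<..<t} (\<lambda>\<tau>. frac_heat_op M \<eta> h (t - \<tau>) (f \<tau>) x)"
      using duhamel_eq(2)[where f = f, OF elim(1) fm] elim(2) by blast
  qed
qed

lemma AE_duhamel_eq:
  assumes "f \<in> C_Lp T M m" "0 < m" "t < T"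
  shows "AE x in M. duhamel M \<eta> h f t x = duhamel_int (past f t) x"
  using AE_regular_point
proof eventually_elim
  case (elim x)
  show ?case by (rule duhamel_eq(1)[OF elim]) (use C_Lp_measurable[OF assms(1,2)] assms(3) in auto)
qed

lemma duhamel_int_past_0: "duhamel_int (past f 0) = (\<lambda>_. 0)"
proof -
  have "flow (past f 0) s x = 0" for s x by (auto simp: flow_def past_def)
  then show ?thesis by (simp add: duhamel_int_def fun_eq_iff)
qed

lemma duhamel_Linf_norm_le:
  assumes f: "f \<in> C_Lp T M m" "0 < m" and JC: "(\<lambda>t. duhamel_int (past f t)) \<in> C_Lp T M n" and n: "1 \<le> n" and Y: "0 \<le> Y"
    and bd: "\<And>t. 0 < t \<Longrightarrow> t < T \<Longrightarrow> energy M n (duhamel_int (past f t)) \<le> ennreal (Y powr n)"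
  shows "Linf_norm T M n (duhamel M \<eta> h f) \<le> ennreal Y"
proof (rule C_Lp_Linf_norm_le[OF _ n])
  show "duhamel M \<eta> h f \<in> C_Lp T M n"
    by (rule C_Lp_cong_AE[OF JC]) (use n AE_duhamel_eq[OF f] in auto)
  fix t assume t: "t \<in> {0..<T}"
  have "energy M n (duhamel M \<eta> h f t) = energy M n (duhamel_int (past f t))"
    using t by (intro energy_cong_AE AE_duhamel_eq[OF f]) auto
  also have "\<dots> \<le> ennreal (Y powr n)"
    using bd[of t] t duhamel_int_past_0[of f] energy_zero[of n M] n by (cases "t = 0") auto
  finally show "Lp_enorm M n (duhamel M \<eta> h f t) \<le> ennreal Y"
    using n Y by (subst Lp_enorm_le_iff) auto
qed

lemma duhamel_C_norm_le:
  assumes f: "f \<in> C_Lp T M m" "0 < m" and JC: "(\<lambda>t. duhamel_int (past f t)) \<in> C_Lp T M n" and n: "1 \<le> n" and Y: "0 \<le> Y"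
    and T: "0 < T" and w: "\<And>t. 0 < t \<Longrightarrow> time_weight q t = t powr w"
    and bd: "\<And>t. 0 < t \<Longrightarrow> t < T \<Longrightarrow> energy M n (duhamel_int (past f t)) \<le> ennreal ((Y * t powr (- w)) powr n)"
  shows "C_norm T q M n (duhamel M \<eta> h f) \<le> ennreal Y"
proof (rule C_norm_le[OF _ _ Y w])
  show "duhamel M \<eta> h f \<in> C_Lp T M n"
    by (rule C_Lp_cong_AE[OF JC]) (use n AE_duhamel_eq[OF f] in auto)
  have eq: "energy M n (duhamel M \<eta> h f t) = energy M n (duhamel_int (past f t))" if "t < T" for t
    using that by (intro energy_cong_AE AE_duhamel_eq[OF f])
  show "energy M n (duhamel M \<eta> h f 0) = 0" using eq[OF T] duhamel_int_past_0[of f] energy_zero[of n M] n by simp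
  show "energy M n (duhamel M \<eta> h f t) \<le> ennreal ((Y * t powr (- w)) powr n)" if "0 < t" "t < T" for t
    using bd[OF that] eq[OF that(2)] by simp
qed (use n in auto)

text \<open>If f vanishes at every positive time, so does the Duhamel term. This settles the cases in which a norm on
  the right-hand side is 0.\<close>
lemma duhamel_norms_zero:
  assumes f: "f \<in> C_Lp T M m" "0 < m" and z: "\<And>\<tau>. 0 < \<tau> \<Longrightarrow> \<tau> < T \<Longrightarrow> AE x in M. f \<tau> x = 0"
    and n: "1 \<le> n" and T: "0 < T" and w: "\<And>t. 0 < t \<Longrightarrow> time_weight q t = t powr w"
  shows "Linf_norm T M n (duhamel M \<eta> h f) = 0" "C_norm T q M n (duhamel M \<eta> h f) = 0"
proof -
  have J0: "duhamel_int (past f t) = (\<lambda>_. 0)" if t: "t < T" for t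
  proof -
    have op0: "kernel_op s (past f t s) = (\<lambda>_. 0)" for s
    proof (cases "0 < s \<and> s < t")
      case True
      have "kernel_op s (f (t - s)) = kernel_op s (\<lambda>_. 0)"
        by (rule kernel_op_cong_AE[OF C_Lp_measurable[OF f] _ z]) (use True t in auto)
      then show ?thesis using True by (simp add: past_def)
    next
      case False
      then have "past f t s = (\<lambda>_. 0)" by (auto simp: past_def)
      then show ?thesis by simp
    qed
    have "flow (past f t) s x = 0" for s x by (simp add: flow_def op0)
    then show ?thesis by (simp add: duhamel_int_def fun_eq_iff)
  qed
  have JC: "(\<lambda>t. duhamel_int (past f t)) \<in> C_Lp T M n"
    by (rule C_Lp_cong_AE[OF C_Lp_zero]) (use n J0 in auto)
  have "Linf_norm T M n (duhamel M \<eta> h f) \<le> ennreal 0"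
    by (rule duhamel_Linf_norm_le[OF f JC n]) (use J0 energy_zero[of n M] n in auto)
  then show "Linf_norm T M n (duhamel M \<eta> h f) = 0" by simp
  have "C_norm T q M n (duhamel M \<eta> h f) \<le> ennreal 0"
    by (rule duhamel_C_norm_le[OF f JC n _ T w]) (use J0 energy_zero[of n M] n in auto)
  then show "C_norm T q M n (duhamel M \<eta> h f) = 0" by simp
qed

end

section \<open>The estimates for admissible exponents\<close>

text \<open>The parameter \<kappa> is 1 / q as a real number, and \<kappa> < 1 restates the upper bound on p in the definition of
  admissibility.\<close>
locale admissible_duhamel = duhamel_kernel M k C \<gamma> h \<eta> N
  for M :: "'a measure" and k :: "real \<Rightarrow> 'a \<Rightarrow> 'a \<Rightarrow> real" and C \<gamma> :: real
    and h :: "real \<Rightarrow> 'a \<Rightarrow> 'a \<Rightarrow> real" and \<eta> :: "real \<Rightarrow> real \<Rightarrow> real" and N :: "('a \<times> 'a) set" +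
  fixes b p r \<kappa> :: real and q :: ennreal
  assumes b: "0 < b" and r: "1 < r" and rp: "r \<le> p" and bp: "b + 1 < p" and \<gamma>_pos: "0 < \<gamma>"
    and r0: "b * \<gamma> \<le> r" and \<kappa>: "\<kappa> = \<gamma> * (1 / r - 1 / p)" "\<kappa> < 1" and q: "1 / q = ennreal \<kappa>"
begin

abbreviation m1 :: real where "m1 \<equiv> p / (b + 1)"
abbreviation \<sigma> :: ennreal where "\<sigma> \<equiv> q / ennreal (b + 1)"
abbreviation \<rho> :: real where "\<rho> \<equiv> 1 - b * \<gamma> / r"

lemma m1: "1 < m1" "0 < m1"
  using b bp by (auto simp: field_simps)

lemma p_pos: "1 < p" "0 < p" "0 < r" using r rp by auto

lemma \<kappa>_nonneg: "0 \<le> \<kappa>"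
  unfolding \<kappa>(1) using \<gamma>_pos r rp by (intro mult_nonneg_nonneg) (auto intro!: divide_left_mono)

lemma \<rho>_nonneg: "0 \<le> \<rho>"
  using r0 r by simp

lemma weight_q: "0 < t \<Longrightarrow> time_weight q t = t powr \<kappa>"
  by (rule time_weight_powr[OF q \<kappa>_nonneg])

lemma weight_\<sigma>: "0 < t \<Longrightarrow> time_weight \<sigma> t = t powr ((b + 1) * \<kappa>)"
  using b \<kappa>_nonneg by (intro time_weight_powr one_div_divide_ennreal q) auto

lemma C_spaceD:
  assumes "f \<in> C_space T \<sigma> M m1"
  obtains B where "f \<in> C_Lp T M m1" "C_norm T \<sigma> M m1 f = ennreal B" "0 \<le> B"
proof -
  have "C_norm T \<sigma> M m1 f \<noteq> top" using assms by (auto simp: C_space_def)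
  then obtain B where "C_norm T \<sigma> M m1 f = ennreal B" "0 \<le> B" by (cases "C_norm T \<sigma> M m1 f") auto
  then show ?thesis using that assms by (auto simp: C_space_def)
qed

text \<open>The exponents of the kernel singularity and of the weight of f add up to b \<gamma> / r, plus the exponent of
  the weight of the L^n norm on the left: 0 for n = r and \<kappa> for n = p.\<close>
lemma exponents:
  "\<gamma> * (1 / m1 - 1 / n) + (b + 1) * \<kappa> = b * \<gamma> / r + \<gamma> * (1 / r - 1 / n)"
  unfolding \<kappa>(1) by (simp add: algebra_simps add_divide_distrib)

text \<open>The hypothesis p < r (b + 1) says that (b + 1) (1/r - 1/p) < b / r, and b \<gamma> \<le> r.\<close>
lemma time_weight_lt_1:
  assumes "p < r * (b + 1)"
  shows "(b + 1) * \<kappa> < 1"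
proof -
  have "(b + 1) * (1 / r - 1 / p) < b / r"
  proof -
    have "1 / r < (b + 1) / p" using assms p_pos by (simp add: field_simps)
    then show ?thesis by (simp add: algebra_simps add_divide_distrib)
  qed
  then have "\<gamma> * ((b + 1) * (1 / r - 1 / p)) < \<gamma> * (b / r)" using \<gamma>_pos by (intro mult_strict_left_mono) auto
  also have "\<dots> \<le> 1" using r0 r by (simp add: mult.commute)
  finally show ?thesis unfolding \<kappa>(1) by (simp add: mult_ac)
qed

lemma duhamel_subcritical:
  assumes f: "f \<in> C_Lp T M m" and m: "1 \<le> m" "m \<le> n" and a: "\<gamma> * (1 / m - 1 / n) = a" "a < 1"
    and w: "0 \<le> w" "w < 1" and X: "0 < X" and aw: "1 - a - w = \<rho> - v" and t: "0 < t" "t < T"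
    and bd: "\<And>\<tau>. 0 < \<tau> \<Longrightarrow> \<tau> < T \<Longrightarrow> energy M m (f \<tau>) \<le> ennreal ((X * \<tau> powr (- w)) powr m)"
  shows "energy M n (duhamel_int (past f t))
    \<le> ennreal ((gain m n * (2 powr w / (1 - a) + 2 powr a / (1 - w)) * T powr \<rho> * X * t powr (- v)) powr n)"
proof (rule order_trans[OF duhamel_int_past_weighted[OF f m t a w X bd]])
  let ?c = "gain m n * (2 powr w / (1 - a) + 2 powr a / (1 - w))"
  have c: "0 < ?c" using gain_pos[of m n] a w by (intro mult_pos_pos add_pos_pos divide_pos_pos) auto
  have "t powr (1 - a - w) = t powr \<rho> * t powr (- v)" unfolding aw powr_add[symmetric] by simp
  also have "\<dots> \<le> T powr \<rho> * t powr (- v)" using t \<rho>_nonneg by (intro mult_right_mono powr_mono2) auto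
  finally have "?c * X * t powr (1 - a - w) \<le> ?c * X * (T powr \<rho> * t powr (- v))"
    using c X by (intro mult_left_mono) auto
  also have "\<dots> = ?c * T powr \<rho> * X * t powr (- v)" by (simp only: mult_ac)
  finally show "ennreal ((?c * X * t powr (1 - a - w)) powr n) \<le> ennreal ((?c * T powr \<rho> * X * t powr (- v)) powr n)"
    using mult_nonneg_nonneg[OF mult_nonneg_nonneg[OF less_imp_le[OF c] less_imp_le[OF X]]] m
    by (intro ennreal_leI powr_mono2) auto
qed auto

lemma duhamel_converges_space:
  assumes "b * \<gamma> < p" and f: "f \<in> C_space T \<sigma> M m1" and t: "t \<in> {0..<T}"
  shows "duhamel_converges M \<eta> h f t"
proof (rule duhamel_converges[where m = m1 and n = p and T = T])
  show "\<gamma> * (1 / m1 - 1 / p) < 1" using assms(1) p_pos by (simp add: field_simps)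
  show "m1 \<le> p" using b p_pos by (simp add: field_simps)
qed (use f t m1 in \<open>auto simp: C_space_def\<close>)

text \<open>Source exponent p / (b + 1), which is below both r and p.\<close>
lemma duhamel_small_exponent:
  assumes p: "p < r * (b + 1)" "b * \<gamma> < p"
  shows "\<exists>c>0. \<forall>T>0. \<forall>f \<in> C_space T \<sigma> M m1.
      Linf_norm T M r (duhamel M \<eta> h f) \<le> ennreal (c * T powr \<rho>) * C_norm T \<sigma> M m1 f"
    "\<exists>c>0. \<forall>T>0. \<forall>f \<in> C_space T \<sigma> M m1.
      C_norm T q M p (duhamel M \<eta> h f) \<le> ennreal (c * T powr \<rho>) * C_norm T \<sigma> M m1 f"
proof -
  define w where "w = (b + 1) * \<kappa>"
  have w: "0 \<le> w" "w < 1" using time_weight_lt_1[OF p(1)] \<kappa>_nonneg b by (auto simp: w_def)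
  have key: "\<exists>c>0. \<forall>T>0. \<forall>f B. f \<in> C_Lp T M m1 \<longrightarrow> C_norm T \<sigma> M m1 f = ennreal B \<longrightarrow> 0 < B \<longrightarrow>
      (\<lambda>t. duhamel_int (past f t)) \<in> C_Lp T M n \<and>
      (\<forall>t. 0 < t \<longrightarrow> t < T \<longrightarrow> energy M n (duhamel_int (past f t)) \<le> ennreal ((c * T powr \<rho> * B * t powr (- v)) powr n))"
    if n: "m1 \<le> n" and a: "\<gamma> * (1 / m1 - 1 / n) < 1" and v: "v = \<gamma> * (1 / r - 1 / n)" for n v
  proof -
    define a' where "a' = \<gamma> * (1 / m1 - 1 / n)"
    have a': "a' < 1" using a by (simp add: a'_def)
    have aw: "1 - a' - w = \<rho> - v" using exponents[of n] unfolding a'_def w_def v by linarith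
    let ?c = "gain m1 n * (2 powr w / (1 - a') + 2 powr a' / (1 - w))"
    have c: "0 < ?c" using gain_pos[of m1 n] a' w by (intro mult_pos_pos add_pos_pos divide_pos_pos) auto
    show ?thesis
    proof (intro exI[of _ ?c] conjI allI impI c)
      fix T f B assume T: "0 < T" and f: "f \<in> C_Lp T M m1" and B: "C_norm T \<sigma> M m1 f = ennreal B" "0 < B"
      show "(\<lambda>t. duhamel_int (past f t)) \<in> C_Lp T M n" using m1 n a by (intro duhamel_int_past_C_Lp[OF f]) auto
      fix t assume t: "0 < t" "t < T"
      show "energy M n (duhamel_int (past f t)) \<le> ennreal ((?c * T powr \<rho> * B * t powr (- v)) powr n)"
      proof (rule duhamel_subcritical[OF f _ n _ a' w B(2) aw t])
        show "\<gamma> * (1 / m1 - 1 / n) = a'" by (simp add: a'_def)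
        show "energy M m1 (f \<tau>) \<le> ennreal ((B * \<tau> powr (- w)) powr m1)" if "0 < \<tau>" "\<tau> < T" for \<tau>
          using that B m1 weight_\<sigma>[of \<tau>] by (intro C_norm_energy_bound) (auto simp: w_def)
      qed (use m1 in auto)
    qed
  qed
  have zero: "AE x in M. f \<tau> x = 0"
    if f: "f \<in> C_Lp T M m1" and B: "C_norm T \<sigma> M m1 f = ennreal 0" and \<tau>: "0 < \<tau>" "\<tau> < T" for T f \<tau>
  proof (rule energy_eq_0_AE[OF C_Lp_measurable[OF f m1(2) \<tau>] _ m1(2)])
    show "energy M m1 (f \<tau>) = 0"
      using C_norm_energy_bound[OF B _ m1(2) \<tau> weight_\<sigma>[OF \<tau>(1)]] by simp
  qed
  have nr: "m1 \<le> r" "m1 \<le> p" using p b p_pos by (auto simp: field_simps)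
  have ap: "\<gamma> * (1 / m1 - 1 / p) < 1" using p p_pos by (simp add: field_simps)
  have ar: "\<gamma> * (1 / m1 - 1 / r) < 1"
  proof -
    have "\<gamma> * (1 / m1 - 1 / r) \<le> \<gamma> * (1 / m1 - 1 / p)"
      using \<gamma>_pos rp r by (intro mult_left_mono diff_left_mono divide_left_mono) auto
    then show ?thesis using ap by simp
  qed
  from key[OF nr(1) ar refl] obtain c where c: "0 < c"
    and est: "\<forall>T>0. \<forall>f B. f \<in> C_Lp T M m1 \<longrightarrow> C_norm T \<sigma> M m1 f = ennreal B \<longrightarrow> 0 < B \<longrightarrow>
      (\<lambda>t. duhamel_int (past f t)) \<in> C_Lp T M r \<and>
      (\<forall>t. 0 < t \<longrightarrow> t < T \<longrightarrow> energy M r (duhamel_int (past f t)) \<le> ennreal ((c * T powr \<rho> * B * t powr (- (\<gamma> * (1 / r - 1 / r)))) powr r))"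
    by (elim exE conjE)
  show "\<exists>c>0. \<forall>T>0. \<forall>f \<in> C_space T \<sigma> M m1.
      Linf_norm T M r (duhamel M \<eta> h f) \<le> ennreal (c * T powr \<rho>) * C_norm T \<sigma> M m1 f"
  proof (intro exI[of _ c] conjI allI impI ballI c)
    fix T f assume T: "(0::real) < T" and "f \<in> C_space T \<sigma> M m1"
    then obtain B where f: "f \<in> C_Lp T M m1" and B: "C_norm T \<sigma> M m1 f = ennreal B" "0 \<le> B"
      using C_spaceD by blast
    show "Linf_norm T M r (duhamel M \<eta> h f) \<le> ennreal (c * T powr \<rho>) * C_norm T \<sigma> M m1 f"
    proof (cases "B = 0")
      case True
      have "Linf_norm T M r (duhamel M \<eta> h f) = 0"
        by (rule duhamel_norms_zero(1)[OF f m1(2) zero[OF f] _ T weight_q]) (use B True r in auto)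
      then show ?thesis by simp
    next
      case False
      then have B0: "0 < B" using B by simp
      have "Linf_norm T M r (duhamel M \<eta> h f) \<le> ennreal (c * T powr \<rho> * B)"
        by (rule duhamel_Linf_norm_le[OF f m1(2)]) (use est[rule_format, OF T f B(1) B0] c B0 r in auto)
      also have "\<dots> = ennreal (c * T powr \<rho>) * ennreal B" using c B0 by (simp add: ennreal_mult)
      finally show ?thesis using B by simp
    qed
  qed
  from key[OF nr(2) ap \<kappa>(1)] obtain c where c: "0 < c"
    and est: "\<forall>T>0. \<forall>f B. f \<in> C_Lp T M m1 \<longrightarrow> C_norm T \<sigma> M m1 f = ennreal B \<longrightarrow> 0 < B \<longrightarrow>
      (\<lambda>t. duhamel_int (past f t)) \<in> C_Lp T M p \<and>
      (\<forall>t. 0 < t \<longrightarrow> t < T \<longrightarrow> energy M p (duhamel_int (past f t)) \<le> ennreal ((c * T powr \<rho> * B * t powr (- \<kappa>)) powr p))"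
    by (elim exE conjE)
  show "\<exists>c>0. \<forall>T>0. \<forall>f \<in> C_space T \<sigma> M m1.
      C_norm T q M p (duhamel M \<eta> h f) \<le> ennreal (c * T powr \<rho>) * C_norm T \<sigma> M m1 f"
  proof (intro exI[of _ c] conjI allI impI ballI c)
    fix T f assume T: "(0::real) < T" and "f \<in> C_space T \<sigma> M m1"
    then obtain B where f: "f \<in> C_Lp T M m1" and B: "C_norm T \<sigma> M m1 f = ennreal B" "0 \<le> B"
      using C_spaceD by blast
    show "C_norm T q M p (duhamel M \<eta> h f) \<le> ennreal (c * T powr \<rho>) * C_norm T \<sigma> M m1 f"
    proof (cases "B = 0")
      case True
      have "C_norm T q M p (duhamel M \<eta> h f) = 0"
        by (rule duhamel_norms_zero(2)[OF f m1(2) zero[OF f] _ T weight_q]) (use B True p_pos in auto)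
      then show ?thesis by simp
    next
      case False
      then have B0: "0 < B" using B by simp
      have "C_norm T q M p (duhamel M \<eta> h f) \<le> ennreal (c * T powr \<rho> * B)"
        by (rule duhamel_C_norm_le[OF f m1(2) _ _ _ T weight_q]) (use est[rule_format, OF T f B(1) B0] c B0 p_pos in auto)
      also have "\<dots> = ennreal (c * T powr \<rho>) * ennreal B" using c B0 by (simp add: ennreal_mult)
      finally show ?thesis using B by simp
    qed
  qed
qed

text \<open>The exponent for which 1 / (r (b + 1)) is the average of 1 / r and 1 / p with weights \<Theta> and 1 - \<Theta>.\<close>
definition \<Theta> :: real where "\<Theta> = (p - r * (b + 1)) / ((b + 1) * (p - r))"

abbreviation root :: "(real \<Rightarrow> 'a \<Rightarrow> real) \<Rightarrow> real \<Rightarrow> 'a \<Rightarrow> real" where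
  "root f \<equiv> (\<lambda>t x. \<bar>f t x\<bar> powr (1 / (b + 1)))"

context
  assumes large: "r * (b + 1) \<le> p"
begin

lemma r_less_p: "r < p"
  using large b r mult_strict_left_mono[of 1 "b + 1" r] by linarith

text \<open>The last identity says that the interpolated L^r norm of f grows like \<tau>^(- b \<gamma> / r) for small times.\<close>
lemma theta: "0 \<le> \<Theta>" "\<Theta> < 1" "\<Theta> = 0 \<longleftrightarrow> p = r * (b + 1)"
  "1 / r = (b + 1) * (\<Theta> / r + (1 - \<Theta>) / p)" "\<kappa> * ((1 - \<Theta>) * (b + 1)) = b * \<gamma> / r"
proof -
  have d: "0 < (b + 1) * (p - r)" using r_less_p b by simp
  show "0 \<le> \<Theta>" "\<Theta> = 0 \<longleftrightarrow> p = r * (b + 1)" using d large r_less_p b by (auto simp: \<Theta>_def)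
  have "p - r * (b + 1) < (b + 1) * (p - r)" using b p_pos by (simp add: algebra_simps)
  then show "\<Theta> < 1" using d by (simp add: \<Theta>_def)
  have "1 - \<Theta> = ((b + 1) * (p - r) - (p - r * (b + 1))) / ((b + 1) * (p - r))"
    using d b r_less_p by (simp add: \<Theta>_def diff_divide_distrib)
  also have "(b + 1) * (p - r) - (p - r * (b + 1)) = b * p" by (simp add: algebra_simps)
  finally have 1: "(1 - \<Theta>) * (b + 1) = b * p / (p - r)" using b r_less_p by simp
  have 2: "\<kappa> = \<gamma> * ((p - r) / (r * p))" unfolding \<kappa>(1) using p_pos by (simp add: diff_divide_distrib)
  show "\<kappa> * ((1 - \<Theta>) * (b + 1)) = b * \<gamma> / r" unfolding 1 2 using r_less_p p_pos by simp
  have "(b + 1) * (\<Theta> / r + (1 - \<Theta>) / p) = (b + 1) / r - ((1 - \<Theta>) * (b + 1)) * (1 / r - 1 / p)"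
    by (simp add: algebra_simps add_divide_distrib diff_divide_distrib)
  also have "1 / r - 1 / p = (p - r) / (r * p)" using p_pos by (simp add: diff_divide_distrib)
  also have "(b + 1) / r - ((1 - \<Theta>) * (b + 1)) * ((p - r) / (r * p)) = 1 / r"
    unfolding 1 using r_less_p p_pos by (simp add: diff_divide_distrib[symmetric])
  finally show "1 / r = (b + 1) * (\<Theta> / r + (1 - \<Theta>) / p)" by simp
qed

lemma root_bounds:
  assumes f: "f \<in> C_Lp T M m1" and T: "0 < T"
  shows "C_norm T q M p (root f) = ennreal B \<Longrightarrow> 0 \<le> B \<Longrightarrow> 0 < \<tau> \<Longrightarrow> \<tau> < T \<Longrightarrow>
      energy M m1 (f \<tau>) \<le> ennreal ((B * \<tau> powr (- \<kappa>)) powr p)"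
    and "Linf_norm T M r (root f) = ennreal A \<Longrightarrow> 0 \<le> A \<Longrightarrow> \<tau> \<in> {0..<T} \<Longrightarrow>
      energy M (r / (b + 1)) (f \<tau>) \<le> ennreal (A powr r)"
proof -
  assume B: "C_norm T q M p (root f) = ennreal B" "0 \<le> B" and \<tau>: "0 < \<tau>" "\<tau> < T"
  show "energy M m1 (f \<tau>) \<le> ennreal ((B * \<tau> powr (- \<kappa>)) powr p)"
    using C_norm_energy_bound[OF B p_pos(2) \<tau> weight_q[OF \<tau>(1)]] energy_root[OF b, of M p "f \<tau>"] by simp
next
  assume A: "Linf_norm T M r (root f) = ennreal A" "0 \<le> A" and \<tau>: "\<tau> \<in> {0..<T}"
  show "energy M (r / (b + 1)) (f \<tau>) \<le> ennreal (A powr r)"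
    by (rule C_Lp_energy_bound_everywhere[OF f _ m1(2) _ \<tau>])
      (use Linf_norm_energy_bound[OF A] energy_root[OF b, of M r] p_pos b in auto)
qed

text \<open>For the L^r norm, f has to vanish at every time and not only at almost every one; continuity in time
  provides this.\<close>
lemma root_zero:
  assumes f: "f \<in> C_Lp T M m1" and T: "0 < T"
    and z: "C_norm T q M p (root f) = 0 \<or> Linf_norm T M r (root f) = 0" and \<tau>: "0 < \<tau>" "\<tau> < T"
  shows "AE x in M. f \<tau> x = 0"
  using z
proof
  assume "C_norm T q M p (root f) = 0"
  then have "energy M m1 (f \<tau>) \<le> ennreal ((0 * \<tau> powr (- \<kappa>)) powr p)"
    by (intro root_bounds(1)[OF f T]) (use \<tau> in auto)
  then show ?thesis by (intro energy_eq_0_AE[OF C_Lp_measurable[OF f m1(2) \<tau>] _ m1(2)]) simp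
next
  assume "Linf_norm T M r (root f) = 0"
  then have "energy M (r / (b + 1)) (f \<tau>) \<le> ennreal (0 powr r)"
    by (intro root_bounds(2)[OF f T]) (use \<tau> in auto)
  then show ?thesis
    using p_pos b by (intro energy_eq_0_AE[OF C_Lp_measurable[OF f m1(2) \<tau>], of "r / (b + 1)"]) auto
qed

lemma root_interpolation:
  assumes f: "f \<in> C_Lp T M m1" and T: "0 < T" and A: "0 < A" and B: "0 < B" "C_norm T q M p (root f) = ennreal B"
    and AL: "\<Theta> * (b + 1) = 0 \<or> Linf_norm T M r (root f) = ennreal A"
    and \<phi>: "0 \<le> \<phi>" "\<phi> < 1" "\<Theta> = 0 \<Longrightarrow> \<phi> = 0" and m: "0 < m" "1 / m = (b + 1) * (\<phi> / r + (1 - \<phi>) / p)"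
  shows "f \<in> C_Lp T M m"
    and "\<And>\<tau>. 0 < \<tau> \<Longrightarrow> \<tau> < T \<Longrightarrow> energy M m (f \<tau>)
      \<le> ennreal ((A powr (\<phi> * (b + 1)) * B powr ((1 - \<phi>) * (b + 1)) * \<tau> powr (- (\<kappa> * ((1 - \<phi>) * (b + 1))))) powr m)"
proof -
  have bdA: "\<phi> = 0 \<or> (\<forall>\<tau>\<in>{0..<T}. energy M (r / (b + 1)) (f \<tau>) \<le> ennreal (A powr r))"
    using AL b \<phi>(3) A root_bounds(2)[OF f T, of A] by (cases "\<Theta> = 0") auto
  have bdB: "energy M m1 (f \<tau>) \<le> ennreal ((B * \<tau> powr (- \<kappa>)) powr p)" if "0 < \<tau>" "\<tau> < T" for \<tau>
    using root_bounds(1)[OF f T B(2) _ that] B by simp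
  note ip = C_Lp_interpolation[OF f b p_pos(3) r_less_p \<phi>(1,2) A B(1) bdA bdB m]
  show "f \<in> C_Lp T M m" by (rule ip(1))
  show "energy M m (f \<tau>)
      \<le> ennreal ((A powr (\<phi> * (b + 1)) * B powr ((1 - \<phi>) * (b + 1)) * \<tau> powr (- (\<kappa> * ((1 - \<phi>) * (b + 1))))) powr m)"
    if "0 < \<tau>" "\<tau> < T" for \<tau> by (rule ip(2)) (use that in auto)
qed

lemma duhamel_large_exponent_Linf:
  assumes sub: "b * \<gamma> < r"
  shows "\<exists>c>0. \<forall>T>0. \<forall>f \<in> C_space T \<sigma> M m1.
      Linf_norm T M r (duhamel M \<eta> h f) \<le> ennreal (c * T powr \<rho>)
        * epow (Linf_norm T M r (root f)) (\<Theta> * (b + 1)) * epow (C_norm T q M p (root f)) ((1 - \<Theta>) * (b + 1))"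
proof -
  define w where "w = b * \<gamma> / r"
  have w: "0 \<le> w" "w < 1" using sub r b \<gamma>_pos by (auto simp: w_def)
  let ?c = "gain r r * (2 powr w / (1 - 0) + 2 powr 0 / (1 - w))"
  have c: "0 < ?c" using gain_pos[of r r] w by (intro mult_pos_pos add_pos_pos divide_pos_pos) auto
  show ?thesis
  proof (intro exI[of _ ?c] conjI allI impI ballI c)
    fix T f assume T: "(0::real) < T" and "f \<in> C_space T \<sigma> M m1"
    then have f: "f \<in> C_Lp T M m1" by (simp add: C_space_def)
    show "Linf_norm T M r (duhamel M \<eta> h f) \<le> ennreal (?c * T powr \<rho>)
        * epow (Linf_norm T M r (root f)) (\<Theta> * (b + 1)) * epow (C_norm T q M p (root f)) ((1 - \<Theta>) * (b + 1))"
    proof (rule le_product_of_epow)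
      show "0 < ?c * T powr \<rho>" using T by (intro mult_pos_pos[OF c]) simp
      show "0 \<le> \<Theta> * (b + 1)" "0 < (1 - \<Theta>) * (b + 1)" using theta b by auto
      show "Linf_norm T M r (duhamel M \<eta> h f) = 0" if "C_norm T q M p (root f) = 0"
        by (rule duhamel_norms_zero(1)[OF f m1(2) root_zero[OF f T] _ T weight_q]) (use that r in auto)
      show "Linf_norm T M r (duhamel M \<eta> h f) = 0" if "Linf_norm T M r (root f) = 0"
        by (rule duhamel_norms_zero(1)[OF f m1(2) root_zero[OF f T] _ T weight_q]) (use that r in auto)
      fix A B assume A: "0 < A" and B: "0 < B" "C_norm T q M p (root f) = ennreal B"
        and AL: "\<Theta> * (b + 1) = 0 \<or> Linf_norm T M r (root f) = ennreal A"
      note ip = root_interpolation[OF f T A B AL theta(1,2) _ p_pos(3) theta(4), unfolded theta(5)]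
      let ?X = "A powr (\<Theta> * (b + 1)) * B powr ((1 - \<Theta>) * (b + 1))"
      have X: "0 < ?X" using A B by simp
      have fr: "f \<in> C_Lp T M r" by (rule ip(1)) simp
      show "Linf_norm T M r (duhamel M \<eta> h f) \<le> ennreal (?c * T powr \<rho> * ?X)"
      proof (rule duhamel_Linf_norm_le[OF fr p_pos(3)])
        show "(\<lambda>t. duhamel_int (past f t)) \<in> C_Lp T M r" using r by (intro duhamel_int_past_C_Lp[OF fr]) auto
        show "0 \<le> ?c * T powr \<rho> * ?X" using c X by simp
        fix t assume t: "0 < t" "t < T"
        have "energy M r (duhamel_int (past f t)) \<le> ennreal ((?c * T powr \<rho> * ?X * t powr (- 0)) powr r)"
          by (rule duhamel_subcritical[OF fr _ _ _ _ w X _ t])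
            (use r ip(2) in \<open>auto simp: w_def\<close>)
        then show "energy M r (duhamel_int (past f t)) \<le> ennreal ((?c * T powr \<rho> * ?X) powr r)" using t by simp
      qed (use r in auto)
    qed
  qed
qed

text \<open>If b \<gamma> < r, the weight \<tau>^(- b \<gamma> / r) is integrable. Otherwise it is 1 / \<tau>, and interpolation exponents slightly
  above and below \<Theta> are combined.\<close>
lemma duhamel_large_exponent_C:
  assumes "b * \<gamma> < r \<or> r * (b + 1) < p"
  shows "\<exists>c>0. \<forall>T>0. \<forall>f \<in> C_space T \<sigma> M m1.
      C_norm T q M p (duhamel M \<eta> h f) \<le> ennreal (c * T powr \<rho>)
        * epow (Linf_norm T M r (root f)) (\<Theta> * (b + 1)) * epow (C_norm T q M p (root f)) ((1 - \<Theta>) * (b + 1))"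
proof -
  have main: ?thesis
    if c: "0 < c" and est: "\<And>T f A B. 0 < T \<Longrightarrow> f \<in> C_Lp T M m1 \<Longrightarrow> 0 < A \<Longrightarrow> 0 < B \<Longrightarrow> C_norm T q M p (root f) = ennreal B \<Longrightarrow>
      \<Theta> * (b + 1) = 0 \<or> Linf_norm T M r (root f) = ennreal A \<Longrightarrow>
      f \<in> C_Lp T M r \<and> (\<forall>t. 0 < t \<longrightarrow> t < T \<longrightarrow> energy M p (duhamel_int (past f t))
        \<le> ennreal ((c * T powr \<rho> * (A powr (\<Theta> * (b + 1)) * B powr ((1 - \<Theta>) * (b + 1))) * t powr (- \<kappa>)) powr p))" for c
  proof (intro exI[of _ c] conjI allI impI ballI c)
    fix T f assume T: "(0::real) < T" and "f \<in> C_space T \<sigma> M m1"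
    then have f: "f \<in> C_Lp T M m1" by (simp add: C_space_def)
    show "C_norm T q M p (duhamel M \<eta> h f) \<le> ennreal (c * T powr \<rho>)
        * epow (Linf_norm T M r (root f)) (\<Theta> * (b + 1)) * epow (C_norm T q M p (root f)) ((1 - \<Theta>) * (b + 1))"
    proof (rule le_product_of_epow)
      show "0 < c * T powr \<rho>" using c T by (intro mult_pos_pos) auto
      show "0 \<le> \<Theta> * (b + 1)" "0 < (1 - \<Theta>) * (b + 1)" using theta b by auto
      show "C_norm T q M p (duhamel M \<eta> h f) = 0" if "C_norm T q M p (root f) = 0"
        by (rule duhamel_norms_zero(2)[OF f m1(2) root_zero[OF f T] _ T weight_q]) (use that p_pos in auto)
      show "C_norm T q M p (duhamel M \<eta> h f) = 0" if "Linf_norm T M r (root f) = 0"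
        by (rule duhamel_norms_zero(2)[OF f m1(2) root_zero[OF f T] _ T weight_q]) (use that p_pos in auto)
      fix A B assume A: "0 < A" and B: "0 < B" "C_norm T q M p (root f) = ennreal B"
        and AL: "\<Theta> * (b + 1) = 0 \<or> Linf_norm T M r (root f) = ennreal A"
      let ?X = "A powr (\<Theta> * (b + 1)) * B powr ((1 - \<Theta>) * (b + 1))"
      have X: "0 < ?X" using A B by simp
      note e = est[OF T f A B AL]
      show "C_norm T q M p (duhamel M \<eta> h f) \<le> ennreal (c * T powr \<rho> * ?X)"
      proof (rule duhamel_C_norm_le[OF _ p_pos(3) _ _ _ T weight_q])
        show "(\<lambda>t. duhamel_int (past f t)) \<in> C_Lp T M p"
          by (rule duhamel_int_past_C_Lp[where m = r]) (use e r rp \<kappa> in auto)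
        show "0 \<le> c * T powr \<rho> * ?X" using c X by simp
      qed (use e p_pos in auto)
    qed
  qed
  show ?thesis
  proof (cases "b * \<gamma> < r")
    case True
    define w where "w = b * \<gamma> / r"
    have w: "0 \<le> w" "w < 1" using True r b \<gamma>_pos by (auto simp: w_def)
    let ?c = "gain r p * (2 powr w / (1 - \<kappa>) + 2 powr \<kappa> / (1 - w))"
    have c: "0 < ?c" using gain_pos[of r p] w \<kappa> by (intro mult_pos_pos add_pos_pos divide_pos_pos) auto
    show ?thesis
    proof (rule main[OF c], intro conjI allI impI)
      fix T f A B assume T: "(0::real) < T" and f: "f \<in> C_Lp T M m1" and A: "0 < A"
        and B: "0 < B" "C_norm T q M p (root f) = ennreal B"
        and AL: "\<Theta> * (b + 1) = 0 \<or> Linf_norm T M r (root f) = ennreal A"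
      note ip = root_interpolation[OF f T A B AL theta(1,2) _ p_pos(3) theta(4), unfolded theta(5)]
      show fr: "f \<in> C_Lp T M r" by (rule ip(1)) simp
      fix t assume t: "0 < t" "t < T"
      show "energy M p (duhamel_int (past f t))
          \<le> ennreal ((?c * T powr \<rho> * (A powr (\<Theta> * (b + 1)) * B powr ((1 - \<Theta>) * (b + 1))) * t powr (- \<kappa>)) powr p)"
        by (rule duhamel_subcritical[OF fr _ rp _ \<kappa>(2) w _ _ t])
          (use r ip(2) A B in \<open>auto simp: w_def \<kappa>(1)\<close>)
    qed
  next
    case False
    then have crit: "b * \<gamma> = r" and p: "r * (b + 1) < p" using r0 assms by auto
    have \<Theta>0: "0 < \<Theta>" using theta(1,3) p by linarith
    define \<Delta> where "\<Delta> = 1 / r - 1 / p"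
    have \<Delta>: "0 < \<Delta>" using r_less_p p_pos by (simp add: \<Delta>_def field_simps)
    have \<kappa>\<Delta>: "\<kappa> = \<gamma> * \<Delta>" by (simp add: \<Delta>_def \<kappa>(1))
    have \<kappa>0: "0 < \<kappa>" using \<Delta> \<gamma>_pos by (simp add: \<kappa>\<Delta>)
    \<comment> \<open>The constraints on z keep the perturbed exponents in [0,1), the source exponents between 1 and p, and \<kappa> + d below 1.\<close>
    define z where "z = Min {\<Theta> * (b + 1), (1 - \<Theta>) * (b + 1) / 2, 1, (1 - 1 / r) / \<Delta>, (1 - \<kappa>) / (2 * \<kappa>)}"
  have "0 < \<Theta> * (b + 1)" "0 < (1 - \<Theta>) * (b + 1) / 2" "0 < (1 - 1 / r) / \<Delta>" "0 < (1 - \<kappa>) / (2 * \<kappa>)"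
      using \<Theta>0 theta(2) b \<Delta> r \<kappa>(2) \<kappa>0 by simp_all
    then have zpos: "0 < z" unfolding z_def by (subst Min_gr_iff) auto
    have z: "z \<le> \<Theta> * (b + 1)" "z \<le> (1 - \<Theta>) * (b + 1) / 2" "z \<le> 1" "z \<le> (1 - 1 / r) / \<Delta>" "z \<le> (1 - \<kappa>) / (2 * \<kappa>)"
      unfolding z_def by (auto intro: Min_le)
    define d where "d = z * \<kappa>"
    have d: "0 < d" "d \<le> \<kappa>" "\<kappa> + d < 1"
    proof -
      show "0 < d" using zpos \<kappa>0 by (simp add: d_def)
      show "d \<le> \<kappa>" using z(3) \<kappa>0 by (simp add: d_def mult_le_cancel_right2)
      have "d \<le> (1 - \<kappa>) / (2 * \<kappa>) * \<kappa>" unfolding d_def using z(5) \<kappa>0 by (intro mult_right_mono) auto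
      also have "\<dots> = (1 - \<kappa>) / 2" using \<kappa>0 by simp
      finally show "\<kappa> + d < 1" using \<kappa>(2) by simp
    qed
    define \<xi> where "\<xi> = z / (b + 1)"
    have \<xi>: "\<xi> * (b + 1) = z" using b by (simp add: \<xi>_def)
    have \<xi>b: "0 < \<xi>" "\<xi> \<le> \<Theta>" "\<xi> \<le> (1 - \<Theta>) / 2"
      using zpos z b by (auto simp: \<xi>_def field_simps)
    have expo: "(b + 1) * ((\<Theta> + x) / r + (1 - (\<Theta> + x)) / p) = 1 / r + (x * (b + 1)) * \<Delta>" for x
    proof -
      have "(b + 1) * ((\<Theta> + x) / r + (1 - (\<Theta> + x)) / p)
        = (b + 1) * (\<Theta> / r + (1 - \<Theta>) / p) + (x * (b + 1)) * \<Delta>"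
        by (simp add: \<Delta>_def algebra_simps add_divide_distrib diff_divide_distrib)
      then show ?thesis using theta(4) by simp
    qed
    define ma where "ma = 1 / (1 / r + z * \<Delta>)"
    define mb where "mb = 1 / (1 / r - z * \<Delta>)"
    have zD: "z * \<Delta> \<le> 1 - 1 / r" "z * \<Delta> \<le> \<Delta>" "0 < z * \<Delta>"
      using z(3,4) \<Delta> zpos by (auto simp: pos_le_divide_eq mult_le_cancel_right2)
    have rr: "0 < 1 / r" "1 / p \<le> 1 / r - z * \<Delta>" "0 < 1 / p" using zD p_pos by (auto simp: \<Delta>_def)
    have ma: "1 \<le> ma" "ma \<le> p" "1 / ma = 1 / r + z * \<Delta>"
    proof -
      show "1 / ma = 1 / r + z * \<Delta>" by (simp add: ma_def)
      have pos: "0 < 1 / r + z * \<Delta>" using rr zD by linarith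
      then show "1 \<le> ma" unfolding ma_def using zD by (intro le_divide_eq_1_pos[THEN iffD2]) auto
      have "1 / p \<le> 1 / r + z * \<Delta>" using rr zD by linarith
      then have "1 / (1 / r + z * \<Delta>) \<le> 1 / (1 / p)"
        using mult_pos_pos[OF pos rr(3)] by (intro divide_left_mono) simp_all
      then show "ma \<le> p" by (simp add: ma_def)
    qed
    have mb: "1 \<le> mb" "mb \<le> p" "1 / mb = 1 / r - z * \<Delta>"
    proof -
      show "1 / mb = 1 / r - z * \<Delta>" by (simp add: mb_def)
      have pos: "0 < 1 / r - z * \<Delta>" using rr by linarith
      have "1 / r < 1" using r by simp
      then show "1 \<le> mb" unfolding mb_def using zD pos by (intro le_divide_eq_1_pos[THEN iffD2]) auto
      have "1 / (1 / r - z * \<Delta>) \<le> 1 / (1 / p)"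
        using rr(2) mult_pos_pos[OF pos rr(3)] by (intro divide_left_mono) simp_all
      then show "mb \<le> p" by (simp add: mb_def)
    qed
    have ea: "\<gamma> * (1 / ma - 1 / p) = \<kappa> + d" and eb: "\<gamma> * (1 / mb - 1 / p) = \<kappa> - d"
      unfolding ma(3) mb(3) by (simp_all add: d_def \<kappa>\<Delta> \<Delta>_def algebra_simps)
    let ?c = "4 * (gain ma p + gain mb p) * (2 / d + 1 / (1 - \<kappa> - d))"
    have c: "0 < ?c" using gain_pos[of ma p] gain_pos[of mb p] d
      by (intro mult_pos_pos add_pos_pos divide_pos_pos) auto
    have \<rho>0: "\<rho> = 0" using crit r by simp
    show ?thesis
    proof (rule main[OF c], intro conjI allI impI)
      fix T f A B assume T: "(0::real) < T" and f: "f \<in> C_Lp T M m1" and A: "0 < A"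
        and B: "0 < B" "C_norm T q M p (root f) = ennreal B"
        and AL: "\<Theta> * (b + 1) = 0 \<or> Linf_norm T M r (root f) = ennreal A"
      show "f \<in> C_Lp T M r"
        by (rule root_interpolation(1)[OF f T A B AL theta(1,2) _ p_pos(3) theta(4)]) simp
      let ?X = "A powr (\<Theta> * (b + 1)) * B powr ((1 - \<Theta>) * (b + 1))"
      \<comment> \<open>The perturbations by \<plusminus>\<xi> multiply the product of the two norms by L^(-1) and L.\<close>
      define L where "L = (B / A) powr z"
      have L: "0 < L" using A B by (simp add: L_def)
      have one: "\<kappa> * ((1 - \<Theta>) * (b + 1)) = 1" using theta(5) crit r by simp
      have Ldiv: "A powr z * B powr (- z) = 1 / L" "A powr (- z) * B powr z = L"
        using A B by (simp_all add: L_def powr_divide powr_minus field_simps)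
      have sa: "A powr ((\<Theta> + \<xi>) * (b + 1)) * B powr ((1 - (\<Theta> + \<xi>)) * (b + 1)) = ?X / L"
      proof -
        have e: "(\<Theta> + \<xi>) * (b + 1) = \<Theta> * (b + 1) + z" "(1 - (\<Theta> + \<xi>)) * (b + 1) = (1 - \<Theta>) * (b + 1) + (- z)"
          using \<xi> by (simp_all add: algebra_simps)
        have "A powr ((\<Theta> + \<xi>) * (b + 1)) * B powr ((1 - (\<Theta> + \<xi>)) * (b + 1)) = ?X * (A powr z * B powr (- z))"
          unfolding e powr_add by (simp only: mult_ac)
        then show ?thesis unfolding Ldiv by simp
      qed
      have sb: "A powr ((\<Theta> + - \<xi>) * (b + 1)) * B powr ((1 - (\<Theta> + - \<xi>)) * (b + 1)) = ?X * L"
      proof -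
        have e: "(\<Theta> + - \<xi>) * (b + 1) = \<Theta> * (b + 1) + (- z)" "(1 - (\<Theta> + - \<xi>)) * (b + 1) = (1 - \<Theta>) * (b + 1) + z"
          using \<xi> by (simp_all add: algebra_simps)
        have "A powr ((\<Theta> + - \<xi>) * (b + 1)) * B powr ((1 - (\<Theta> + - \<xi>)) * (b + 1)) = ?X * (A powr (- z) * B powr z)"
          unfolding e powr_add by (simp only: mult_ac)
        then show ?thesis unfolding Ldiv by simp
      qed
      have ta: "- (\<kappa> * ((1 - (\<Theta> + \<xi>)) * (b + 1))) = d - 1"
      proof -
        have "\<kappa> * ((1 - (\<Theta> + \<xi>)) * (b + 1)) = \<kappa> * ((1 - \<Theta>) * (b + 1)) - \<kappa> * (\<xi> * (b + 1))"
          by (simp add: algebra_simps)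
        then show ?thesis unfolding one \<xi> by (simp add: d_def)
      qed
      have tb: "- (\<kappa> * ((1 - (\<Theta> + - \<xi>)) * (b + 1))) = - 1 - d"
      proof -
        have "\<kappa> * ((1 - (\<Theta> + - \<xi>)) * (b + 1)) = \<kappa> * ((1 - \<Theta>) * (b + 1)) + \<kappa> * (\<xi> * (b + 1))"
          by (simp add: algebra_simps)
        then show ?thesis unfolding one \<xi> by (simp add: d_def)
      qed
      have ipa0: "0 \<le> \<Theta> + \<xi>" "\<Theta> + \<xi> < 1" "\<Theta> = 0 \<Longrightarrow> \<Theta> + \<xi> = 0" "0 < ma"
          "1 / ma = (b + 1) * ((\<Theta> + \<xi>) / r + (1 - (\<Theta> + \<xi>)) / p)"
        using \<xi>b \<Theta>0 theta(2) ma unfolding expo \<xi> by auto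
      have ipb0: "0 \<le> \<Theta> + - \<xi>" "\<Theta> + - \<xi> < 1" "\<Theta> = 0 \<Longrightarrow> \<Theta> + - \<xi> = 0" "0 < mb"
          "1 / mb = (b + 1) * ((\<Theta> + - \<xi>) / r + (1 - (\<Theta> + - \<xi>)) / p)"
        using \<xi>b \<Theta>0 theta(2) mb unfolding expo using \<xi> by auto
      note ipa = root_interpolation[OF f T A B AL ipa0, unfolded sa ta]
      note ipb = root_interpolation[OF f T A B AL ipb0, unfolded sb tb]
      fix t assume t: "0 < t" "t < T"
      have "energy M p (duhamel_int (past f t)) \<le> ennreal ((?c * ?X * t powr (- \<kappa>)) powr p)"
        by (rule duhamel_int_past_critical[OF ipa(1) ipb(1) ma(1,2) mb(1,2) t ea eb d _ L ipa(2) ipb(2)])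
          (use A B in auto)
      then show "energy M p (duhamel_int (past f t)) \<le> ennreal ((?c * T powr \<rho> * ?X * t powr (- \<kappa>)) powr p)"
        using T unfolding \<rho>0 by simp
    qed
  qed
qed

end

end

section \<open>From the hypotheses to a bounded heat kernel\<close>

lemma ball_growth:
  fixes M :: "'a::metric_space measure"
  assumes "0 < (INF (x, \<rho>) \<in> UNIV \<times> {0<..}. emeasure M (ball x \<rho>) / ennreal (\<rho> powr \<beta>))"
  obtains e where "0 < e" "\<And>x \<rho>. 0 < \<rho> \<Longrightarrow> ennreal (e * \<rho> powr \<beta>) \<le> emeasure M (ball x \<rho>)"
proof -
  from dense[OF assms] obtain z where z: "0 < z"
    "z < (INF (x, \<rho>) \<in> UNIV \<times> {0<..}. emeasure M (ball x \<rho>) / ennreal (\<rho> powr \<beta>))" by blast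
  obtain e where e: "z = ennreal e" "0 < e" using z by (cases z) auto
  show ?thesis
  proof (rule that[OF e(2)])
    fix x :: 'a and \<rho> :: real assume \<rho>: "0 < \<rho>"
    have "ennreal e \<le> emeasure M (ball x \<rho>) / ennreal (\<rho> powr \<beta>)"
      using less_imp_le[OF z(2)] \<rho> unfolding e(1) le_INF_iff by auto
    then have "ennreal e * ennreal (\<rho> powr \<beta>) \<le> emeasure M (ball x \<rho>) / ennreal (\<rho> powr \<beta>) * ennreal (\<rho> powr \<beta>)"
      by (rule mult_right_mono) simp
    also have "\<dots> = emeasure M (ball x \<rho>)"
    proof -
      have "emeasure M (ball x \<rho>) / ennreal (\<rho> powr \<beta>) * ennreal (\<rho> powr \<beta>)
        = emeasure M (ball x \<rho>) * (inverse (ennreal (\<rho> powr \<beta>)) * ennreal (\<rho> powr \<beta>))"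
        by (simp add: divide_ennreal_def mult.assoc)
      also have "inverse (ennreal (\<rho> powr \<beta>)) * ennreal (\<rho> powr \<beta>) = 1"
        using \<rho> by (simp add: inverse_ennreal ennreal_mult[symmetric])
      finally show ?thesis by simp
    qed
    finally show "ennreal (e * \<rho> powr \<beta>) \<le> emeasure M (ball x \<rho>)"
      using e(2) by (simp add: ennreal_mult)
  qed
qed

text \<open>Balls have finite measure, since the upper bound of the heat kernel would be 0 otherwise; hence the
  measure is \<sigma>-finite. The lower volume bound turns the upper bound of the heat kernel into c s^(-\<beta>/2).\<close>
lemma bounded_heat_kernelI:
  fixes M :: "'a::metric_space measure"
  assumes mms: "metric_measure_space M" and \<beta>: "0 < \<beta>" and heat: "heat_kernel M h"
    and bound: "\<exists>C>0. \<exists>c>0. \<forall>s>0. \<forall>x y. 0 < h s x y \<and>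
           ennreal (h s x y)
             \<le> ennreal c / emeasure M (ball x (sqrt s)) * ennreal (exp (- C * (dist x y)\<^sup>2 / s))"
    and growth: "0 < (INF (x, \<rho>) \<in> UNIV \<times> {0<..}. emeasure M (ball x \<rho>) / ennreal (\<rho> powr \<beta>))"
  shows "\<exists>c. bounded_heat_kernel M h c (\<beta> / 2)"
proof -
  from bound obtain C c where c: "0 < C" "0 < c" and all: "\<forall>s>0. \<forall>x y. 0 < h s x y \<and>
      ennreal (h s x y) \<le> ennreal c / emeasure M (ball x (sqrt s)) * ennreal (exp (- C * (dist x y)\<^sup>2 / s))"
    by (elim exE conjE)
  have hpos: "0 < h s x y" and hle: "ennreal (h s x y)
      \<le> ennreal c / emeasure M (ball x (sqrt s)) * ennreal (exp (- C * (dist x y)\<^sup>2 / s))" if "0 < s" for s x y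
    using all[rule_format, OF that, of x y] by simp_all
  obtain e where e: "0 < e" "\<And>x \<rho>. 0 < \<rho> \<Longrightarrow> ennreal (e * \<rho> powr \<beta>) \<le> emeasure M (ball x \<rho>)"
    using ball_growth[OF growth] by blast
  have sets: "sets M = sets borel" using mms by (simp add: metric_measure_space_def)
  then have sp: "space M = UNIV" by (metis sets_eq_imp_space_eq space_borel)
  have finite: "emeasure M (ball x (sqrt s)) \<noteq> \<infinity>" if "0 < s" for x s
  proof
    assume "emeasure M (ball x (sqrt s)) = \<infinity>"
    then have "ennreal (h s x x) \<le> 0" using hle[OF that, of x x] by simp
    then show False using hpos[OF that, of x x] by simp
  qed
  have sigma: "sigma_finite_measure M"
  proof
    fix x0 :: 'a
    let ?A = "range (\<lambda>n. ball x0 (sqrt (real (Suc n))))"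
    have "y \<in> \<Union> ?A" for y
    proof -
      obtain n where "(dist x0 y)\<^sup>2 < real n" using reals_Archimedean2 by blast
      then have "(dist x0 y)\<^sup>2 < real (Suc n)" by simp
      then have "dist x0 y < sqrt (real (Suc n))" by (rule real_less_rsqrt)
      then have "y \<in> ball x0 (sqrt (real (Suc n)))" by (simp only: mem_ball)
      then show ?thesis by (rule UnionI[OF rangeI])
    qed
    then have "\<Union> ?A = space M" using sp by auto
    moreover have "?A \<subseteq> sets M" unfolding sets by (intro image_subsetI borel_open open_ball)
    moreover have "\<forall>a\<in>?A. emeasure M a \<noteq> \<infinity>"
    proof
      fix a assume "a \<in> ?A"
      then obtain n where "a = ball x0 (sqrt (real (Suc n)))" by (rule rangeE)
      then show "emeasure M a \<noteq> \<infinity>" using finite[of "real (Suc n)" x0] by (simp only: of_nat_0_less_iff zero_less_Suc simp_thms)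
    qed
    ultimately show "\<exists>A. countable A \<and> A \<subseteq> sets M \<and> \<Union> A = space M \<and> (\<forall>a\<in>A. emeasure M a \<noteq> \<infinity>)"
      by (intro exI[of _ ?A] conjI countable_image countableI_type)
  qed
  have "emeasure M UNIV \<noteq> 0"
  proof -
    fix x :: 'a
    have "0 < ennreal (e * 1 powr \<beta>)" using e by simp
    also have "\<dots> \<le> emeasure M (ball x 1)" by (rule e(2)) simp
    also have "\<dots> \<le> emeasure M UNIV" using sets sp sets.top[of M] by (intro emeasure_mono) auto
    finally show ?thesis by simp
  qed
  moreover have "h s x y \<le> c / e * s powr (- (\<beta> / 2))" if s: "0 < s" for s x y
  proof -
    have B: "0 < e * sqrt s powr \<beta>" using e s by simp
    have "ennreal (h s x y) \<le> ennreal c / emeasure M (ball x (sqrt s)) * ennreal (exp (- C * (dist x y)\<^sup>2 / s))"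
      by (rule hle[OF s])
    also have "\<dots> \<le> ennreal c / ennreal (e * sqrt s powr \<beta>) * ennreal 1"
    proof (intro mult_mono)
      show "ennreal c / emeasure M (ball x (sqrt s)) \<le> ennreal c / ennreal (e * sqrt s powr \<beta>)"
      proof (cases "emeasure M (ball x (sqrt s))")
        case (real m)
        have "ennreal (e * sqrt s powr \<beta>) \<le> ennreal m"
          unfolding real(2)[symmetric] by (rule e(2)) (use s in simp)
        then have "e * sqrt s powr \<beta> \<le> m" using real(1) by simp
        then have m: "0 < m" and "c / m \<le> c / (e * sqrt s powr \<beta>)"
          using B c(2) by (simp_all add: divide_left_mono mult_pos_pos)
        then have "ennreal (c / m) \<le> ennreal (c / (e * sqrt s powr \<beta>))" by (intro ennreal_leI)
        then show ?thesis
          unfolding real(2) using divide_ennreal[OF less_imp_le[OF c(2)] m] divide_ennreal[OF less_imp_le[OF c(2)] B]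
          by (simp only:)
      qed (use finite[OF s, of x] in simp)
      have "- C * (dist x y)\<^sup>2 / s \<le> 0" using c s by (simp add: divide_nonpos_pos)
      then show "ennreal (exp (- C * (dist x y)\<^sup>2 / s)) \<le> ennreal 1" by (intro ennreal_leI) simp
    qed auto
    also have "\<dots> = ennreal (c / (e * sqrt s powr \<beta>))" using c B by (simp add: divide_ennreal)
    also have "sqrt s powr \<beta> = s powr (\<beta> / 2)"
      unfolding powr_half_sqrt[OF less_imp_le[OF s], symmetric] powr_powr by simp
    also have "c / (e * s powr (\<beta> / 2)) = c / e * s powr (- (\<beta> / 2))" unfolding powr_minus_divide by simp
    finally show ?thesis using c e by simp
  qed
  ultimately have "bounded_heat_kernel M h (c / e) (\<beta> / 2)"
    using sigma sp heat c e \<beta> less_imp_le[OF hpos]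
    by (intro bounded_heat_kernel.intro bounded_heat_kernel_axioms.intro) simp_all
  then show ?thesis by blast
qed

theorem theorem3p6:
  fixes M :: "'a::metric_space measure"
    and h :: "real \<Rightarrow> 'a \<Rightarrow> 'a \<Rightarrow> real"
    and \<eta> :: "real \<Rightarrow> real \<Rightarrow> real"
    and \<alpha> \<beta> b r\<^sub>0 p r \<theta> :: real
    and q :: ennreal
  assumes "metric_measure_space M"
    and "0 < \<beta>" and "ennreal \<beta> \<le> hausdorff_dim (UNIV :: 'a set)"
    and "0 < \<alpha>" and "\<alpha> < 1"
    and "heat_kernel M h"
    and "subordination_density \<alpha> \<eta>"
    and "\<exists>C>0. \<exists>c>0. \<forall>s>0. \<forall>x y. 0 < h s x y \<and>
           ennreal (h s x y)
             \<le> ennreal c / emeasure M (ball x (sqrt s)) * ennreal (exp (- C * (dist x y)\<^sup>2 / s))"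
    and "0 < (INF (x, \<rho>) \<in> UNIV \<times> {0<..}. emeasure M (ball x \<rho>) / ennreal (\<rho> powr \<beta>))"
    and "0 < b" and "r\<^sub>0 = b * \<beta> / (2 * \<alpha>)"
    and "r\<^sub>0 \<le> r" and "1 < r\<^sub>0"
    and "generalized_admissible \<alpha> \<beta> q p r"
    and "b + 1 < p"
    and "\<theta> = (p - r * (b + 1)) / ((b + 1) * (p - r))"
  shows
    "(r\<^sub>0 < p \<longrightarrow>
       (\<forall>T>0. \<forall>f \<in> C_space T (q / ennreal (b + 1)) M (p / (b + 1)).
          \<forall>t\<in>{0..<T}. duhamel_converges M \<eta> h f t)) \<and>
     (p < r * (b + 1) \<and> r\<^sub>0 < p \<longrightarrow>
       (\<exists>c>0. \<forall>T>0. \<forall>f \<in> C_space T (q / ennreal (b + 1)) M (p / (b + 1)).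
          Linf_norm T M r (duhamel M \<eta> h f)
            \<le> ennreal (c * T powr (1 - b * \<beta> / (2 * r * \<alpha>)))
               * C_norm T (q / ennreal (b + 1)) M (p / (b + 1)) f)) \<and>
     (p \<ge> r * (b + 1) \<and> r\<^sub>0 < r \<longrightarrow>
       (\<exists>c>0. \<forall>T>0. \<forall>f \<in> C_space T (q / ennreal (b + 1)) M (p / (b + 1)).
          Linf_norm T M r (duhamel M \<eta> h f)
            \<le> ennreal (c * T powr (1 - b * \<beta> / (2 * r * \<alpha>)))
               * epow (Linf_norm T M r (\<lambda>t x. \<bar>f t x\<bar> powr (1 / (b + 1)))) (\<theta> * (b + 1))
               * epow (C_norm T q M p (\<lambda>t x. \<bar>f t x\<bar> powr (1 / (b + 1)))) ((1 - \<theta>) * (b + 1)))) \<and>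
     (p < r * (b + 1) \<and> r\<^sub>0 < p \<longrightarrow>
       (\<exists>c>0. \<forall>T>0. \<forall>f \<in> C_space T (q / ennreal (b + 1)) M (p / (b + 1)).
          C_norm T q M p (duhamel M \<eta> h f)
            \<le> ennreal (c * T powr (1 - b * \<beta> / (2 * r * \<alpha>)))
               * C_norm T (q / ennreal (b + 1)) M (p / (b + 1)) f)) \<and>
     (p \<ge> r * (b + 1) \<and> (r\<^sub>0 < r \<or> r * (b + 1) < p) \<longrightarrow>
       (\<exists>c>0. \<forall>T>0. \<forall>f \<in> C_space T (q / ennreal (b + 1)) M (p / (b + 1)).
          C_norm T q M p (duhamel M \<eta> h f)
            \<le> ennreal (c * T powr (1 - b * \<beta> / (2 * r * \<alpha>)))
               * epow (Linf_norm T M r (\<lambda>t x. \<bar>f t x\<bar> powr (1 / (b + 1)))) (\<theta> * (b + 1))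
               * epow (C_norm T q M p (\<lambda>t x. \<bar>f t x\<bar> powr (1 / (b + 1)))) ((1 - \<theta>) * (b + 1))))"
proof -
  define \<gamma> where "\<gamma> = \<beta> / 2 / \<alpha>"
  define \<kappa> where "\<kappa> = \<gamma> * (1 / r - 1 / p)"
  obtain c where "bounded_heat_kernel M h c (\<beta> / 2)"
    using bounded_heat_kernelI[OF assms(1,2,6,8,9)] by blast
  then interpret bounded_heat_kernel M h c "\<beta> / 2" .
  obtain N k C where N: "N \<in> null_sets (M \<Otimes>\<^sub>M M)" and sk: "smoothing_kernel M k C (\<beta> / 2 / \<alpha>)"
    and ker: "\<And>t x y. 0 < t \<Longrightarrow> (x, y) \<notin> N \<Longrightarrow> frac_heat_kernel \<eta> h t x y = k t x y"
    and int: "\<And>t x y. 0 < t \<Longrightarrow> (x, y) \<notin> N \<Longrightarrow> set_integrable lborel {0<..} (\<lambda>\<sigma>. \<eta> t \<sigma> * h \<sigma> x y)"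
    by (rule fractional_kernel[OF assms(7,4)]) blast
  have adm: "1 / q = ennreal \<kappa>" "1 < r" "r \<le> p" "\<beta> > 2 * r * \<alpha> \<Longrightarrow> p < \<beta> * r / (\<beta> - 2 * \<alpha> * r)"
    using assms(14) by (auto simp: generalized_admissible_def \<kappa>_def \<gamma>_def)
  have \<gamma>: "0 < \<gamma>" using assms(2,4) by (simp add: \<gamma>_def)
  have \<beta>\<gamma>: "\<beta> = 2 * \<alpha> * \<gamma>" using assms(4) by (simp add: \<gamma>_def)
  have r0_eq: "r\<^sub>0 = b * \<gamma>" using assms(4,11) by (simp add: \<gamma>_def)
  have \<kappa>1: "\<kappa> < 1"
  proof (cases "r < \<gamma>")
    case True
    have "\<beta> > 2 * r * \<alpha>" using True assms(4) by (simp add: \<beta>\<gamma>)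
    from adm(4)[OF this] have "p < (2 * \<alpha>) * (\<gamma> * r) / ((2 * \<alpha>) * (\<gamma> - r))"
      by (simp add: \<beta>\<gamma> algebra_simps)
    then have "p < \<gamma> * r / (\<gamma> - r)" using assms(4) by simp
    then have "p * (\<gamma> - r) < \<gamma> * r" using True by (simp add: pos_less_divide_eq)
    then show ?thesis using adm(2,3) by (simp add: \<kappa>_def field_simps)
  next
    case False
    have "\<gamma> * (1 / r - 1 / p) < \<gamma> * (1 / r)" using \<gamma> adm by (intro mult_strict_left_mono) auto
    also have "\<dots> \<le> 1" using False adm by simp
    finally show ?thesis by (simp add: \<kappa>_def)
  qed
  interpret smoothing_kernel M k C \<gamma> using sk by (simp add: \<gamma>_def)
  interpret admissible_duhamel M k C \<gamma> h \<eta> N b p r \<kappa> q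
    by unfold_locales
      (use N ker int assms(10,12,15) adm \<gamma> \<kappa>1 in \<open>auto simp: r0_eq \<kappa>_def\<close>)
  have \<rho>: "1 - b * \<gamma> / r = 1 - b * \<beta> / (2 * r * \<alpha>)"
    by (simp add: \<gamma>_def)
  have \<theta>: "\<theta> = \<Theta>" using assms(16) by (simp add: \<Theta>_def)
  note small = duhamel_small_exponent[unfolded \<rho>]
  note large = duhamel_large_exponent_Linf[unfolded \<rho>] duhamel_large_exponent_C[unfolded \<rho>]
  show ?thesis
    unfolding r0_eq \<theta>
  proof (intro conjI impI)
    show "\<forall>T>0. \<forall>f\<in>C_space T \<sigma> M m1. \<forall>t\<in>{0..<T}. duhamel_converges M \<eta> h f t" if "b * \<gamma> < p"
      using duhamel_converges_space[OF that] by blast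
  qed (elim conjE, rule small large; assumption)+
qed

end
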